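(* Let $f(x)=g(x)+h(x)$ with $g(x)=\mathbb{E}_{z\sim\mathcal{P}}[g(x,z)]$ satisfy the assumptions in the context, with constants $\mu,L,\bar\ell$; let $f^*=\min f$ and $\kappa=L/\mu$. Fix a target accuracy $\epsilon>0$ and a probability of failure $p\in(0,1)$, and set $$T=\lceil\log_2(\kappa)\rceil,\quad m=\left\lceil18\ln\left(\frac{T+3}{p}\right)\right\rceil,\quad\delta=\frac{\epsilon}{4+2T},\quad\lambda_i=\mu2^i .$$ Then the point $x_{T+1}=\mathtt{BoostERMC}(\delta,T,m)$ (defined in the context) satisfies $$\mathbb{P}\bigl(f(x_{T+1})-f^*\le\epsilon\bigr)\ge1-p.$$ Moreover, the total number of samples used by the algorithm is $$\mathcal{O}\left(\ln^2(\kappa)\ln\left(\frac{\ln(\kappa)}{p}\right)\cdot\frac{\bar\ell^2}{\epsilon\mu}\right).$$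
   Context: Setting. $(\Omega,\mathcal{F},\mathcal{P})$ is a probability space and $f$ is closed. Assumptions: (1) $g\colon\mathbb{R}^d\times\Omega\to\mathbb{R}$ is measurable; (2) $h\colon\mathbb{R}^d\to\mathbb{R}\cup\{+\infty\}$ is convex and there is $\mu>0$ such that $x\mapsto g(x,z)+h(x)$ is $\mu$-strongly convex (i.e. convex after subtracting $\frac\mu2\|\cdot\|^2$) for a.e. $z\sim\mathcal{P}$; (3) there are a measurable $\ell\colon\Omega\to\mathbb{R}$ and a real $\bar\ell>0$ with $\sqrt{\mathbb{E}_z\ell(z)^2}\le\bar\ell$ and $|g(x,z)-g(y,z)|\le\ell(z)\|x-y\|$ for all $x,y\in U$, $z\in\Omega$, where $U$ is some open neighborhood of $\operatorname{dom}h$; (4) the function $g\colon\mathbb{R}^d\to\mathbb{R}$ (the expectation) is $L$-smooth (differentiable with $L$-Lipschitz gradient). The gradient estimator for $g$ is $\nabla g(x,z)$ (gradient in $x$), whose variance is bounded by $4\bar\ell^2$. $\mathtt{ERM}(n,\lambda,x)$: draw $n$ i.i.d. samples $z_1,\dots,z_n\sim\mathcal{P}$ ($n$ rounded up to an integer) and return the minimizer of $y\mapsto\frac1n\sum_{i=1}^ng(y,z_i)+h(y)+\frac\lambda2\|y-x\|^2$. $\mathtt{ERM\text{-}R}(n,m,\lambda,x)$: call $\mathtt{ERM}(n,\lambda,x)$ independently $m$ times to get $y_1,\dots,y_m$; for each $i$ let $r_i$ be the smallest $r\ge0$ such that more than $m/2$ of the points $y_k$ satisfy $\|y_k-y_i\|\le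 r$; return $y_{i^*}$ where $i^*$ minimizes $r_i$. $\mathtt{Extract}(\{y_i\}_{i=1}^m,\rho)$ for a pseudometric $\rho$: for each $i$ let $r_i$ be the smallest $r\ge0$ such that more than $m/2$ of the points $y_k$ satisfy $\rho(y_i,y_k)\le r$; let $\hat r$ be the median of $r_1,\dots,r_m$, meaning the $\lceil m/2\rceil$-th entry in the list sorted in increasing order; return $\{i:r_i\le\hat r\}$. $\mathtt{BoostERMC}(\delta,T,m)$: set $\lambda_{-1}=0$, $x_{-1}=0$. For $j=0,\dots,T$ set $x_j=\mathtt{ERM\text{-}R}\left(\frac{54\bar\ell^2}{(\mu+\lambda_{j-1})\delta},m,\lambda_{j-1},x_{j-1}\right)$. Then apply the following robust gap estimation step to $f^T(x)=f(x)+\frac{\lambda_T}{2}\|x-x_T\|^2$, with smooth part $g(x)+\frac{\lambda_T}2\|x-x_T\|^2$. Put $\mu'=\mu+\lambda_T$, $L'=L+\lambda_T$, $\kappa'=L'/\mu'$, $\sigma^2=4\bar\ell^2$, $\epsilon'=\frac{\delta(\mu+\lambda_T)}{222(L+\lambda_T)}$, $G(x,z)=\nabla g(x,z)+\lambda_T(x-x_T)$. (1) Generate $u_1,\dots,u_m$ by $m$ independent calls to $\mathtt{ERM}\left(\frac{6\bar\ell^2}{(\mu+\lambda_T)\epsilon'},\lambda_T,x_T\right)$. (2) $\mathcal{I}_1=\mathtt{Extract}(\{u_i\},\rho_1)$ with $\rho_1(x,x')=\|x-x'\|$. (3) Fix an arbitrary $i\in\mathcal{I}_1$ and set $\hat x=u_i$.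 Independently for $k=1,\dots,m$ let $v_k$ be the average of $G(\hat x,z)$ over $\left\lceil\frac{3\sigma^2}{\kappa'^2\mu'\epsilon'}\right\rceil$ fresh i.i.d. samples $z\sim\mathcal{P}$; let $v=v_{k^*}$, where $k^*$ minimizes the smallest radius $r_k\ge0$ such that more than $m/2$ of the points $v_l$ satisfy $\|v_k-v_l\|\le r_k$. (4) $\mathcal{I}_2=\mathtt{Extract}(\{u_i\},\rho_2)$ with $\rho_2(x,x')=|h(x)-h(x')+\langle v,x-x'\rangle|$ on $\operatorname{dom}h$. Return $x_{T+1}=u_i$ for an arbitrary $i\in\mathcal{I}_1\cap\mathcal{I}_2$.
   Formalization: For even m the set I1∩I2 may be empty, so no point is returned; the bound is proved for every admissible returned point, and a run returning none counts as success. The O-constant depends on a positive lower bound for ln κ, ln(ln κ/p) and ℓ̄²/(εμ), since the bound fails as these tend to 0. *)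

theory Defs
  imports "HOL-Probability.Probability" "HOL-Library.State_Monad"
begin

section \<open>Extended-real-valued convex functions, gradients\<close>

definition epi :: "('a \<Rightarrow> ereal) \<Rightarrow> ('a \<times> real) set" where
  "epi F = {(x, t). F x \<le> ereal t}"

definition effdom :: "('a \<Rightarrow> ereal) \<Rightarrow> 'a set" where
  "effdom F = {x. F x < \<infinity>}"

definition convex_fun :: "('a::real_vector \<Rightarrow> ereal) \<Rightarrow> bool" where
  "convex_fun F \<longleftrightarrow> convex (epi F)"

definition closed_fun :: "('a::topological_space \<Rightarrow> ereal) \<Rightarrow> bool" where
  "closed_fun F \<longleftrightarrow> closed (epi F)"

definition strongly_convex_fun :: "real \<Rightarrow> ('a::real_normed_vector \<Rightarrow> ereal) \<Rightarrow> bool" where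
  "strongly_convex_fun \<mu> F \<longleftrightarrow> convex_fun (\<lambda>x. F x - ereal (\<mu> / 2 * (norm x)\<^sup>2))"

definition smooth_fun :: "real \<Rightarrow> ('a::real_inner \<Rightarrow> real) \<Rightarrow> bool" where
  "smooth_fun L \<phi> \<longleftrightarrow> (\<exists>D. (\<forall>x. GDERIV \<phi> x :> D x) \<and> L-lipschitz_on UNIV D)"

definition grad :: "('a::real_inner \<Rightarrow> real) \<Rightarrow> 'a \<Rightarrow> 'a" where
  "grad \<phi> x = (THE D. GDERIV \<phi> x :> D)"


section \<open>Sampling\<close>

text \<open>
  A randomized procedure reads an infinite stream \<open>w\<close> of i.i.d. samples. Its state is the number of
  samples consumed so far, so successive draws are fresh, and the final state of a run started in
  \<open>0\<close> is the total number of samples the run has used.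
\<close>

definition draw :: "(nat \<Rightarrow> 'z) \<Rightarrow> nat \<Rightarrow> (nat, 'z list) state" where
  "draw w n = do {
     s \<leftarrow> State_Monad.get;
     _ \<leftarrow> State_Monad.set (s + n);
     State_Monad.return (map w [s..<s + n])
   }"

definition repeat_calls :: "nat \<Rightarrow> (nat, 'b) state \<Rightarrow> (nat, 'b list) state" where
  "repeat_calls m A = traverse_list (\<lambda>_. A) [0..<m]"

text \<open>
  Arbitrary choices (ties, ``fix an arbitrary index'') are resolved by a rule \<open>pick\<close> that may depend
  on all samples drawn so far, but not on later ones: fresh samples must stay independent of it.
\<close>

definition choose_from ::
  "('z list \<Rightarrow> nat set \<Rightarrow> nat) \<Rightarrow> (nat \<Rightarrow> 'z) \<Rightarrow> nat set \<Rightarrow> (nat, nat) state" where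
  "choose_from pick w I = do {
     s \<leftarrow> State_Monad.get;
     State_Monad.return (pick (map w [0..<s]) I)
   }"


section \<open>Robust selection\<close>

text \<open>In this section the points are \<open>ys ! 0, \<dots>, ys ! (m - 1)\<close>; the indices start at \<open>0\<close>.\<close>

definition majority_radius :: "('b \<Rightarrow> 'b \<Rightarrow> real) \<Rightarrow> 'b list \<Rightarrow> nat \<Rightarrow> real" where
  "majority_radius \<rho> ys i =
     (LEAST r. 0 \<le> r \<and>
        real (card {k. k < length ys \<and> \<rho> (ys ! i) (ys ! k) \<le> r}) > real (length ys) / 2)"

definition central_indices :: "'a::metric_space list \<Rightarrow> nat set" where
  "central_indices ys =
     {i. i < length ys \<and>
         (\<forall>k < length ys. majority_radius dist ys i \<le> majority_radius dist ys k)}"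

definition median_radius :: "('b \<Rightarrow> 'b \<Rightarrow> real) \<Rightarrow> 'b list \<Rightarrow> real" where
  "median_radius \<rho> ys =
     sort (map (majority_radius \<rho> ys) [0..<length ys]) ! (nat \<lceil>real (length ys) / 2\<rceil> - 1)"

definition extract_indices :: "('b \<Rightarrow> 'b \<Rightarrow> real) \<Rightarrow> 'b list \<Rightarrow> nat set" where
  "extract_indices \<rho> ys = {i. i < length ys \<and> majority_radius \<rho> ys i \<le> median_radius \<rho> ys}"


section \<open>Regularized empirical risk minimization\<close>

definition empirical_objective ::
  "('a::real_normed_vector \<Rightarrow> 'z \<Rightarrow> real) \<Rightarrow> ('a \<Rightarrow> ereal) \<Rightarrow> 'z list \<Rightarrow> real \<Rightarrow> 'a \<Rightarrow> 'a \<Rightarrow> ereal" where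
  "empirical_objective g h zs lam x y =
     ereal (1 / real (length zs) * (\<Sum>z\<leftarrow>zs. g y z)) + h y + ereal (lam / 2 * (norm (y - x))\<^sup>2)"

definition ERM ::
  "('a::real_normed_vector \<Rightarrow> 'z \<Rightarrow> real) \<Rightarrow> ('a \<Rightarrow> ereal) \<Rightarrow> (nat \<Rightarrow> 'z) \<Rightarrow>
   real \<Rightarrow> real \<Rightarrow> 'a \<Rightarrow> (nat, 'a) state" where
  "ERM g h w n lam x = do {
     zs \<leftarrow> draw w (nat \<lceil>n\<rceil>);
     State_Monad.return (ARG_MIN (empirical_objective g h zs lam x) y. True)
   }"

definition ERM_R ::
  "('a::real_normed_vector \<Rightarrow> 'z \<Rightarrow> real) \<Rightarrow> ('a \<Rightarrow> ereal) \<Rightarrow> ('z list \<Rightarrow> nat set \<Rightarrow> nat) \<Rightarrow>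
   (nat \<Rightarrow> 'z) \<Rightarrow> real \<Rightarrow> nat \<Rightarrow> real \<Rightarrow> 'a \<Rightarrow> (nat, 'a) state" where
  "ERM_R g h pick w n m lam x = do {
     ys \<leftarrow> repeat_calls m (ERM g h w n lam x);
     i \<leftarrow> choose_from pick w (central_indices ys);
     State_Monad.return (ys ! i)
   }"


section \<open>Sample sizes\<close>

definition stage_size :: "real \<Rightarrow> real \<Rightarrow> real \<Rightarrow> real \<Rightarrow> real" where
  "stage_size \<mu> lbar \<delta> lam = 54 * lbar\<^sup>2 / ((\<mu> + lam) * \<delta>)"

definition gap_accuracy :: "real \<Rightarrow> real \<Rightarrow> real \<Rightarrow> real \<Rightarrow> real" where
  "gap_accuracy \<mu> L \<delta> lam = \<delta> * (\<mu> + lam) / (222 * (L + lam))"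

definition gap_ERM_size :: "real \<Rightarrow> real \<Rightarrow> real \<Rightarrow> real \<Rightarrow> real \<Rightarrow> real" where
  "gap_ERM_size \<mu> L lbar \<delta> lam = 6 * lbar\<^sup>2 / ((\<mu> + lam) * gap_accuracy \<mu> L \<delta> lam)"

definition gap_grad_size :: "real \<Rightarrow> real \<Rightarrow> real \<Rightarrow> real \<Rightarrow> real \<Rightarrow> nat" where
  "gap_grad_size \<mu> L lbar \<delta> lam =
     (let \<mu>' = \<mu> + lam; L' = L + lam; \<kappa>' = L' / \<mu>'; sigma2 = 4 * lbar\<^sup>2;
          \<epsilon>' = gap_accuracy \<mu> L \<delta> lam
      in nat \<lceil>3 * sigma2 / (\<kappa>'\<^sup>2 * \<mu>' * \<epsilon>')\<rceil>)"


section \<open>BoostERMC\<close>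

text \<open>\<open>prev_reg lam j\<close> is $\lambda_{j-1}$, with $\lambda_{-1} = 0$.\<close>

definition prev_reg :: "(nat \<Rightarrow> real) \<Rightarrow> nat \<Rightarrow> real" where
  "prev_reg lam j = (case j of 0 \<Rightarrow> 0 | Suc i \<Rightarrow> lam i)"

text \<open>\<open>boost_stages \<dots> j\<close> computes $x_{j-1}$, with $x_{-1} = 0$.\<close>

primrec boost_stages ::
  "('a::real_normed_vector \<Rightarrow> 'z \<Rightarrow> real) \<Rightarrow> ('a \<Rightarrow> ereal) \<Rightarrow> ('z list \<Rightarrow> nat set \<Rightarrow> nat) \<Rightarrow>
   (nat \<Rightarrow> 'z) \<Rightarrow> real \<Rightarrow> real \<Rightarrow> (nat \<Rightarrow> real) \<Rightarrow> real \<Rightarrow> nat \<Rightarrow> nat \<Rightarrow> (nat, 'a) state" where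
  "boost_stages g h pick w \<mu> lbar lam \<delta> m 0 = State_Monad.return 0"
| "boost_stages g h pick w \<mu> lbar lam \<delta> m (Suc j) = do {
     x \<leftarrow> boost_stages g h pick w \<mu> lbar lam \<delta> m j;
     ERM_R g h pick w (stage_size \<mu> lbar \<delta> (prev_reg lam j)) m (prev_reg lam j) x
   }"

text \<open>One average of $n$ fresh values of $G(\hat x, z) = \nabla g(\hat x, z) + \lambda_T (\hat x - x_T)$.\<close>

definition averaged_gradient ::
  "('a::real_inner \<Rightarrow> 'z \<Rightarrow> real) \<Rightarrow> (nat \<Rightarrow> 'z) \<Rightarrow> nat \<Rightarrow> real \<Rightarrow> 'a \<Rightarrow> 'a \<Rightarrow> (nat, 'a) state" where
  "averaged_gradient g w n lam xT xhat = do {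
     zs \<leftarrow> draw w n;
     State_Monad.return
       ((1 / real n) *\<^sub>R (\<Sum>z\<leftarrow>zs. grad (\<lambda>x. g x z) xhat + lam *\<^sub>R (xhat - xT)))
   }"

definition gap_pseudometric :: "('a::real_inner \<Rightarrow> ereal) \<Rightarrow> 'a \<Rightarrow> 'a \<Rightarrow> 'a \<Rightarrow> real" where
  "gap_pseudometric h v x y = \<bar>real_of_ereal (h x) - real_of_ereal (h y) + inner v (x - y)\<bar>"

text \<open>
  The result is the set of all points the algorithm may return: the final index is an arbitrary
  element of $\mathcal{I}_1 \cap \mathcal{I}_2$. This intersection, and with it the result, can be
  empty when $m$ is even, because each of the two index sets may have exactly $m/2$ elements.
\<close>

definition robust_gap_step ::
  "('a::real_inner \<Rightarrow> 'z \<Rightarrow> real) \<Rightarrow> ('a \<Rightarrow> ereal) \<Rightarrow> ('z list \<Rightarrow> nat set \<Rightarrow> nat) \<Rightarrow>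
   (nat \<Rightarrow> 'z) \<Rightarrow> real \<Rightarrow> real \<Rightarrow> real \<Rightarrow> real \<Rightarrow> nat \<Rightarrow> real \<Rightarrow> 'a \<Rightarrow> (nat, 'a set) state" where
  "robust_gap_step g h pick w \<mu> L lbar \<delta> m lamT xT = do {
     us \<leftarrow> repeat_calls m (ERM g h w (gap_ERM_size \<mu> L lbar \<delta> lamT) lamT xT);
     let I1 = extract_indices dist us;
     i \<leftarrow> choose_from pick w I1;
     vs \<leftarrow> repeat_calls m
             (averaged_gradient g w (gap_grad_size \<mu> L lbar \<delta> lamT) lamT xT (us ! i));
     k \<leftarrow> choose_from pick w (central_indices vs);
     let I2 = extract_indices (gap_pseudometric h (vs ! k)) us;
     State_Monad.return {us ! i | i. i \<in> I1 \<inter> I2}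
   }"

definition BoostERMC ::
  "('a::real_inner \<Rightarrow> 'z \<Rightarrow> real) \<Rightarrow> ('a \<Rightarrow> ereal) \<Rightarrow> ('z list \<Rightarrow> nat set \<Rightarrow> nat) \<Rightarrow>
   (nat \<Rightarrow> 'z) \<Rightarrow> real \<Rightarrow> real \<Rightarrow> real \<Rightarrow> (nat \<Rightarrow> real) \<Rightarrow> real \<Rightarrow> nat \<Rightarrow> nat \<Rightarrow>
   (nat, 'a set) state" where
  "BoostERMC g h pick w \<mu> L lbar lam \<delta> T m = do {
     xT \<leftarrow> boost_stages g h pick w \<mu> lbar lam \<delta> m (Suc T);
     robust_gap_step g h pick w \<mu> L lbar \<delta> m (lam T) xT
   }"

text \<open>
  The number of samples depends on the numerical parameters only. It is given as a function of
  these, so that the constant in a bound on it cannot depend on the dimension, on the sample space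
  or on the functions.
\<close>

definition BoostERMC_samples ::
  "real \<Rightarrow> real \<Rightarrow> real \<Rightarrow> (nat \<Rightarrow> real) \<Rightarrow> real \<Rightarrow> nat \<Rightarrow> nat \<Rightarrow> nat" where
  "BoostERMC_samples \<mu> L lbar lam \<delta> T m =
     m * (\<Sum>j\<le>T. nat \<lceil>stage_size \<mu> lbar \<delta> (prev_reg lam j)\<rceil>)
     + m * nat \<lceil>gap_ERM_size \<mu> L lbar \<delta> (lam T)\<rceil>
     + m * gap_grad_size \<mu> L lbar \<delta> (lam T)"


section \<open>Parameter choices\<close>

text \<open>For $\kappa \le 1/2$, where the ceiling is negative, the number of stages is read as $0$.\<close>

definition num_stages :: "real \<Rightarrow> nat" where
  "num_stages \<kappa> = nat \<lceil>log 2 \<kappa>\<rceil>"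

definition num_trials :: "nat \<Rightarrow> real \<Rightarrow> nat" where
  "num_trials T p = nat \<lceil>18 * ln ((real T + 3) / p)\<rceil>"

definition stage_accuracy :: "nat \<Rightarrow> real \<Rightarrow> real" where
  "stage_accuracy T \<epsilon> = \<epsilon> / (4 + 2 * real T)"

definition reg_params :: "real \<Rightarrow> nat \<Rightarrow> real" where
  "reg_params \<mu> i = \<mu> * 2 ^ i"

end

theory Submission
  imports Defs
begin

text \<open>A single trial is controlled only in expectation; Markov's inequality at three times the
  mean turns this into the success probability 2/3. The obstacle to boosting is that
  \<open>h\<close> may be nonsmooth and infinite, so a point near the minimizer can have a value far
  above the minimum. Selection by distance thus says nothing about the objective, and
  \<open>gbar\<close> cannot be evaluated exactly. Differences of the linearized objective can be
  computed, and they form a pseudometric in which a second selection is made. Its error is quadratic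
  in the distance with factor \<open>L + lam\<close>, while squared distances are bounded through
  \<open>\<mu> + lam\<close>; the quotient is the condition number lost in the last step.

  The failure budget is \<open>p / (real T + 3)\<close> per event: \<open>T + 1\<close> stages, the
  last minimizers and the last gradients. Much of the work is measurability of minimizers, gradients
  and choices, and freshness of each batch. Freshness rests on fixed positions of the blocks in the
  stream and on functions of a prefix, in place of conditional expectations.\<close>

text \<open>
With \<open>m\<close> independent trials that each succeed with probability at least \<open>2 / 3\<close>, a majority
  succeeds except with probability \<open>exp (- m / 18)\<close>; selecting by majority radii therefore boosts
  the guarantees in expectation of empirical risk minimization (by stability) and of averaged
  gradients (by their variance) to high probability, at the price of a factor \<open>3\<close> in the distance.

  A regularized minimizer is thus only located in distance, with \<open>(\<mu> + \<lambda>\<^sub>j\<^sub>-\<^sub>1) / 2\<close> times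
  the squared error at most \<open>\<delta>\<close>. As \<open>\<lambda>\<^sub>j\<close> is at most \<open>2 (\<mu> + \<lambda>\<^sub>j\<^sub>-\<^sub>1)\<close>, recentring at the computed
  point raises the optimal value by at most \<open>2 \<delta>\<close>. In the
  last step the accuracy is smaller than \<open>\<delta>\<close> by a factor proportional to the condition number of the
  regularized problem, so that linearizing the smooth part at one approximate minimizer is precise
  enough to select a point within \<open>\<delta>\<close> of the optimal value; after \<open>T\<close> stages that condition number
  is at most \<open>2\<close>, which bounds the cost of this step.

  All events are tracked on the space of infinite sample sequences. Since strong convexity is only
  assumed for almost every sample, the integrand is first changed on a null set of samples; the
  completion in the statement makes the original event measurable.
\<close>

section \<open>Strongly convex functions and their minimizers\<close>

definition strongly_convex_on :: "real \<Rightarrow> 'a::real_inner set \<Rightarrow> ('a \<Rightarrow> real) \<Rightarrow> bool" where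
  "strongly_convex_on \<mu> C u \<longleftrightarrow>
     (\<forall>x\<in>C. \<forall>y\<in>C. \<forall>t\<in>{0..1}. (1 - t) *\<^sub>R x + t *\<^sub>R y \<in> C \<and>
        u ((1 - t) *\<^sub>R x + t *\<^sub>R y) + \<mu> / 2 * (t * (1 - t)) * (norm (x - y))^2
          \<le> (1 - t) * u x + t * u y)"

definition epi_on :: "'a set \<Rightarrow> ('a \<Rightarrow> real) \<Rightarrow> ('a \<times> real) set" where
  "epi_on C u = {(x, t). x \<in> C \<and> u x \<le> t}"

text \<open>Quadratic growth is what is used of strong convexity once minimizers exist: it yields
  uniqueness, stability under a change of samples, and distances from objective gaps.\<close>

definition growth_min :: "real \<Rightarrow> 'a::real_normed_vector set \<Rightarrow> ('a \<Rightarrow> real) \<Rightarrow> 'a \<Rightarrow> bool" where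
  "growth_min \<mu> C u x \<longleftrightarrow> x \<in> C \<and> (\<forall>y\<in>C. u x + \<mu> / 2 * (norm (y - x))^2 \<le> u y)"

lemma norm_convex_combination_sq:
  fixes x y :: "'a::real_inner"
  shows "(norm ((1 - t) *\<^sub>R x + t *\<^sub>R y))^2 + t * (1 - t) * (norm (x - y))^2
           = (1 - t) * (norm x)^2 + t * (norm y)^2"
  unfolding power2_norm_eq_inner
  by (simp add: inner_add_left inner_add_right inner_diff_left inner_diff_right inner_commute
      algebra_simps)

text \<open>The points \<open>(x, a - q x)\<close> and \<open>(y, b - q y)\<close> lie in the convex
  epigraph of \<open>F\<close> minus the quadratic \<open>q\<close>, hence so does their
  combination. Adding \<open>q\<close> back through the identity for the squared norm leaves exactly
  the strong convexity term.\<close>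

lemma strongly_convex_on_real_of_ereal:
  fixes F :: "'a::real_inner \<Rightarrow> ereal"
  assumes "strongly_convex_fun \<mu> F" and nm: "\<And>x. F x \<noteq> -\<infinity>"
  shows "strongly_convex_on \<mu> (effdom F) (\<lambda>x. real_of_ereal (F x))"
  unfolding strongly_convex_on_def
proof (intro ballI)
  fix x y and t :: real assume x: "x \<in> effdom F" and y: "y \<in> effdom F" and t: "t \<in> {0..1}"
  define G where "G = (\<lambda>x. F x - ereal (\<mu> / 2 * (norm x)^2))"
  define q where "q = (\<lambda>x::'a. \<mu> / 2 * (norm x)^2)"
  have cvx: "convex (epi G)"
    using assms(1) by (simp add: strongly_convex_fun_def convex_fun_def G_def)
  define a where "a = real_of_ereal (F x)"
  define b where "b = real_of_ereal (F y)"
  have Fx: "F x = ereal a" and Fy: "F y = ereal b"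
    using x y nm[of x] nm[of y] by (cases "F x"; cases "F y"; simp add: effdom_def a_def b_def)+
  define z where "z = (1 - t) *\<^sub>R x + t *\<^sub>R y"
  have "(1 - t) *\<^sub>R (x, a - q x) + t *\<^sub>R (y, b - q y) \<in> epi G"
    using t cvx by (intro convexD) (auto simp: epi_def G_def q_def Fx Fy)
  then have "G z \<le> ereal ((1 - t) * (a - q x) + t * (b - q y))"
    by (simp add: epi_def z_def)
  then have *: "F z \<le> ereal ((1 - t) * (a - q x) + t * (b - q y) + q z)"
    by (cases "F z") (auto simp: G_def q_def algebra_simps)
  then have z: "z \<in> effdom F" by (auto simp: effdom_def intro: le_less_trans)
  then obtain c where c: "F z = ereal c" using nm[of z] by (cases "F z") (auto simp: effdom_def)
  have 1: "c \<le> (1 - t) * (a - q x) + t * (b - q y) + q z" using * c by simp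
  have "\<mu> / 2 * ((norm z)^2 + t * (1 - t) * (norm (x - y))^2)
      = \<mu> / 2 * ((1 - t) * (norm x)^2 + t * (norm y)^2)"
    unfolding z_def norm_convex_combination_sq ..
  then have 2: "q z + \<mu> / 2 * (t * (1 - t)) * (norm (x - y))^2 = (1 - t) * q x + t * q y"
    unfolding q_def by argo
  have "c + \<mu> / 2 * (t * (1 - t)) * (norm (x - y))^2 \<le> (1 - t) * a + t * b"
    using 1 2 by (simp add: algebra_simps)
  with z show "(1 - t) *\<^sub>R x + t *\<^sub>R y \<in> effdom F \<and>
      real_of_ereal (F ((1 - t) *\<^sub>R x + t *\<^sub>R y)) + \<mu> / 2 * (t * (1 - t)) * (norm (x - y))^2
        \<le> (1 - t) * real_of_ereal (F x) + t * real_of_ereal (F y)"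
    by (simp add: z_def[symmetric] c Fx Fy)
qed

lemma strongly_convex_on_add_prox:
  assumes "strongly_convex_on \<mu> C u"
  shows "strongly_convex_on (\<mu> + l) C (\<lambda>y. u y + l / 2 * (norm (y - x))^2)"
  unfolding strongly_convex_on_def
proof (intro ballI conjI)
  fix a b and t :: real assume h: "a \<in> C" "b \<in> C" "t \<in> {0..1}"
  define z where "z = (1 - t) *\<^sub>R a + t *\<^sub>R b"
  show "(1 - t) *\<^sub>R a + t *\<^sub>R b \<in> C"
    using assms h by (auto simp: strongly_convex_on_def)
  have 1: "u z + \<mu> / 2 * (t * (1 - t)) * (norm (a - b))^2 \<le> (1 - t) * u a + t * u b"
    using assms h unfolding strongly_convex_on_def z_def by blast
  have zx: "z - x = (1 - t) *\<^sub>R (a - x) + t *\<^sub>R (b - x)"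
    unfolding z_def by (simp add: algebra_simps)
  have "l / 2 * ((norm (z - x))^2 + t * (1 - t) * (norm (a - b))^2)
      = l / 2 * ((1 - t) * (norm (a - x))^2 + t * (norm (b - x))^2)"
    unfolding zx norm_convex_combination_sq[of t "a - x" "b - x", symmetric] by simp
  with 1 show "u ((1 - t) *\<^sub>R a + t *\<^sub>R b) + l / 2 * (norm ((1 - t) *\<^sub>R a + t *\<^sub>R b - x))^2
      + (\<mu> + l) / 2 * (t * (1 - t)) * (norm (a - b))^2
      \<le> (1 - t) * (u a + l / 2 * (norm (a - x))^2) + t * (u b + l / 2 * (norm (b - x))^2)"
    unfolding z_def[symmetric] by (simp add: algebra_simps add_divide_distrib diff_divide_distrib)
qed

section \<open>Existence, uniqueness and quadratic growth of minimizers\<close>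

lemma closed_epi_attains_min:
  fixes u :: "'a::euclidean_space \<Rightarrow> real"
  assumes cl: "closed (epi_on C u)" and K: "compact K" "K \<inter> C \<noteq> {}"
  shows "\<exists>x\<in>K \<inter> C. \<forall>y\<in>K \<inter> C. u x \<le> u y"
proof -
  define Lv where "Lv = (\<lambda>y. {x \<in> C. u x \<le> u y})"
  have clL: "closed (Lv y)" for y
  proof -
    have "Lv y = (\<lambda>x. (x, u y)) -` epi_on C u"
      by (auto simp: Lv_def epi_on_def)
    then show ?thesis
      using closed_vimage[OF cl, of "\<lambda>x. (x, u y)"] by (simp add: continuous_intros)
  qed
  \<comment> \<open>The sets \<open>Lv y\<close> are closed, being sections of the closed epigraph.
    Finitely many of them share the point of least value, so compactness gives a point of
    \<open>K\<close> common to all.\<close>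
  have "K \<inter> \<Inter> (Lv ` (K \<inter> C)) \<noteq> {}"
  proof (rule compact_imp_fip[OF K(1)])
    fix F' assume F': "finite F'" "F' \<subseteq> Lv ` (K \<inter> C)"
    then obtain A where A: "A \<subseteq> K \<inter> C" "finite A" "F' = Lv ` A"
      using finite_subset_image by metis
    show "K \<inter> \<Inter> F' \<noteq> {}"
    proof (cases "A = {}")
      case True then show ?thesis using A K by auto
    next
      case False
      then obtain y0 where y0: "y0 \<in> A" "\<forall>y\<in>A. u y0 \<le> u y"
        using arg_min_if_finite[OF A(2) False, of u] by (meson linorder_le_less_linear)
      then have "y0 \<in> K \<inter> \<Inter> F'" using A by (auto simp: Lv_def)
      then show ?thesis by blast
    qed
  qed (use clL in auto)
  then show ?thesis using K(2) by (fastforce simp: Lv_def)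
qed

text \<open>Minimizing over a ball suffices: if a point at distance \<open>n > 1\<close> from
  \<open>x0\<close> has value at most \<open>u x0\<close>, strong convexity along the segment gives
  a value at most \<open>u x0 - \<mu> / 2 * (n - 1)\<close> at distance 1, where \<open>u xb\<close>
  is a lower bound. This is the origin of \<open>R\<close>.\<close>

lemma strongly_convex_attains_min:
  fixes u :: "'a::euclidean_space \<Rightarrow> real"
  assumes sc: "strongly_convex_on \<mu> C u" and \<mu>: "\<mu> > 0" and cl: "closed (epi_on C u)" and C: "C \<noteq> {}"
  shows "\<exists>x. growth_min \<mu> C u x"
proof -
  obtain x0 where x0: "x0 \<in> C" using C by auto
  have ne: "cball x0 r \<inter> C \<noteq> {}" if "0 \<le> r" for r using x0 that by (auto intro!: exI[of _ x0] simp: set_eq_iff)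
  obtain xb where xb: "xb \<in> cball x0 1 \<inter> C" "\<forall>y\<in>cball x0 1 \<inter> C. u xb \<le> u y"
    using closed_epi_attains_min[OF cl compact_cball ne, of 1] by fastforce
  define R where "R = 1 + 2 * (u x0 - u xb) / \<mu>"
  have le: "u xb \<le> u x0" using xb x0 by auto
  have R1: "R \<ge> 1" using le \<mu> by (auto simp: R_def)
  have inR: "y \<in> cball x0 R" if y: "y \<in> C" "u y \<le> u x0" for y
  proof (cases "norm (y - x0) \<le> 1")
    case True then show ?thesis using R1 by (simp add: dist_norm norm_minus_commute)
  next
    case False
    define n where "n = norm (y - x0)"
    have n: "n > 1" using False by (simp add: n_def)
    define p where "p = (1 - 1 / n) *\<^sub>R x0 + (1 / n) *\<^sub>R y"
    have tr: "1 / n \<in> {0..1}" using n by auto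
    have p: "p \<in> C" and 1: "u p + \<mu> / 2 * (1 / n * (1 - 1 / n)) * (norm (x0 - y))^2
        \<le> (1 - 1 / n) * u x0 + 1 / n * u y"
      using sc x0 y(1) tr unfolding strongly_convex_on_def p_def by blast+
    have "p - x0 = (1 / n) *\<^sub>R (y - x0)" by (simp add: p_def algebra_simps)
    then have "norm (p - x0) = \<bar>1 / n\<bar> * norm (y - x0)" by (simp only: norm_scaleR)
    then have "norm (p - x0) = 1" using n by (simp add: n_def[symmetric])
    then have "u xb \<le> u p" using xb p by (simp add: dist_norm norm_minus_commute)
    moreover have "1 / n * u y \<le> 1 / n * u x0" using y n by (intro mult_left_mono) auto
    moreover have X: "(1 / n * (1 - 1 / n)) * (norm (x0 - y))^2 = n - 1"
      using n unfolding norm_minus_commute[of x0 y] n_def[symmetric]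
      by (simp add: field_simps power2_eq_square)
    moreover have "u p + \<mu> / 2 * (n - 1) \<le> (1 - 1 / n) * u x0 + 1 / n * u y"
      using 1 unfolding mult.assoc[of "\<mu> / 2"] X .
    moreover have "(1 - 1 / n) * u x0 = u x0 - 1 / n * u x0" by (simp only: left_diff_distrib mult_1)
    ultimately have "u xb + \<mu> / 2 * (n - 1) \<le> u x0" by linarith
    then have "n \<le> R" using \<mu> unfolding R_def by (simp add: field_simps)
    then show ?thesis by (simp add: dist_norm norm_minus_commute n_def)
  qed
  obtain x where x: "x \<in> cball x0 R \<inter> C" "\<forall>y\<in>cball x0 R \<inter> C. u x \<le> u y"
    using closed_epi_attains_min[OF cl compact_cball ne, of R] R1 by fastforce
  have mn: "u x \<le> u y" if "y \<in> C" for y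
  proof (cases "u y \<le> u x0")
    case True then show ?thesis using inR that x by auto
  next
    case False
    moreover have "u x \<le> u x0" using x x0 R1 by auto
    ultimately show ?thesis by simp
  qed
  have "u x + \<mu> / 2 * (norm (y - x))^2 \<le> u y" if y: "y \<in> C" for y
  proof -
    \<comment> \<open>Strong convexity at parameter \<open>t\<close>, divided by \<open>t\<close>,
      gives the bound with the factor \<open>s = 1 - t\<close>. Letting \<open>s\<close> range over
      all numbers below 1 replaces the limit of \<open>t\<close> to 0.\<close>
    have "\<mu> / 2 * (norm (y - x))^2 \<le> u y - u x"
    proof (rule field_le_mult_one_interval)
      fix s :: real assume s: "0 < s" "s < 1"
      define t where "t = 1 - s"
      have t: "t \<in> {0..1}" "t > 0" using s by (auto simp: t_def)
      have "(1 - t) *\<^sub>R x + t *\<^sub>R y \<in> C"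
        and 1: "u ((1 - t) *\<^sub>R x + t *\<^sub>R y) + \<mu> / 2 * (t * (1 - t)) * (norm (x - y))^2
                 \<le> (1 - t) * u x + t * u y"
        using sc x y t unfolding strongly_convex_on_def by blast+
      then have "u x \<le> u ((1 - t) *\<^sub>R x + t *\<^sub>R y)" using mn by blast
      with 1 have "u x + \<mu> / 2 * (t * (1 - t)) * (norm (x - y))^2 \<le> (1 - t) * u x + t * u y" by simp
      then have "t * (s * (\<mu> / 2 * (norm (y - x))^2)) \<le> t * (u y - u x)"
        by (simp add: t_def norm_minus_commute algebra_simps)
      then show "s * (\<mu> / 2 * (norm (y - x))^2) \<le> u y - u x"
        using t(2) by simp
    qed
    then show ?thesis by simp
  qed
  then show ?thesis using x unfolding growth_min_def by blast
qed

lemma growth_min_unique: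
  assumes "growth_min \<mu> C u x" "\<mu> > 0" "y \<in> C" "u y \<le> u x"
  shows "y = x"
proof -
  have "\<mu> / 2 * (norm (y - x))^2 \<le> 0" using assms unfolding growth_min_def by fastforce
  then have "(norm (y - x))^2 \<le> 0" using assms(2) by (simp add: mult_le_0_iff)
  then show ?thesis by simp
qed

lemma arg_min_on_growth_min:
  assumes "growth_min \<mu> C u x" "\<mu> > 0"
  shows "arg_min_on u C = x"
  unfolding arg_min_on_def
proof (rule arg_minI)
  have ge: "u x \<le> u y" if "y \<in> C" for y
  proof -
    have "0 \<le> \<mu> / 2 * (norm (y - x))^2" using assms(2) by simp
    with that assms(1) show ?thesis unfolding growth_min_def by fastforce
  qed
  show "x \<in> C" using assms by (simp add: growth_min_def)
  show "\<not> u y < u x" if "y \<in> C" for y using ge[OF that] by simp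
  show "z = x" if "z \<in> C" "\<forall>y. y \<in> C \<longrightarrow> \<not> u y < u z" for z
    using that assms growth_min_unique[OF assms(1,2), of z] by (auto simp: growth_min_def)
qed

lemma growth_min_arg_min_on:
  assumes "growth_min \<mu> C u x" "\<mu> > 0"
  shows "growth_min \<mu> C u (arg_min_on u C)"
  using assms arg_min_on_growth_min by metis

text \<open>\<open>C\<close> need not be closed and \<open>\<psi>\<close> is controlled only on
  \<open>C\<close>, so continuity is useless until the limit point is known to lie in
  \<open>C\<close>. Uniform continuity makes \<open>\<psi>\<close> converge along the sequence
  anyway; subtracting its limit gives a point in the epigraph of \<open>u\<close>, which places the
  limit point in \<open>C\<close>.\<close>

lemma closed_epi_on_add:
  fixes u \<psi> :: "'a::euclidean_space \<Rightarrow> real"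
  assumes cl: "closed (epi_on C u)" and u: "uniformly_continuous_on C \<psi>"
  shows "closed (epi_on C (\<lambda>x. u x + \<psi> x))"
  unfolding closed_sequential_limits
proof (intro allI impI, elim conjE)
  fix s l assume s: "\<forall>n. s n \<in> epi_on C (\<lambda>x. u x + \<psi> x)" "s \<longlonglongrightarrow> l"
  have xl: "(\<lambda>n. fst (s n)) \<longlonglongrightarrow> fst l" and tl: "(\<lambda>n. snd (s n)) \<longlonglongrightarrow> snd l"
    using s(2) by (auto intro: tendsto_intros)
  have xC: "fst (s n) \<in> C" and le: "u (fst (s n)) + \<psi> (fst (s n)) \<le> snd (s n)" for n
    using s(1)[rule_format, of n] by (auto simp: epi_on_def split: prod.splits)
  have "Cauchy (\<lambda>n. \<psi> (fst (s n)))"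
    using uniformly_continuous_on_Cauchy[OF u LIMSEQ_imp_Cauchy[OF xl]] xC by blast
  then obtain c where c: "(\<lambda>n. \<psi> (fst (s n))) \<longlonglongrightarrow> c"
    using Cauchy_convergent convergent_def by blast
  have "(\<lambda>n. (fst (s n), snd (s n) - \<psi> (fst (s n)))) \<longlonglongrightarrow> (fst l, snd l - c)"
    by (intro tendsto_intros xl tl c)
  moreover have "\<forall>n. (fst (s n), snd (s n) - \<psi> (fst (s n))) \<in> epi_on C u"
    using xC le by (auto simp: epi_on_def algebra_simps)
  ultimately have e: "(fst l, snd l - c) \<in> epi_on C u"
    using closed_sequentially[OF cl, of "\<lambda>n. (fst (s n), snd (s n) - \<psi> (fst (s n)))"] by blast
  then have lC: "fst l \<in> C" by (simp add: epi_on_def)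
  have "(\<lambda>n. \<psi> (fst (s n))) \<longlonglongrightarrow> \<psi> (fst l)"
    by (rule continuous_on_tendsto_compose[OF uniformly_continuous_imp_continuous[OF u] xl lC])
       (use xC in auto)
  then have "c = \<psi> (fst l)" using c LIMSEQ_unique by blast
  with e show "l \<in> epi_on C (\<lambda>x. u x + \<psi> x)" by (auto simp: epi_on_def split: prod.splits)
qed

lemma closed_epi_on_add_continuous:
  fixes u \<psi> :: "'a::euclidean_space \<Rightarrow> real"
  assumes cl: "closed (epi_on C u)" and u: "continuous_on UNIV \<psi>"
  shows "closed (epi_on C (\<lambda>x. u x + \<psi> x))"
proof -
  have "epi_on C (\<lambda>x. u x + \<psi> x) = (\<lambda>p. (fst p, snd p - \<psi> (fst p))) -` epi_on C u"
    by (auto simp: epi_on_def algebra_simps)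
  moreover have "continuous_on UNIV (\<lambda>p::'a \<times> real. (fst p, snd p - \<psi> (fst p)))"
    by (intro continuous_intros continuous_on_compose2[OF u]) auto
  ultimately show ?thesis using closed_vimage[OF cl] by simp
qed

text \<open>The minimizer is the limit of the first points of \<open>D\<close> whose values come within
  \<open>1 / (k + 1)\<close> of the infimum over \<open>D\<close>; quadratic growth forces the convergence.\<close>

lemma borel_measurable_arg_min_on:
  fixes u :: "'s \<Rightarrow> 'a::euclidean_space \<Rightarrow> real"
  assumes D: "countable D" "D \<subseteq> C" and \<mu>: "\<mu> > 0"
    and dense: "\<And>s y e. s \<in> space N \<Longrightarrow> y \<in> C \<Longrightarrow> e > 0 \<Longrightarrow> \<exists>d\<in>D. u s d < u s y + e"
    and gr: "\<And>s. s \<in> space N \<Longrightarrow> \<exists>x. growth_min \<mu> C (u s) x"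
    and meas: "\<And>y. y \<in> D \<Longrightarrow> (\<lambda>s. u s y) \<in> borel_measurable N"
  shows "(\<lambda>s. arg_min_on (u s) C) \<in> borel_measurable N"
proof (cases "space N = {}")
  case True
  then show ?thesis by (auto simp: measurable_def)
next
  case False
  then have "D \<noteq> {}" using gr dense[of _ _ 1] by (fastforce simp: growth_min_def)
  define e where "e = from_nat_into D"
  have eD: "range e = D" unfolding e_def using D(1) \<open>D \<noteq> {}\<close> by (simp add: range_from_nat_into)
  then have eD': "e i \<in> D" for i by auto
  have [measurable]: "(\<lambda>s. u s (e i)) \<in> borel_measurable N" for i using meas eD' by blast
  define I where "I = (\<lambda>k s. LEAST i. \<forall>j. u s (e i) \<le> u s (e j) + 1 / real (Suc k))"
  have [measurable]: "I k \<in> measurable N (count_space UNIV)" for k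
    unfolding I_def by measurable
  have [measurable]: "(\<lambda>s. e (I k s)) \<in> borel_measurable N" for k
    by measurable
  show ?thesis
  proof (rule borel_measurable_LIMSEQ_metric)
    show "(\<lambda>s. e (I k s)) \<in> borel_measurable N" for k by measurable
    fix s assume s: "s \<in> space N"
    obtain x where x: "growth_min \<mu> C (u s) x" using gr[OF s] by auto
    have xC: "x \<in> C" and xg: "\<And>y. y \<in> C \<Longrightarrow> u s x + \<mu> / 2 * (norm (y - x))^2 \<le> u s y"
      using x by (auto simp: growth_min_def)
    have xm: "u s x \<le> u s y" if "y \<in> C" for y
    proof -
      have "0 \<le> \<mu> / 2 * (norm (y - x))^2" using \<mu> by simp
      then show ?thesis using xg[OF that] by linarith
    qed
    have ex: "\<exists>i. \<forall>j. u s (e i) \<le> u s (e j) + 1 / real (Suc k)" for k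
    proof -
      obtain d where d: "d \<in> D" "u s d < u s x + 1 / real (Suc k)"
        using dense[OF s xC, of "1 / real (Suc k)"] by auto
      obtain i where "d = e i" using d eD by auto
      then show ?thesis using d xm eD' D(2) by (intro exI[of _ i]) (smt (verit) subsetD)
    qed
    have b: "u s (e (I k s)) \<le> u s x + 1 / real (Suc k)" for k
    proof (rule field_le_epsilon)
      fix t :: real assume "t > 0"
      then obtain d where d: "d \<in> D" "u s d < u s x + t" using dense[OF s xC] by blast
      obtain j where "d = e j" using d eD by auto
      moreover have "\<forall>j. u s (e (I k s)) \<le> u s (e j) + 1 / real (Suc k)"
        unfolding I_def by (rule LeastI_ex[OF ex])
      ultimately show "u s (e (I k s)) \<le> u s x + 1 / real (Suc k) + t" using d by (smt (verit))
    qed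
    have aux: "a \<le> 2 / \<mu> * b" if "\<mu> / 2 * a \<le> b" for a b
      using that \<mu> by (simp add: field_simps)
    have "(norm (e (I k s) - x))^2 \<le> 2 / \<mu> * (1 / real (Suc k))" for k
    proof -
      have "\<mu> / 2 * (norm (e (I k s) - x))^2 \<le> 1 / real (Suc k)"
        using b[of k] xg[of "e (I k s)"] eD' D(2) by fastforce
      then show ?thesis by (rule aux)
    qed
    then have le: "eventually (\<lambda>k. norm ((norm (e (I k s) - x))^2) \<le> 2 / \<mu> * (1 / real (Suc k))) sequentially"
      by (intro always_eventually) simp
    have "(\<lambda>k. 2 / \<mu> * (1 / real (Suc k))) \<longlonglongrightarrow> 2 / \<mu> * 0"
      by (intro tendsto_mult_left LIMSEQ_Suc[OF lim_1_over_n])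
    then have "(\<lambda>k. 2 / \<mu> * (1 / real (Suc k))) \<longlonglongrightarrow> 0" by simp
    from Lim_null_comparison[OF le this]
    have "(\<lambda>k. sqrt ((norm (e (I k s) - x))^2)) \<longlonglongrightarrow> sqrt 0"
      by (rule tendsto_real_sqrt)
    then have "(\<lambda>k. norm (e (I k s) - x)) \<longlonglongrightarrow> 0" by simp
    then have "(\<lambda>k. e (I k s)) \<longlonglongrightarrow> x"
      by (rule LIM_zero_cancel[OF tendsto_norm_zero_cancel])
    then show "(\<lambda>k. e (I k s)) \<longlonglongrightarrow> arg_min_on (u s) C"
      using arg_min_on_growth_min[OF x \<mu>] by simp
  qed
qed

text \<open>The objective has a part that is merely lower semicontinuous, so density in
  \<open>C\<close> says nothing about its values. Points dense in the graph approximate argument and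
  value together; they exist because the graph lies in a separable metric space.\<close>

lemma countable_graph_dense:
  fixes u :: "'a::euclidean_space \<Rightarrow> real"
  obtains D where "countable D" "D \<subseteq> C"
    "\<And>y e. y \<in> C \<Longrightarrow> e > 0 \<Longrightarrow> \<exists>d\<in>D. dist d y < e \<and> \<bar>u d - u y\<bar> < e"
proof -
  obtain T where T: "countable T" "T \<subseteq> (\<lambda>y. (y, u y)) ` C" "(\<lambda>y. (y, u y)) ` C \<subseteq> closure T"
    using separable by blast
  show thesis
  proof
    show "countable (fst ` T)" using T by simp
    show "fst ` T \<subseteq> C" using T by auto
    fix y and e :: real assume "y \<in> C" "e > 0"
    then have "(y, u y) \<in> closure T" using T by auto
    then obtain p where p: "p \<in> T" "dist p (y, u y) < e"
      using \<open>e > 0\<close> closure_approachable by blast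
    then obtain d where d: "d \<in> C" "p = (d, u d)" using T by auto
    have "dist d y \<le> dist p (y, u y)" "dist (u d) (u y) \<le> dist p (y, u y)"
      using dist_fst_le[of p "(y, u y)"] dist_snd_le[of p "(y, u y)"] d by auto
    then show "\<exists>d\<in>fst ` T. dist d y < e \<and> \<bar>u d - u y\<bar> < e"
      using p d by (intro bexI[of _ d]) (auto simp: dist_real_def image_iff intro: bexI[of _ p])
  qed
qed

section \<open>Sequences of independent samples\<close>

definition shift :: "nat \<Rightarrow> (nat \<Rightarrow> 'z) \<Rightarrow> nat \<Rightarrow> 'z" where
  "shift k w = (\<lambda>i. w (k + i))"

text \<open>Replaces measurability with respect to the first \<open>n\<close> samples: such an
  \<open>f\<close> is unchanged when \<open>comb_seq n\<close> appends another tail, so fresh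
  samples can be integrated out with \<open>f\<close> held fixed.\<close>

definition depends_on_first :: "nat \<Rightarrow> ((nat \<Rightarrow> 'z) \<Rightarrow> 'b) \<Rightarrow> bool" where
  "depends_on_first n f \<longleftrightarrow> (\<forall>w w'. (\<forall>i<n. w i = w' i) \<longrightarrow> f w = f w')"

lemma shift_0 [simp]: "shift 0 w = w"
  by (simp add: shift_def)

lemma shift_shift [simp]: "shift a (shift b w) = shift (b + a) w"
  by (simp add: shift_def add.assoc)

lemma card_Collect_eq_sum: "card {k. k < (m::nat) \<and> Q k} = (\<Sum>k<m. if Q k then 1 else 0)"
proof -
  have "{..<m} \<inter> {k. Q k} = {k. k < m \<and> Q k}" by auto
  then show ?thesis by (subst sum.If_cases) simp_all
qed

lemma shift_comb_seq [simp]: "shift k (comb_seq k w w') = w'"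
  by (simp add: shift_def comb_seq_def fun_eq_iff)

lemma shift_add_comb_seq: "shift (k + l) (comb_seq k w w') = shift l w'"
  by (simp add: shift_def comb_seq_def fun_eq_iff)

lemma depends_on_first_comb_seq:
  "depends_on_first n f \<Longrightarrow> f (comb_seq n w w') = f w"
  unfolding depends_on_first_def by (metis comb_seq_less)

lemma measurable_shift [measurable]:
  "shift k \<in> measurable (\<Pi>\<^sub>M i\<in>(UNIV::nat set). M) (\<Pi>\<^sub>M i\<in>(UNIV::nat set). M)"
proof -
  have "(\<lambda>w. \<lambda>i. w (k + i)) \<in> measurable (\<Pi>\<^sub>M i\<in>(UNIV::nat set). M) (\<Pi>\<^sub>M i\<in>(UNIV::nat set). M)"
    by (rule measurable_PiM_single') (auto simp: space_PiM PiE_iff)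
  then show ?thesis by (simp add: shift_def[abs_def])
qed

section \<open>Splitting the sample stream into past and fresh samples\<close>

context sequence_space begin

text \<open>Joining the first \<open>n\<close> samples of one stream to an independent second stream
  reproduces the distribution of the stream.\<close>

lemma nn_integral_comb_seq:
  assumes [measurable]: "u \<in> borel_measurable S"
  shows "(\<integral>\<^sup>+w. u w \<partial>S) = (\<integral>\<^sup>+w. (\<integral>\<^sup>+w'. u (comb_seq n w w') \<partial>S) \<partial>S)"
proof -
  have "(\<integral>\<^sup>+w. u w \<partial>S) = (\<integral>\<^sup>+w. u w \<partial>distr (S \<Otimes>\<^sub>M S) S (\<lambda>(w, w'). comb_seq n w w'))"
    by (simp add: PiM_comb_seq)
  also have "\<dots> = (\<integral>\<^sup>+p. u (comb_seq n (fst p) (snd p)) \<partial>(S \<Otimes>\<^sub>M S))"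
    by (subst nn_integral_distr) (auto simp: split_beta' measurable_comb_seq')
  also have "\<dots> = (\<integral>\<^sup>+w. (\<integral>\<^sup>+w'. u (comb_seq n w w') \<partial>S) \<partial>S)"
    by (subst P.nn_integral_fst[symmetric]) auto
  finally show ?thesis .
qed

lemma integral_comb_seq:
  fixes u :: "_ \<Rightarrow> real"
  assumes int: "integrable S u"
  shows "(\<integral>w. u w \<partial>S) = (\<integral>w. (\<integral>w'. u (comb_seq n w w') \<partial>S) \<partial>S)"
proof -
  interpret pair_sigma_finite S S ..
  have [measurable]: "u \<in> borel_measurable S" using int by auto
  have "integrable (distr (S \<Otimes>\<^sub>M S) S (\<lambda>(w, w'). comb_seq n w w')) u"
    using int by (simp add: PiM_comb_seq)
  then have i: "integrable (S \<Otimes>\<^sub>M S) (\<lambda>(w, w'). u (comb_seq n w w'))"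
    by (subst (asm) integrable_distr_eq) (auto simp: split_beta' measurable_comb_seq')
  have "(\<integral>w. u w \<partial>S) = (\<integral>w. u w \<partial>distr (S \<Otimes>\<^sub>M S) S (\<lambda>(w, w'). comb_seq n w w'))"
    by (simp add: PiM_comb_seq)
  also have "\<dots> = (\<integral>p. (\<lambda>(w, w'). u (comb_seq n w w')) p \<partial>(S \<Otimes>\<^sub>M S))"
    by (subst integral_distr) (auto simp: split_beta' measurable_comb_seq')
  also have "\<dots> = (\<integral>w. (\<integral>w'. u (comb_seq n w w') \<partial>S) \<partial>S)"
    using integral_fst'[OF i] by simp
  finally show ?thesis .
qed

text \<open>Conditioning on the past: on \<open>comb_seq n w w'\<close> the value of
  \<open>X\<close> is that of \<open>w\<close>, while the shifted stream is \<open>w'\<close>. The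
  bound is uniform in the value of \<open>X\<close>, so it survives the outer integration.\<close>

lemma prob_fresh_le:
  assumes [measurable]: "X \<in> measurable S N" and X: "depends_on_first n X"
    and [measurable]: "B \<in> sets (N \<Otimes>\<^sub>M S)" and q: "0 \<le> q"
    and le: "\<And>w. w \<in> space S \<Longrightarrow> measure S {z \<in> space S. (X w, z) \<in> B} \<le> q"
  shows "measure S {w \<in> space S. (X w, shift n w) \<in> B} \<le> q"
proof -
  define E where "E = {w \<in> space S. (X w, shift n w) \<in> B}"
  have [measurable]: "E \<in> sets S" unfolding E_def by measurable
  have "emeasure S E = (\<integral>\<^sup>+w. indicator E w \<partial>S)" by simp
  also have "\<dots> = (\<integral>\<^sup>+w. (\<integral>\<^sup>+w'. indicator E (comb_seq n w w') \<partial>S) \<partial>S)"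
    by (rule nn_integral_comb_seq) simp
  also have "\<dots> \<le> (\<integral>\<^sup>+w. ennreal q \<partial>S)"
  proof (rule nn_integral_mono)
    fix w assume w: "w \<in> space S"
    have [measurable]: "{z \<in> space S. (X w, z) \<in> B} \<in> sets S"
      using w measurable_space[OF assms(1) w] by measurable
    have sp: "comb_seq n w w' \<in> space S" if "w' \<in> space S" for w'
      using w that by (auto simp: space_PiM PiE_iff comb_seq_def)
    have "(\<integral>\<^sup>+w'. indicator E (comb_seq n w w') \<partial>S)
        = (\<integral>\<^sup>+w'. indicator {z \<in> space S. (X w, z) \<in> B} w' \<partial>S)"
      by (intro nn_integral_cong)
         (auto simp: E_def depends_on_first_comb_seq[OF X] sp split: split_indicator)
    also have "\<dots> = emeasure S {z \<in> space S. (X w, z) \<in> B}" by simp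
    also have "\<dots> \<le> ennreal q"
      using le[OF w] by (simp add: P.emeasure_eq_measure ennreal_leI)
    finally show "(\<integral>\<^sup>+w'. indicator E (comb_seq n w w') \<partial>S) \<le> ennreal q" .
  qed
  also have "\<dots> = ennreal q" by (simp add: P.emeasure_space_1)
  finally show ?thesis using q unfolding E_def[symmetric]
    by (simp add: P.emeasure_eq_measure)
qed

text \<open>Markov's inequality for \<open>2\<close> to the power of minus the number of successes, whose expectation is
  at most \<open>(2 / 3) ^ m\<close>; the rate comes from \<open>8 / 9 = 1 - 1 / 9 \<le> exp (- 1 / 9)\<close>.\<close>

lemma prob_minority_le:
  assumes [measurable]: "Measurable.pred S Pr" and dep: "depends_on_first n Pr"
    and A: "measure S {w \<in> space S. Pr w} \<ge> 2 / 3"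
  shows "measure S {w \<in> space S. 2 * card {k. k < m \<and> Pr (shift (k * n) w)} \<le> m} \<le> exp (- real m / 18)"
proof -
  define A where "A = {w \<in> space S. Pr w}"
  have [measurable]: "A \<in> sets S" unfolding A_def by measurable
  define W where "W = (\<lambda>w. if Pr w then 1 / 2 else 1 :: real)"
  define \<Phi> where "\<Phi> = (\<lambda>m w. \<Prod>k<m. W (shift (k * n) w))"
  have [measurable]: "W \<in> borel_measurable S" unfolding W_def by measurable
  have [measurable]: "\<Phi> m \<in> borel_measurable S" for m unfolding \<Phi>_def by measurable
  have W01: "0 \<le> W w" "W w \<le> 1" for w by (auto simp: W_def)
  have \<Phi>01: "0 \<le> \<Phi> m w" "\<Phi> m w \<le> 1" for m w
    unfolding \<Phi>_def using W01 by (auto intro!: prod_nonneg prod_le_1)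
  have i\<Phi>: "integrable S (\<Phi> m)" for m
    by (rule P.integrable_const_bound[of _ 1]) (use \<Phi>01 in auto)
  have iW: "integrable S W"
    by (rule P.integrable_const_bound[of _ 1]) (use W01 in auto)
  have EW: "(\<integral>w. W w \<partial>S) = 1 - measure S A / 2"
  proof -
    have "(\<integral>w. W w \<partial>S) = (\<integral>w. 1 - indicator A w / 2 \<partial>S)"
      by (intro Bochner_Integration.integral_cong) (auto simp: W_def A_def)
    also have "\<dots> = (\<integral>w. 1 \<partial>S) - (\<integral>w. indicator A w / 2 \<partial>S)"
      by (rule Bochner_Integration.integral_diff)
         (auto intro!: P.integrable_const_bound[of _ 1] split: split_indicator)
    also have "\<dots> = 1 - measure S A / 2" by (simp add: P.prob_space)
    finally show ?thesis .
  qed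
  have E\<Phi>: "(\<integral>w. \<Phi> m w \<partial>S) = (1 - measure S A / 2) ^ m" for m
  proof (induction m)
    case 0 show ?case by (simp add: \<Phi>_def P.prob_space)
  next
    case (Suc m)
    have WA: "W (comb_seq n w w') = W w" for w w'
      using depends_on_first_comb_seq[OF dep, of w w'] by (simp add: W_def)
    \<comment> \<open>The first block separates from the others, which see only the fresh tail, so
      every trial multiplies the expectation by one more factor.\<close>
    have step: "\<Phi> (Suc m) (comb_seq n w w') = W w * \<Phi> m w'" for w w'
      unfolding \<Phi>_def prod.lessThan_Suc_shift by (simp add: WA shift_add_comb_seq)
    have "(\<integral>w. \<Phi> (Suc m) w \<partial>S) = (\<integral>w. (\<integral>w'. \<Phi> (Suc m) (comb_seq n w w') \<partial>S) \<partial>S)"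
      by (rule integral_comb_seq[OF i\<Phi>])
    also have "\<dots> = (\<integral>w. W w * (\<integral>w'. \<Phi> m w' \<partial>S) \<partial>S)" by (simp only: step) simp
    finally have "(\<integral>w. \<Phi> (Suc m) w \<partial>S) = (\<integral>w. W w * (\<integral>w'. \<Phi> m w' \<partial>S) \<partial>S)" .
    then show ?case by (simp add: Suc.IH EW)
  qed
  define E where "E = {w \<in> space S. 2 * card {k. k < m \<and> Pr (shift (k * n) w)} \<le> m}"
  have [measurable]: "E \<in> sets S" unfolding E_def card_Collect_eq_sum by measurable
  have \<Phi>c: "\<Phi> m w = (1 / 2) ^ card {k. k < m \<and> Pr (shift (k * n) w)}" for w
  proof -
    have "{..<m} \<inter> {k. Pr (shift (k * n) w)} = {k. k < m \<and> Pr (shift (k * n) w)}" by auto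
    then show ?thesis unfolding \<Phi>_def W_def by (subst prod.If_cases) simp_all
  qed
  have lb: "indicator E w \<le> sqrt 2 ^ m * \<Phi> m w" for w
  proof (cases "w \<in> E")
    case True
    define c where "c = card {k. k < m \<and> Pr (shift (k * n) w)}"
    have "(2::real) ^ c = sqrt 2 ^ (2 * c)" by (simp add: power_mult)
    also have "\<dots> \<le> sqrt 2 ^ m"
      using True by (intro power_increasing) (auto simp: E_def c_def)
    finally have "1 \<le> sqrt 2 ^ m * (1 / 2) ^ c" by (simp add: power_one_over field_simps)
    then show ?thesis using True by (simp add: \<Phi>c c_def)
  next
    case False then show ?thesis using \<Phi>01(1)[of m w] by simp
  qed
  have iE: "integrable S (indicat_real E)"
    by (rule P.integrable_const_bound[of _ 1]) (auto split: split_indicator)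
  have "measure S E = (\<integral>w. indicator E w \<partial>S)" by simp
  also have "\<dots> \<le> (\<integral>w. sqrt 2 ^ m * \<Phi> m w \<partial>S)"
    by (rule integral_mono[OF iE integrable_mult_right[OF i\<Phi>] lb])
  also have "\<dots> = (sqrt 2 * (1 - measure S A / 2)) ^ m" by (simp add: E\<Phi> power_mult_distrib)
  also have "\<dots> \<le> exp (- 1 / 18) ^ m"
  proof (rule power_mono)
    define e where "e = exp (- 1 / 18 :: real)"
    have "2 * (- 1 / 18) = (- 1 / 9 :: real)" by simp
    then have e2: "exp (- 1 / 9 :: real) = e^2" unfolding e_def by (metis exp_double)
    have "(sqrt 2 * (2 / 3))^2 = 1 + (- 1 / 9 :: real)" by (simp add: power_mult_distrib power2_eq_square)
    also have "\<dots> \<le> e^2" unfolding e2[symmetric] by (rule exp_ge_add_one_self)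
    finally have "sqrt 2 * (2 / 3) \<le> exp (- 1 / 18)"
      unfolding e_def by (rule power2_le_imp_le) simp
    moreover have "sqrt 2 * (1 - measure S A / 2) \<le> sqrt 2 * (2 / 3)"
      using A unfolding A_def[symmetric] by (intro mult_left_mono) auto
    ultimately show "sqrt 2 * (1 - measure S A / 2) \<le> exp (- 1 / 18)" by linarith
    have "measure S A / 2 \<le> 1" using P.prob_le_1[of A] by linarith
    then show "0 \<le> sqrt 2 * (1 - measure S A / 2)" by (intro mult_nonneg_nonneg) simp_all
  qed
  also have "\<dots> = exp (- real m / 18)"
    unfolding exp_of_nat_mult[symmetric] by simp
  finally show ?thesis unfolding E_def .
qed

text \<open>The trials may depend on a parameter \<open>X w\<close> computed from earlier samples.
  For each frozen value the majority bound applies to consecutive blocks of length \<open>l\<close>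
  from position \<open>n\<close> on; freshness of these blocks carries it over to the random
  parameter.\<close>

lemma prob_fresh_minority:
  assumes X: "X \<in> measurable S N" "depends_on_first n X"
    and Pr: "Measurable.pred (N \<Otimes>\<^sub>M S) (\<lambda>p. Pr (fst p) (snd p))" "\<And>x. depends_on_first l (Pr x)"
    and le: "\<And>w. w \<in> space S \<Longrightarrow> measure S {z \<in> space S. Pr (X w) z} \<ge> 2 / 3"
  shows "measure S {w \<in> space S. 2 * card {k. k < m \<and> Pr (X w) (shift (n + k * l) w)} \<le> m} \<le> exp (- real m / 18)"
    and "{w \<in> space S. 2 * card {k. k < m \<and> Pr (X w) (shift (n + k * l) w)} \<le> m} \<in> sets S"
proof -
  note [measurable] = X(1) Pr(1)
  define cnt where "cnt = (\<lambda>p. \<Sum>k<m. if Pr (fst p) (shift (k * l) (snd p)) then 1 else 0 :: nat)"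
  have cnt: "card {k. k < m \<and> Pr x (shift (k * l) z)} = cnt (x, z)" for x z
    by (simp add: cnt_def card_Collect_eq_sum)
  have pr: "Measurable.pred Q (\<lambda>w. Pr (Y w) (V w))" if "Y \<in> measurable Q N" "V \<in> measurable Q S" for Q Y V
    using measurable_compose[OF measurable_Pair[OF that] Pr(1)] by simp
  have [measurable]: "Measurable.pred (N \<Otimes>\<^sub>M S) (\<lambda>p. Pr (fst p) (shift (k * l) (snd p)))" for k
    by (intro pr) measurable
  have [measurable]: "cnt \<in> measurable (N \<Otimes>\<^sub>M S) (count_space UNIV)" unfolding cnt_def by measurable
  define B where "B = {p \<in> space (N \<Otimes>\<^sub>M S). 2 * cnt p \<le> m}"
  have [measurable]: "B \<in> sets (N \<Otimes>\<^sub>M S)" unfolding B_def by measurable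
  have sh: "shift i w \<in> space S" if "w \<in> space S" for i w
    using measurable_space[OF measurable_shift that] .
  have mem: "(X w, z) \<in> B \<longleftrightarrow> 2 * card {k. k < m \<and> Pr (X w) (shift (k * l) z)} \<le> m"
    if "w \<in> space S" "z \<in> space S" for w z
    using that measurable_space[OF X(1)] by (simp add: B_def cnt space_pair_measure)
  have "measure S {z \<in> space S. (X w, z) \<in> B} \<le> exp (- real m / 18)" if w: "w \<in> space S" for w
  proof -
    have p: "Measurable.pred S (Pr (X w))"
      using measurable_space[OF X(1) w] by (intro pr) measurable
    have "{z \<in> space S. (X w, z) \<in> B} = {z \<in> space S. 2 * card {k. k < m \<and> Pr (X w) (shift (k * l) z)} \<le> m}"
      using mem[OF w] by auto
    then show ?thesis using prob_minority_le[OF p Pr(2) le[OF w]] by simp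
  qed
  then have "measure S {w \<in> space S. (X w, shift n w) \<in> B} \<le> exp (- real m / 18)"
    by (intro prob_fresh_le[OF X]) auto
  moreover have eq: "{w \<in> space S. (X w, shift n w) \<in> B} = {w \<in> space S. 2 * card {k. k < m \<and> Pr (X w) (shift (n + k * l) w)} \<le> m}"
    using mem sh by auto
  ultimately show "measure S {w \<in> space S. 2 * card {k. k < m \<and> Pr (X w) (shift (n + k * l) w)} \<le> m} \<le> exp (- real m / 18)" by (simp only: eq)
  have "{w \<in> space S. (X w, shift n w) \<in> B} \<in> sets S" by measurable
  then show "{w \<in> space S. 2 * card {k. k < m \<and> Pr (X w) (shift (n + k * l) w)} \<le> m} \<in> sets S" by (simp only: eq)
qed

section \<open>Expectations of single samples and of sums of samples\<close>

lemma prob_space_M: "prob_space M"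
  by (rule M.prob_space_axioms)

lemma distr_component: "distr S M (\<lambda>w. w i) = M"
  using distr_PiM_component[of UNIV "\<lambda>_. M" i] prob_space_M by simp

lemma integral_component:
  fixes u :: "_ \<Rightarrow> 'b::{banach, second_countable_topology}"
  assumes "u \<in> borel_measurable M"
  shows "(\<integral>w. u (w i) \<partial>S) = (\<integral>z. u z \<partial>M)"
proof -
  have "(\<integral>z. u z \<partial>M) = (\<integral>z. u z \<partial>distr S M (\<lambda>w. w i))" by (simp add: distr_component)
  also have "\<dots> = (\<integral>w. u (w i) \<partial>S)" by (rule integral_distr) (use assms in auto)
  finally show ?thesis by simp
qed

lemma integrable_component:
  fixes u :: "_ \<Rightarrow> 'b::{banach, second_countable_topology}"
  assumes "integrable M u"
  shows "integrable S (\<lambda>w. u (w i))"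
proof -
  have "integrable (distr S M (\<lambda>w. w i)) u" using assms by (simp add: distr_component)
  then show ?thesis by (rule integrable_distr[rotated]) auto
qed

lemma measurable_reindex [measurable]: "(\<lambda>w i. w (f i)) \<in> measurable S S"
  by (rule measurable_PiM_single') (auto simp: space_PiM PiE_iff)

lemma integral_reindex:
  fixes u :: "_ \<Rightarrow> real"
  assumes [measurable]: "u \<in> borel_measurable S" and f: "inj f"
  shows "(\<integral>w. u (\<lambda>i. w (f i)) \<partial>S) = (\<integral>w. u w \<partial>S)"
proof -
  have "distr S S (\<lambda>w i. w (f i)) = S"
    using distr_PiM_reindex[of UNIV "\<lambda>_. M" f UNIV] prob_space_M f by (simp add: restrict_def)
  then have "(\<integral>w. u w \<partial>S) = (\<integral>w. u w \<partial>distr S S (\<lambda>w i. w (f i)))" by simp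
  also have "\<dots> = (\<integral>w. u (\<lambda>i. w (f i)) \<partial>S)"
    by (rule integral_distr) auto
  finally show ?thesis by simp
qed

text \<open>Induction on \<open>n\<close>: in the expanded square the cross term vanishes, because
  the partial sum depends on the first \<open>n\<close> samples and is paired with an independent
  sample of mean zero.\<close>

lemma second_moment_sum:
  fixes \<xi> :: "_ \<Rightarrow> 'b::euclidean_space"
  assumes [measurable]: "\<xi> \<in> borel_measurable M" and sq: "integrable M (\<lambda>z. (norm (\<xi> z))^2)"
    and mean: "(\<integral>z. \<xi> z \<partial>M) = 0" and int: "integrable M \<xi>"
  shows "integrable S (\<lambda>w. (norm (\<Sum>i<n. \<xi> (w i)))^2) \<and>
         (\<integral>w. (norm (\<Sum>i<n. \<xi> (w i)))^2 \<partial>S) = real n * (\<integral>z. (norm (\<xi> z))^2 \<partial>M)"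
proof (induction n)
  case 0 show ?case by simp
next
  case (Suc n)
  define A where "A = (\<lambda>w. \<Sum>i<n. \<xi> (w i))"
  have [measurable]: "A \<in> borel_measurable S" unfolding A_def by measurable
  have iA: "integrable S (\<lambda>w. (norm (A w))^2)" using Suc by (simp add: A_def)
  have i\<xi>: "integrable S (\<lambda>w. (norm (\<xi> (w n)))^2)" by (rule integrable_component[OF sq])
  have ic: "integrable S (\<lambda>w. A w \<bullet> \<xi> (w n))"
  proof (rule Bochner_Integration.integrable_bound)
    show "integrable S (\<lambda>w. (norm (A w))^2 + (norm (\<xi> (w n)))^2)" using iA i\<xi> by simp
    show "AE w in S. norm (A w \<bullet> \<xi> (w n)) \<le> norm ((norm (A w))^2 + (norm (\<xi> (w n)))^2)"
    proof (rule AE_I2)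
      fix w
      have "norm (A w \<bullet> \<xi> (w n)) \<le> norm (A w) * norm (\<xi> (w n))"
        using Cauchy_Schwarz_ineq2[of "A w" "\<xi> (w n)"] by simp
      also have "\<dots> \<le> (norm (A w))^2 + (norm (\<xi> (w n)))^2"
        using sum_squares_bound[of "norm (A w)" "norm (\<xi> (w n))"]
        mult_nonneg_nonneg[OF norm_ge_zero norm_ge_zero, of "A w" "\<xi> (w n)"]
        by linarith
      finally show "norm (A w \<bullet> \<xi> (w n)) \<le> norm ((norm (A w))^2 + (norm (\<xi> (w n)))^2)" by simp
    qed
  qed simp
  have "depends_on_first n A" by (simp add: depends_on_first_def A_def)
  then have Ac: "A (comb_seq n w w') = A w" for w w' by (rule depends_on_first_comb_seq)
  have "(\<integral>w. A w \<bullet> \<xi> (w n) \<partial>S) = (\<integral>w. (\<integral>w'. A w \<bullet> \<xi> (w' 0) \<partial>S) \<partial>S)"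
    by (subst integral_comb_seq[OF ic, of n]) (simp add: Ac comb_seq_def)
  also have "\<dots> = (\<integral>w. A w \<bullet> (\<integral>w'. \<xi> (w' 0) \<partial>S) \<partial>S)"
    using integrable_component[OF int, of 0] by simp
  also have "\<dots> = 0" by (simp add: integral_component mean)
  finally have cross: "(\<integral>w. A w \<bullet> \<xi> (w n) \<partial>S) = 0" .
  have ex: "(norm (\<Sum>i<Suc n. \<xi> (w i)))^2 = (norm (A w))^2 + 2 * (A w \<bullet> \<xi> (w n)) + (norm (\<xi> (w n)))^2" for w
    by (simp add: A_def power2_norm_eq_inner inner_add_left inner_add_right inner_commute)
  have i2: "integrable S (\<lambda>w. (norm (A w))^2 + 2 * (A w \<bullet> \<xi> (w n)))"
    by (rule Bochner_Integration.integrable_add[OF iA integrable_mult_right[OF ic]])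
  have "(\<integral>w. (norm (A w))^2 + 2 * (A w \<bullet> \<xi> (w n)) + (norm (\<xi> (w n)))^2 \<partial>S)
      = (\<integral>w. (norm (A w))^2 \<partial>S) + 2 * (\<integral>w. A w \<bullet> \<xi> (w n) \<partial>S) + (\<integral>w. (norm (\<xi> (w n)))^2 \<partial>S)"
    by (subst Bochner_Integration.integral_add[OF i2 i\<xi>],
        subst Bochner_Integration.integral_add[OF iA integrable_mult_right[OF ic]]) simp
  also have "(\<integral>w. (norm (\<xi> (w n)))^2 \<partial>S) = (\<integral>z. (norm (\<xi> z))^2 \<partial>M)"
    by (rule integral_component[of "\<lambda>z. (norm (\<xi> z))^2"]) simp
  also have "(\<integral>w. (norm (A w))^2 \<partial>S) = real n * (\<integral>z. (norm (\<xi> z))^2 \<partial>M)"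
    using Suc by (simp add: A_def)
  finally show ?case
    unfolding ex using Bochner_Integration.integrable_add[OF i2 i\<xi>] by (simp only: cross) (simp add: algebra_simps)
qed

end

section \<open>Robust selection\<close>

text \<open>A \<open>LEAST\<close> over the reals says nothing until it is known to be attained. The
  count changes only at finitely many distances, so an admissible radius can be lowered to one of
  the values in \<open>V\<close> without losing the majority; 0 belongs to \<open>V\<close> because
  radii are nonnegative.\<close>

lemma majority_radius_least:
  fixes \<rho> :: "'b \<Rightarrow> 'b \<Rightarrow> real" and i :: nat
  assumes ys: "ys \<noteq> []"
  defines "cnt \<equiv> (\<lambda>r. card {k. k < length ys \<and> \<rho> (ys ! i) (ys ! k) \<le> r})"
  shows "0 \<le> majority_radius \<rho> ys i"
    and "length ys < 2 * cnt (majority_radius \<rho> ys i)"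
    and "\<And>r. 0 \<le> r \<Longrightarrow> length ys < 2 * cnt r \<Longrightarrow> majority_radius \<rho> ys i \<le> r"
proof -
  define m where "m = length ys"
  define V where "V = insert 0 ((\<lambda>k. \<rho> (ys ! i) (ys ! k)) ` {..<m})"
  define W where "W = {v \<in> V. 0 \<le> v \<and> m < 2 * cnt v}"
  have fV: "finite V" by (simp add: V_def)
  then have fW: "finite W" by (simp add: W_def)
  have round: "\<exists>v\<in>W. v \<le> r" if r: "0 \<le> r" "m < 2 * cnt r" for r
  proof -
    define v where "v = Max {v \<in> V. v \<le> r}"
    have f: "finite {v \<in> V. v \<le> r}" and z: "0 \<in> {v \<in> V. v \<le> r}"
      using fV r by (auto simp: V_def)
    have v: "v \<in> V" "v \<le> r" "0 \<le> v"
      using Max_in[OF f] Max_ge[OF f z] z unfolding v_def by blast+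
    have "{k. k < length ys \<and> \<rho> (ys ! i) (ys ! k) \<le> r} = {k. k < length ys \<and> \<rho> (ys ! i) (ys ! k) \<le> v}"
    proof (intro Collect_cong conj_cong refl iffI)
      fix k assume "k < length ys" "\<rho> (ys ! i) (ys ! k) \<le> r"
      then have "\<rho> (ys ! i) (ys ! k) \<in> {v \<in> V. v \<le> r}" by (auto simp: V_def m_def)
      then show "\<rho> (ys ! i) (ys ! k) \<le> v" unfolding v_def by (rule Max_ge[OF f])
    qed (use v in auto)
    then have "cnt r = cnt v" by (simp add: cnt_def)
    then show ?thesis using v r by (auto simp: W_def)
  qed
  have "cnt (Max V) = m"
  proof -
    have "{k. k < length ys \<and> \<rho> (ys ! i) (ys ! k) \<le> Max V} = {..<m}"
      using Max_ge[OF fV] by (auto simp: V_def m_def)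
    then show ?thesis by (simp add: cnt_def)
  qed
  moreover have "0 \<le> Max V" using fV by (intro Max_ge) (auto simp: V_def)
  moreover have "m > 0" using ys by (simp add: m_def)
  ultimately have "W \<noteq> {}" using round[of "Max V"] by auto
  have mr: "majority_radius \<rho> ys i = Min W"
    unfolding majority_radius_def
  proof (rule Least_equality)
    have "Min W \<in> W" using fW \<open>W \<noteq> {}\<close> by (rule Min_in)
    then show "0 \<le> Min W \<and> real (length ys) / 2 < real (card {k. k < length ys \<and> \<rho> (ys ! i) (ys ! k) \<le> Min W})"
      by (auto simp: W_def cnt_def m_def)
    fix r assume "0 \<le> r \<and> real (length ys) / 2 < real (card {k. k < length ys \<and> \<rho> (ys ! i) (ys ! k) \<le> r})"
    then obtain v where "v \<in> W" "v \<le> r" using round[of r] by (auto simp: cnt_def m_def)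
    then show "Min W \<le> r" using Min_le[OF fW] by force
  qed
  have "Min W \<in> W" using fW \<open>W \<noteq> {}\<close> by (rule Min_in)
  then show "0 \<le> majority_radius \<rho> ys i" "length ys < 2 * cnt (majority_radius \<rho> ys i)"
    by (auto simp: mr W_def m_def)
  show "majority_radius \<rho> ys i \<le> r" if "0 \<le> r" "length ys < 2 * cnt r" for r
    using round[of r] that Min_le[OF fW] unfolding mr m_def[symmetric] by force
qed

section \<open>Medians expressed by counting\<close>

lemma sorted_le_nth_iff:
  fixes xs :: "'b::linorder list"
  assumes "sorted xs" "j < length xs"
  shows "a \<le> xs ! j \<longleftrightarrow> length (filter (\<lambda>x. x < a) xs) \<le> j"
proof
  assume "a \<le> xs ! j"
  then have "{k. k < length xs \<and> xs ! k < a} \<subseteq> {..<j}"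
    using sorted_nth_mono[OF assms(1), of j] by (fastforce simp: not_less[symmetric])
  then have "card {k. k < length xs \<and> xs ! k < a} \<le> card {..<j}" by (intro card_mono) auto
  then show "length (filter (\<lambda>x. x < a) xs) \<le> j" by (simp add: length_filter_conv_card)
next
  assume l: "length (filter (\<lambda>x. x < a) xs) \<le> j"
  show "a \<le> xs ! j"
  proof (rule ccontr)
    assume "\<not> a \<le> xs ! j"
    then have "{..j} \<subseteq> {k. k < length xs \<and> xs ! k < a}"
      using assms sorted_nth_mono[OF assms(1), of _ j] by fastforce
    then have "card {..j} \<le> card {k. k < length xs \<and> xs ! k < a}" by (intro card_mono) auto
    then show False using l by (simp add: length_filter_conv_card)
  qed
qed

lemma length_filter_sort: "length (filter P (sort xs)) = length (filter P xs)"
  by (metis mset_filter mset_sort size_mset)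

lemma length_filter_map_upt:
  "length (filter P (map r [0..<m])) = card {k. k < m \<and> P (r k)}"
proof -
  have "{k. k < m \<and> P (map r [0..<m] ! k)} = {k. k < m \<and> P (r k)}" by auto
  then show ?thesis by (simp add: length_filter_conv_card)
qed

lemma ceiling_half_minus_one:
  assumes "m > 0"
  shows "nat \<lceil>real m / 2\<rceil> - 1 < m" "c \<le> nat \<lceil>real m / 2\<rceil> - 1 \<longleftrightarrow> 2 * c < m"
proof -
  have "\<lceil>real m / 2\<rceil> = (int m + 1) div 2"
    by (rule ceiling_unique) linarith+
  then have *: "nat \<lceil>real m / 2\<rceil> = (m + 1) div 2" by (simp add: nat_div_distrib)
  show "nat \<lceil>real m / 2\<rceil> - 1 < m" "c \<le> nat \<lceil>real m / 2\<rceil> - 1 \<longleftrightarrow> 2 * c < m"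
    unfolding * using assms by linarith+
qed

text \<open>Trades the sorted list for a count of strictly smaller radii, the form needed both for
  majority arguments and for measurability.\<close>

lemma extract_indices_iff:
  assumes "ys \<noteq> []"
  shows "i \<in> extract_indices \<rho> ys \<longleftrightarrow> i < length ys \<and>
     2 * card {k. k < length ys \<and> majority_radius \<rho> ys k < majority_radius \<rho> ys i} < length ys"
proof -
  define xs where "xs = sort (map (majority_radius \<rho> ys) [0..<length ys])"
  define j where "j = nat \<lceil>real (length ys) / 2\<rceil> - 1"
  have pos: "length ys > 0" using assms by simp
  have j: "j < length xs" using ceiling_half_minus_one(1)[OF pos] by (simp add: j_def xs_def)
  have "majority_radius \<rho> ys i \<le> median_radius \<rho> ys \<longleftrightarrow>
      length (filter (\<lambda>x. x < majority_radius \<rho> ys i) xs) \<le> j"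
    using sorted_le_nth_iff[OF _ j] by (simp add: median_radius_def xs_def j_def)
  also have "\<dots> \<longleftrightarrow> 2 * card {k. k < length ys \<and> majority_radius \<rho> ys k < majority_radius \<rho> ys i} < length ys"
    unfolding xs_def length_filter_sort length_filter_map_upt j_def
    by (rule ceiling_half_minus_one(2)[OF pos])
  finally show ?thesis by (auto simp: extract_indices_def)
qed

lemma extract_indices_subset: "extract_indices \<rho> ys \<subseteq> {..<length ys}"
  by (auto simp: extract_indices_def)

text \<open>The positions up to the median contribute at least half of the indices. With an even
  number of points it may be exactly half; an odd number turns this into a strict majority.\<close>

lemma card_extract_indices:
  assumes "ys \<noteq> []"
  shows "length ys \<le> 2 * card (extract_indices \<rho> ys)"
proof -
  define xs where "xs = sort (map (majority_radius \<rho> ys) [0..<length ys])"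
  define j where "j = nat \<lceil>real (length ys) / 2\<rceil> - 1"
  have pos: "length ys > 0" using assms by simp
  have j: "j < length xs" using ceiling_half_minus_one(1)[OF pos] by (simp add: j_def xs_def)
  have "{..j} \<subseteq> {k. k < length xs \<and> xs ! k \<le> xs ! j}"
    using j sorted_nth_mono[of xs _ j] by (auto simp: xs_def)
  then have "card {..j} \<le> card {k. k < length xs \<and> xs ! k \<le> xs ! j}" by (intro card_mono) auto
  then have "Suc j \<le> length (filter (\<lambda>x. x \<le> xs ! j) xs)" by (simp add: length_filter_conv_card)
  also have "\<dots> = card {k. k < length ys \<and> majority_radius \<rho> ys k \<le> xs ! j}"
    unfolding xs_def length_filter_sort by (rule length_filter_map_upt)
  also have "{k. k < length ys \<and> majority_radius \<rho> ys k \<le> xs ! j} = extract_indices \<rho> ys"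
    by (simp add: extract_indices_def median_radius_def xs_def j_def)
  finally have "\<not> card (extract_indices \<rho> ys) \<le> j" by simp
  then show ?thesis unfolding j_def ceiling_half_minus_one(2)[OF pos] by simp
qed

lemma extract_indices_nonempty: "ys \<noteq> [] \<Longrightarrow> extract_indices \<rho> ys \<noteq> {}"
  using card_extract_indices[of ys \<rho>] by auto

lemma majorities_intersect:
  assumes "finite A" "A \<subseteq> {..<m::nat}" "B \<subseteq> {..<m}" "m \<le> 2 * card A" "m < 2 * card B"
  shows "A \<inter> B \<noteq> {}"
proof
  assume e: "A \<inter> B = {}"
  have "finite B" using assms finite_subset by blast
  then have "card (A \<union> B) = card A + card B" using assms e by (intro card_Un_disjoint) auto
  moreover have "card (A \<union> B) \<le> card {..<m}" using assms by (intro card_mono) auto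
  ultimately show False using assms by simp
qed

lemma extract_indices_odd_intersect:
  assumes "odd (length ys)"
  shows "extract_indices \<rho> ys \<inter> extract_indices \<rho>' ys \<noteq> {}"
proof (rule majorities_intersect[of _ "length ys"])
  have ne: "ys \<noteq> []" using assms by auto
  show "length ys \<le> 2 * card (extract_indices \<rho> ys)" by (rule card_extract_indices[OF ne])
  have "length ys \<le> 2 * card (extract_indices \<rho>' ys)" by (rule card_extract_indices[OF ne])
  moreover have "length ys \<noteq> 2 * card (extract_indices \<rho>' ys)" using assms by (metis dvd_triv_left)
  ultimately show "length ys < 2 * card (extract_indices \<rho>' ys)" by simp
qed (auto intro: finite_subset[OF extract_indices_subset] dest: subsetD[OF extract_indices_subset])

lemma central_indices_nonempty:
  assumes "ys \<noteq> []" shows "central_indices ys \<noteq> {}"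
proof -
  have "finite {..<length ys}" "{..<length ys} \<noteq> {}" using assms by auto
  then obtain i where "i \<in> {..<length ys}" "\<forall>k\<in>{..<length ys}. majority_radius dist ys i \<le> majority_radius dist ys k"
    using arg_min_if_finite[of "{..<length ys}" "majority_radius dist ys"]
    by (metis linorder_le_less_linear)
  then show ?thesis by (auto simp: central_indices_def)
qed

section \<open>Selection guarantees in a pseudometric space\<close>

locale pseudometric =
  fixes \<rho> :: "'b \<Rightarrow> 'b \<Rightarrow> real"
  assumes nonneg: "0 \<le> \<rho> x y" and sym: "\<rho> x y = \<rho> y x" and triangle: "\<rho> x z \<le> \<rho> x y + \<rho> y z"
begin

context
  fixes ys :: "'b list" and c :: 'b and R :: real
  assumes maj: "length ys < 2 * card {k. k < length ys \<and> \<rho> (ys ! k) c \<le> R}"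
begin

lemma ys_nonempty: "ys \<noteq> []"
  using maj by auto

lemma R_nonneg: "0 \<le> R"
proof -
  have "{k. k < length ys \<and> \<rho> (ys ! k) c \<le> R} \<noteq> {}" using maj by (metis card.empty less_nat_zero_code mult_0_right)
  then show ?thesis using nonneg order_trans by blast
qed

text \<open>Two points of the majority are within \<open>2 * R\<close> of each other through
  \<open>c\<close>, so the ball of that radius around a good point already holds a majority.\<close>

lemma majority_radius_good:
  assumes "\<rho> (ys ! k) c \<le> R"
  shows "majority_radius \<rho> ys k \<le> 2 * R"
proof (rule majority_radius_least(3)[OF ys_nonempty])
  have "{l. l < length ys \<and> \<rho> (ys ! l) c \<le> R} \<subseteq> {l. l < length ys \<and> \<rho> (ys ! k) (ys ! l) \<le> 2 * R}"
  proof safe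
    fix l assume "\<rho> (ys ! l) c \<le> R"
    then show "\<rho> (ys ! k) (ys ! l) \<le> 2 * R"
      using assms triangle[of "ys ! k" "ys ! l" c] sym[of "ys ! l" c] by linarith
  qed
  then have "card {l. l < length ys \<and> \<rho> (ys ! l) c \<le> R} \<le> card {l. l < length ys \<and> \<rho> (ys ! k) (ys ! l) \<le> 2 * R}"
    by (intro card_mono) auto
  then show "length ys < 2 * card {l. l < length ys \<and> \<rho> (ys ! k) (ys ! l) \<le> 2 * R}" using maj by linarith
qed (use R_nonneg in simp)

text \<open>The majority inside the radius of point \<open>i\<close> meets the majority near
  \<open>c\<close>; passing through a common point adds \<open>R\<close> to \<open>2 * R\<close>.
  This is the factor 3 lost in every selection.\<close>

lemma close_if_majority_radius_le:
  assumes "majority_radius \<rho> ys i \<le> 2 * R"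
  shows "\<rho> (ys ! i) c \<le> 3 * R"
proof -
  define A where "A = {k. k < length ys \<and> \<rho> (ys ! i) (ys ! k) \<le> majority_radius \<rho> ys i}"
  have "A \<inter> {k. k < length ys \<and> \<rho> (ys ! k) c \<le> R} \<noteq> {}"
    using majority_radius_least(2)[OF ys_nonempty, of \<rho> i] maj
    by (intro majorities_intersect[of _ "length ys"]) (auto simp: A_def)
  then obtain k where "\<rho> (ys ! i) (ys ! k) \<le> majority_radius \<rho> ys i" "\<rho> (ys ! k) c \<le> R"
    by (auto simp: A_def)
  then show ?thesis using assms triangle[of "ys ! i" c "ys ! k"] by linarith
qed

text \<open>Fewer than half of the radii are strictly smaller than that of \<open>i\<close>, so the
  good majority contains a point whose radius is at least as large, and a good point has radius at
  most \<open>2 * R\<close>.\<close>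

lemma extract_indices_close:
  assumes "i \<in> extract_indices \<rho> ys"
  shows "\<rho> (ys ! i) c \<le> 3 * R"
proof (rule close_if_majority_radius_le)
  define B where "B = {k. k < length ys \<and> majority_radius \<rho> ys k < majority_radius \<rho> ys i}"
  have "2 * card B < length ys"
    using assms extract_indices_iff[OF ys_nonempty] by (simp add: B_def)
  then have "\<not> {k. k < length ys \<and> \<rho> (ys ! k) c \<le> R} \<subseteq> B"
    using maj card_mono[of B "{k. k < length ys \<and> \<rho> (ys ! k) c \<le> R}"] by (fastforce simp: B_def)
  then obtain k where k: "k < length ys" "\<rho> (ys ! k) c \<le> R" "k \<notin> B" by blast
  then have "majority_radius \<rho> ys i \<le> majority_radius \<rho> ys k" by (simp add: B_def)
  with k show "majority_radius \<rho> ys i \<le> 2 * R" using majority_radius_good[of k] by linarith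
qed

end

end

lemma pseudometric_dist: "pseudometric (dist :: 'a::metric_space \<Rightarrow> 'a \<Rightarrow> real)"
  by unfold_locales (rule zero_le_dist dist_commute dist_triangle)+

lemma pseudometric_gap: "pseudometric (gap_pseudometric h v)"
  by unfold_locales (auto simp: gap_pseudometric_def inner_diff_right)

lemma central_indices_close:
  fixes ys :: "'a::metric_space list"
  assumes maj: "length ys < 2 * card {k. k < length ys \<and> dist (ys ! k) c \<le> R}"
    and i: "i \<in> central_indices ys"
  shows "dist (ys ! i) c \<le> 3 * R"
proof -
  interpret pseudometric "dist :: 'a \<Rightarrow> 'a \<Rightarrow> real" by (rule pseudometric_dist)
  have "{k. k < length ys \<and> dist (ys ! k) c \<le> R} \<noteq> {}"
    using maj by (metis card.empty less_nat_zero_code mult_0_right)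
  then obtain k where k: "k < length ys" "dist (ys ! k) c \<le> R" by blast
  show ?thesis
  proof (rule close_if_majority_radius_le[OF maj])
    show "majority_radius dist ys i \<le> 2 * R"
      using i k majority_radius_good[OF maj k(2)] unfolding central_indices_def by fastforce
  qed
qed

section \<open>Measurability of the selected indices\<close>

lemma borel_measurable_majority_radius:
  assumes len: "\<And>w. length (ys w) = m" and m: "m > 0"
    and meas: "\<And>k. k < m \<Longrightarrow> (\<lambda>w. \<rho> w (ys w ! i) (ys w ! k)) \<in> borel_measurable N"
  shows "(\<lambda>w. majority_radius (\<rho> w) (ys w) i) \<in> borel_measurable N"
proof -
  have ne: "ys w \<noteq> []" for w using len[of w] m by auto
  define cnt where "cnt = (\<lambda>c w. card {k. k < m \<and> \<rho> w (ys w ! i) (ys w ! k) \<le> c})"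
  have [measurable]: "cnt c \<in> measurable N (count_space UNIV)" for c
  proof -
    have "(\<lambda>w. if \<rho> w (ys w ! i) (ys w ! k) \<le> c then 1 else 0 :: nat) \<in> measurable N (count_space UNIV)"
      if "k \<in> {..<m}" for k
    proof -
      have [measurable]: "(\<lambda>w. \<rho> w (ys w ! i) (ys w ! k)) \<in> borel_measurable N" using that meas by auto
      show ?thesis by measurable
    qed
    then show ?thesis unfolding cnt_def card_Collect_eq_sum by measurable
  qed
  have mono: "cnt a w \<le> cnt b w" if "a \<le> b" for a b w
    unfolding cnt_def using that by (intro card_mono) auto
  \<comment> \<open>The count is monotone in the radius, so the least radius is at most
    \<open>c\<close> exactly when \<open>c\<close> itself captures a majority; sublevel sets become
    conditions on finite counts.\<close>
  have iff: "majority_radius (\<rho> w) (ys w) i \<le> c \<longleftrightarrow> 0 \<le> c \<and> m < 2 * cnt c w" for w c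
    using majority_radius_least[OF ne[of w], where \<rho> = "\<rho> w" and i = i] mono[of "majority_radius (\<rho> w) (ys w) i" c w]
    unfolding cnt_def len by fastforce
  show ?thesis
    unfolding borel_measurable_iff_le iff by measurable
qed

text \<open>Random index sets are treated as elements of a finite discrete space, so that
  \<open>pick\<close> can later be applied to one fixed set at a time.\<close>

lemma measurable_finite_subset_valued:
  assumes "\<And>w. w \<in> space N \<Longrightarrow> I w \<subseteq> {..<m::nat} \<and> I w \<noteq> {}"
    and "\<And>i. i < m \<Longrightarrow> {w \<in> space N. i \<in> I w} \<in> sets N"
  shows "I \<in> measurable N (count_space (Pow {..<m} - {{}}))"
proof (subst measurable_count_space_eq2)
  show "finite (Pow {..<m} - {{}})" by simp
  have [measurable]: "Measurable.pred N (\<lambda>w. i \<in> I w)" if "i < m" for i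
    using assms(2)[OF that] by (simp add: pred_def)
  have "I -` {J} \<inter> space N \<in> sets N" if J: "J \<in> Pow {..<m}" for J
  proof -
    have "I -` {J} \<inter> space N = {w \<in> space N. \<forall>i\<in>{..<m}. i \<in> I w \<longleftrightarrow> i \<in> J}"
    proof (intro set_eqI iffI)
      fix w assume w: "w \<in> {w \<in> space N. \<forall>i\<in>{..<m}. i \<in> I w \<longleftrightarrow> i \<in> J}"
      then have "I w \<subseteq> {..<m}" using assms(1) by blast
      with w J have "I w = J" by blast
      with w show "w \<in> I -` {J} \<inter> space N" by simp
    qed auto
    also have "\<dots> \<in> sets N"
    proof (rule sets.sets_Collect_finite_All)
      fix i assume "i \<in> {..<m}"
      then have [measurable]: "Measurable.pred N (\<lambda>w. i \<in> I w)" using assms(2)[of i] by (simp add: pred_def)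
      show "{w \<in> space N. (i \<in> I w) = (i \<in> J)} \<in> sets N" by measurable
    qed simp
    finally show ?thesis .
  qed
  then show "I \<in> space N \<rightarrow> Pow {..<m} - {{}} \<and> (\<forall>a\<in>Pow {..<m} - {{}}. I -` {a} \<inter> space N \<in> sets N)"
    using assms(1) by auto
qed

lemma measurable_extract_indices:
  assumes len: "\<And>w. length (ys w) = m" and m: "m > 0"
    and meas: "\<And>i k. i < m \<Longrightarrow> k < m \<Longrightarrow> (\<lambda>w. \<rho> w (ys w ! i) (ys w ! k)) \<in> borel_measurable N"
  shows "(\<lambda>w. extract_indices (\<rho> w) (ys w)) \<in> measurable N (count_space (Pow {..<m} - {{}}))"
proof (rule measurable_finite_subset_valued)
  have ne: "ys w \<noteq> []" for w using len[of w] m by auto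
  show "extract_indices (\<rho> w) (ys w) \<subseteq> {..<m} \<and> extract_indices (\<rho> w) (ys w) \<noteq> {}" for w
    using extract_indices_nonempty[OF ne] extract_indices_subset[of "\<rho> w" "ys w"] by (simp add: len)
  fix i assume i: "i < m"
  have r: "(\<lambda>w. majority_radius (\<rho> w) (ys w) j) \<in> borel_measurable N" if "j < m" for j
    using that by (intro borel_measurable_majority_radius[OF len m] meas)
  define b where "b = (\<lambda>w k. if majority_radius (\<rho> w) (ys w) k < majority_radius (\<rho> w) (ys w) i then 1 else 0 :: nat)"
  have "(\<lambda>w. b w k) \<in> measurable N (count_space UNIV)" if "k \<in> {..<m}" for k
  proof -
    have k: "k < m" using that by simp
    note [measurable] = r[OF i] r[OF k]
    show ?thesis unfolding b_def by measurable
  qed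
  then have [measurable]: "(\<lambda>w. \<Sum>k<m. b w k) \<in> measurable N (count_space UNIV)" by measurable
  have "card {k. k < m \<and> majority_radius (\<rho> w) (ys w) k < majority_radius (\<rho> w) (ys w) i} = (\<Sum>k<m. b w k)" for w
    by (simp add: b_def card_Collect_eq_sum)
  then have "{w \<in> space N. i \<in> extract_indices (\<rho> w) (ys w)} = {w \<in> space N. 2 * (\<Sum>k<m. b w k) < m}"
    using i by (simp add: extract_indices_iff[OF ne] len)
  then show "{w \<in> space N. i \<in> extract_indices (\<rho> w) (ys w)} \<in> sets N" by simp
qed

lemma measurable_central_indices:
  fixes ys :: "'w \<Rightarrow> 'a::euclidean_space list"
  assumes len: "\<And>w. length (ys w) = m" and m: "m > 0"
    and meas: "\<And>i. i < m \<Longrightarrow> (\<lambda>w. ys w ! i) \<in> borel_measurable N"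
  shows "(\<lambda>w. central_indices (ys w)) \<in> measurable N (count_space (Pow {..<m} - {{}}))"
proof (rule measurable_finite_subset_valued)
  have ne: "ys w \<noteq> []" for w using len[of w] m by auto
  show "central_indices (ys w) \<subseteq> {..<m} \<and> central_indices (ys w) \<noteq> {}" for w
    using central_indices_nonempty[OF ne, of w] by (auto simp: len central_indices_def)
  fix i assume i: "i < m"
  have r: "(\<lambda>w. majority_radius dist (ys w) j) \<in> borel_measurable N" if "j < m" for j
    using that by (intro borel_measurable_majority_radius[OF len m] borel_measurable_dist meas)
  have "{w \<in> space N. i \<in> central_indices (ys w)}
      = {w \<in> space N. \<forall>k\<in>{..<m}. majority_radius dist (ys w) i \<le> majority_radius dist (ys w) k}"
    using i by (auto simp: central_indices_def len)
  also have "\<dots> \<in> sets N"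
  proof (rule sets.sets_Collect_finite_All)
    fix k assume "k \<in> {..<m}"
    then have [measurable]: "(\<lambda>w. majority_radius dist (ys w) k) \<in> borel_measurable N" using r by simp
    note [measurable] = r[OF i]
    show "{w \<in> space N. majority_radius dist (ys w) i \<le> majority_radius dist (ys w) k} \<in> sets N" by measurable
  qed simp
  finally show "{w \<in> space N. i \<in> central_indices (ys w)} \<in> sets N" .
qed

text \<open>Decomposes over the finitely many values of the index set and then of the chosen index,
  so measurability of \<open>pick\<close> for each fixed set suffices.\<close>

lemma borel_measurable_nth_index:
  fixes ys :: "'w \<Rightarrow> 'a::euclidean_space list"
  assumes meas: "\<And>i. i < m \<Longrightarrow> (\<lambda>w. ys w ! i) \<in> borel_measurable N"
    and I: "I \<in> measurable N (count_space (Pow {..<m} - {{}}))"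
    and pick: "\<And>J. J \<in> Pow {..<m} - {{}} \<Longrightarrow> (\<lambda>w. pk w J) \<in> measurable N (count_space UNIV)"
    and mem: "\<And>w J. J \<in> Pow {..<m} - {{}} \<Longrightarrow> pk w J \<in> J"
  shows "(\<lambda>w. ys w ! pk w (I w)) \<in> borel_measurable N"
proof -
  have "(\<lambda>w. pk w (I w)) \<in> measurable N (count_space {..<m})"
  proof (rule measurable_compose_countable'[OF _ I])
    fix J assume J: "J \<in> Pow {..<m} - {{}}"
    have "(\<lambda>w. pk w J) \<in> space N \<rightarrow> {..<m}" using J mem[OF J] by auto
    then show "(\<lambda>w. pk w J) \<in> measurable N (count_space {..<m})"
      using pick[OF J] by (auto simp: measurable_count_space_eq2_countable)
  qed (auto intro: countable_finite)
  then show ?thesis by (rule measurable_compose_countable'[where f = "\<lambda>i w. ys w ! i", rotated]) (use meas in auto)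
qed

section \<open>Regularized empirical and population objectives\<close>

lemma uniformly_continuous_on_Lipschitz_bound:
  fixes \<psi> :: "'a::real_normed_vector \<Rightarrow> real"
  assumes "\<And>x y. x \<in> C \<Longrightarrow> y \<in> C \<Longrightarrow> \<bar>\<psi> x - \<psi> y\<bar> \<le> B * norm (x - y)" "0 \<le> B"
  shows "uniformly_continuous_on C \<psi>"
proof -
  have "B-lipschitz_on C \<psi>"
    by (rule lipschitz_onI) (use assms in \<open>auto simp: dist_norm\<close>)
  then show ?thesis by (rule lipschitz_on_uniformly_continuous)
qed

lemma continuous_on_smooth_fun:
  assumes "smooth_fun L u" shows "continuous_on UNIV u"
proof -
  obtain D where "\<And>x. GDERIV u x :> D x" using assms unfolding smooth_fun_def by blast
  then have "u differentiable (at x)" for x unfolding gderiv_def differentiable_def by blast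
  then show ?thesis by (simp add: continuous_at_imp_continuous_on differentiable_imp_continuous_within)
qed

lemma strongly_convex_on_cong:
  assumes "strongly_convex_on \<mu> C u" "\<And>x. x \<in> C \<Longrightarrow> u x = \<psi> x"
  shows "strongly_convex_on \<mu> C \<psi>"
  unfolding strongly_convex_on_def
proof (intro ballI)
  fix x y and t :: real assume h: "x \<in> C" "y \<in> C" "t \<in> {0..1}"
  then have 1: "(1 - t) *\<^sub>R x + t *\<^sub>R y \<in> C \<and>
        u ((1 - t) *\<^sub>R x + t *\<^sub>R y) + \<mu> / 2 * (t * (1 - t)) * (norm (x - y))^2
          \<le> (1 - t) * u x + t * u y"
    using assms(1) unfolding strongly_convex_on_def by blast
  then have "u ((1 - t) *\<^sub>R x + t *\<^sub>R y) = \<psi> ((1 - t) *\<^sub>R x + t *\<^sub>R y)" "u x = \<psi> x" "u y = \<psi> y"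
    using assms(2) h by blast+
  with 1 show "(1 - t) *\<^sub>R x + t *\<^sub>R y \<in> C \<and>
        \<psi> ((1 - t) *\<^sub>R x + t *\<^sub>R y) + \<mu> / 2 * (t * (1 - t)) * (norm (x - y))^2
          \<le> (1 - t) * \<psi> x + t * \<psi> y" by metis
qed

lemma graph_dense_add_continuous:
  fixes G u :: "'a::euclidean_space \<Rightarrow> real"
  assumes D: "D \<subseteq> C" "\<And>y e. y \<in> C \<Longrightarrow> e > 0 \<Longrightarrow> \<exists>d\<in>D. dist d y < e \<and> \<bar>u d - u y\<bar> < e"
    and G: "continuous_on C G" and y: "y \<in> C" "e > 0"
  shows "\<exists>d\<in>D. G d + u d < G y + u y + e"
proof -
  obtain r where r: "r > 0" "\<And>d. d \<in> C \<Longrightarrow> dist d y < r \<Longrightarrow> dist (G d) (G y) < e / 2"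
    using G y unfolding continuous_on_iff by (metis half_gt_zero)
  obtain d where d: "d \<in> D" "dist d y < min r (e / 2)" "\<bar>u d - u y\<bar> < min r (e / 2)"
    using D(2)[OF y(1), of "min r (e / 2)"] r y by auto
  then have "dist (G d) (G y) < e / 2" using r(2)[of d] D(1) by auto
  then have "\<bar>G d - G y\<bar> < e / 2" by (simp add: dist_real_def)
  moreover have "\<bar>u d - u y\<bar> < e / 2" using d(3) by simp
  ultimately have "G d + u d < G y + u y + e" by linarith
  with d show ?thesis by blast
qed

text \<open>The hypotheses of the theorem, except that strong convexity holds for every sample and that the
  Lipschitz modulus is nonnegative. The main theorem reduces to this case by changing \<open>g\<close> on a null
  set of samples and replacing \<open>ell\<close> by its absolute value.\<close>

locale composite = sequence_space Z for Z :: "'z measure" +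
  fixes g :: "'a::euclidean_space \<Rightarrow> 'z \<Rightarrow> real" and h :: "'a \<Rightarrow> ereal" and ell :: "'z \<Rightarrow> real"
    and U :: "'a set" and \<mu> L lbar :: real
  assumes g_measurable: "(\<lambda>(x, z). g x z) \<in> borel_measurable (borel \<Otimes>\<^sub>M Z)"
    and g_integrable: "\<And>x. integrable Z (g x)"
    and h_closed: "closed (epi h)"
    and h_not_minus_inf: "\<And>x. h x \<noteq> -\<infinity>"
    and h_proper: "effdom h \<noteq> {}"
    and mu_pos: "\<mu> > 0"
    and strong_convexity: "\<And>z. z \<in> space Z \<Longrightarrow> strongly_convex_fun \<mu> (\<lambda>x. ereal (g x z) + h x)"
    and U_nbhd: "open U" "effdom h \<subseteq> U"
    and ell_measurable: "ell \<in> borel_measurable Z"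
    and ell_nonneg: "\<And>z. 0 \<le> ell z"
    and lbar_pos: "lbar > 0"
    and ell_square_integrable: "integrable Z (\<lambda>z. (ell z)^2)"
    and ell_bound: "(\<integral>z. (ell z)^2 \<partial>Z) \<le> lbar^2"
    and g_lipschitz: "\<And>x y z. x \<in> U \<Longrightarrow> y \<in> U \<Longrightarrow> z \<in> space Z \<Longrightarrow>
                        \<bar>g x z - g y z\<bar> \<le> ell z * norm (x - y)"
    and L_pos: "L > 0"
    and gbar_smooth: "smooth_fun L (\<lambda>x. \<integral>z. g x z \<partial>Z)"
begin

text \<open>Minimization is carried out over \<open>C\<close> with the real values \<open>hr\<close> of \<open>h\<close>. The empirical objective
  \<open>emp\<close> uses the first \<open>N\<close> entries of an infinite sample sequence.\<close>

definition "C = effdom h"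
definition "hr x = real_of_ereal (h x)"
definition "gbar x = (\<integral>z. g x z \<partial>Z)"
definition "emp lam N x \<zeta> y = 1 / real N * (\<Sum>i<N. g y (\<zeta> i)) + hr y + lam / 2 * (norm (y - x))^2"
definition "pop lam x y = gbar y + hr y + lam / 2 * (norm (y - x))^2"
definition "emp_min lam N x \<zeta> = arg_min_on (emp lam N x \<zeta>) C"
definition "pop_min lam x = arg_min_on (pop lam x) C"

lemma h_eq_hr: "x \<in> C \<Longrightarrow> h x = ereal (hr x)"
  using h_not_minus_inf[of x] by (cases "h x") (auto simp: C_def effdom_def hr_def)

lemma h_eq_inf: "x \<notin> C \<Longrightarrow> h x = \<infinity>"
  by (auto simp: C_def effdom_def)

lemma C_nonempty: "C \<noteq> {}"
  using h_proper by (simp add: C_def)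

lemma C_subset_U: "C \<subseteq> U"
  using U_nbhd by (simp add: C_def)

lemma space_S_iff: "w \<in> space S \<longleftrightarrow> (\<forall>i. w i \<in> space Z)"
  by (auto simp: space_PiM PiE_iff)

lemma measurable_g [measurable (raw)]:
  assumes "X \<in> borel_measurable N" "Y \<in> measurable N Z"
  shows "(\<lambda>w. g (X w) (Y w)) \<in> borel_measurable N"
  using measurable_compose[OF measurable_Pair[OF assms] g_measurable] by simp

lemma borel_measurable_ell [measurable]: "ell \<in> borel_measurable Z"
  by (rule ell_measurable)

lemma sc_g:
  assumes z: "z \<in> space Z"
  shows "strongly_convex_on \<mu> C (\<lambda>x. g x z + hr x)"
proof -
  have "effdom (\<lambda>x. ereal (g x z) + h x) = C"
    by (auto simp: effdom_def C_def)
  moreover have "ereal (g x z) + h x \<noteq> -\<infinity>" for x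
    using h_not_minus_inf[of x] by (cases "h x") auto
  ultimately have "strongly_convex_on \<mu> C (\<lambda>x. real_of_ereal (ereal (g x z) + h x))"
    using strongly_convex_on_real_of_ereal[OF strong_convexity[OF z]] by simp
  then show ?thesis by (rule strongly_convex_on_cong) (simp add: h_eq_hr)
qed

lemma sc_avg:
  assumes \<zeta>: "\<zeta> \<in> space S" and N: "N > 0"
  shows "strongly_convex_on \<mu> C (\<lambda>x. 1 / real N * (\<Sum>i<N. g x (\<zeta> i)) + hr x)"
  unfolding strongly_convex_on_def
proof (intro ballI conjI)
  fix x y and t :: real assume h: "x \<in> C" "y \<in> C" "t \<in> {0..1}"
  have z: "\<zeta> i \<in> space Z" for i using \<zeta> by (simp add: space_S_iff)
  define u where "u = (1 - t) *\<^sub>R x + t *\<^sub>R y"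
  define q where "q = \<mu> / 2 * (t * (1 - t)) * (norm (x - y))^2"
  show "(1 - t) *\<^sub>R x + t *\<^sub>R y \<in> C" using sc_g[OF z[of 0]] h by (auto simp: strongly_convex_on_def)
  have "g u (\<zeta> i) + hr u + q \<le> (1 - t) * (g x (\<zeta> i) + hr x) + t * (g y (\<zeta> i) + hr y)" for i
    using sc_g[OF z[of i]] h unfolding strongly_convex_on_def u_def q_def by blast
  moreover have sum_shift: "(\<Sum>i<N. a i + c) = (\<Sum>i<N. a i) + real N * c" for a c
    by (simp add: sum.distrib)
  ultimately have "(\<Sum>i<N. g u (\<zeta> i) + (hr u + q)) \<le> (\<Sum>i<N. (1 - t) * g x (\<zeta> i) + t * g y (\<zeta> i) + ((1 - t) * hr x + t * hr y))"
    by (intro sum_mono) (simp add: algebra_simps)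
  then have "(\<Sum>i<N. g u (\<zeta> i)) + real N * (hr u + q) \<le> (1 - t) * (\<Sum>i<N. g x (\<zeta> i)) + t * (\<Sum>i<N. g y (\<zeta> i)) + real N * ((1 - t) * hr x + t * hr y)"
    unfolding sum_shift by (simp add: sum.distrib sum_distrib_left)
  then have "1 / real N * ((\<Sum>i<N. g u (\<zeta> i)) + real N * (hr u + q)) \<le> 1 / real N * ((1 - t) * (\<Sum>i<N. g x (\<zeta> i)) + t * (\<Sum>i<N. g y (\<zeta> i)) + real N * ((1 - t) * hr x + t * hr y))"
    by (intro mult_left_mono) auto
  moreover have "1 / real N * (a + real N * b) = 1 / real N * a + b" for a b
    using N by (simp add: field_simps)
  ultimately have "1 / real N * (\<Sum>i<N. g u (\<zeta> i)) + (hr u + q) \<le> 1 / real N * ((1 - t) * (\<Sum>i<N. g x (\<zeta> i)) + t * (\<Sum>i<N. g y (\<zeta> i))) + ((1 - t) * hr x + t * hr y)"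
    by metis
  then show "1 / real N * (\<Sum>i<N. g ((1 - t) *\<^sub>R x + t *\<^sub>R y) (\<zeta> i)) + hr ((1 - t) *\<^sub>R x + t *\<^sub>R y) + \<mu> / 2 * (t * (1 - t)) * (norm (x - y))^2
     \<le> (1 - t) * (1 / real N * (\<Sum>i<N. g x (\<zeta> i)) + hr x) + t * (1 / real N * (\<Sum>i<N. g y (\<zeta> i)) + hr y)"
    unfolding u_def[symmetric] q_def[symmetric] by (simp only: distrib_left add.assoc mult.left_commute add.left_commute add.commute)
qed

lemma sc_gbar: "strongly_convex_on \<mu> C (\<lambda>x. gbar x + hr x)"
  unfolding strongly_convex_on_def
proof (intro ballI conjI)
  fix x y and t :: real assume h: "x \<in> C" "y \<in> C" "t \<in> {0..1}"
  define u where "u = (1 - t) *\<^sub>R x + t *\<^sub>R y"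
  define q where "q = \<mu> / 2 * (t * (1 - t)) * (norm (x - y))^2"
  \<comment> \<open>Convexity of \<open>C\<close> is read off from the strong convexity for a single
    sample, which exists because a probability space is not empty.\<close>
  obtain z0 where "z0 \<in> space Z" using M.not_empty by auto
  then show "(1 - t) *\<^sub>R x + t *\<^sub>R y \<in> C" using sc_g h by (auto simp: strongly_convex_on_def)
  have "g u z + (hr u + q) \<le> (1 - t) * g x z + t * g y z + ((1 - t) * hr x + t * hr y)" if "z \<in> space Z" for z
  proof -
    have "g u z + hr u + q \<le> (1 - t) * (g x z + hr x) + t * (g y z + hr y)"
      using sc_g[OF that] h unfolding strongly_convex_on_def u_def q_def by blast
    then show ?thesis by (simp add: algebra_simps)
  qed
  then have "(\<integral>z. g u z + (hr u + q) \<partial>Z) \<le> (\<integral>z. (1 - t) * g x z + t * g y z + ((1 - t) * hr x + t * hr y) \<partial>Z)"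
    by (intro integral_mono Bochner_Integration.integrable_add integrable_mult_right g_integrable) auto
  then have "gbar u + (hr u + q) \<le> (1 - t) * gbar x + t * gbar y + ((1 - t) * hr x + t * hr y)"
    using g_integrable by (simp add: gbar_def M.prob_space)
  then show "gbar ((1 - t) *\<^sub>R x + t *\<^sub>R y) + hr ((1 - t) *\<^sub>R x + t *\<^sub>R y) + \<mu> / 2 * (t * (1 - t)) * (norm (x - y))^2
     \<le> (1 - t) * (gbar x + hr x) + t * (gbar y + hr y)"
    unfolding u_def[symmetric] q_def[symmetric] by (simp add: algebra_simps)
qed

lemma integrable_ell: "integrable Z ell"
proof (rule Bochner_Integration.integrable_bound)
  show "integrable Z (\<lambda>z. 1 + (ell z)^2)" using ell_square_integrable by simp
  show "AE z in Z. norm (ell z) \<le> norm (1 + (ell z)^2)"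
  proof (rule AE_I2)
    fix z
    have "2 * ell z * 1 \<le> (ell z)^2 + 1^2" by (rule sum_squares_bound)
    then show "norm (ell z) \<le> norm (1 + (ell z)^2)" using ell_nonneg[of z] by simp
  qed
qed simp

text \<open>Cauchy-Schwarz against the constant 1, obtained by integrating
  \<open>2 * lbar * ell z \<le> lbar^2 + (ell z)^2\<close>.\<close>

lemma integral_ell_le: "(\<integral>z. ell z \<partial>Z) \<le> lbar"
proof -
  have "(\<integral>z. 2 * lbar * ell z \<partial>Z) \<le> (\<integral>z. lbar^2 + (ell z)^2 \<partial>Z)"
    by (intro integral_mono integrable_mult_right Bochner_Integration.integrable_add integrable_ell ell_square_integrable)
       (auto intro: sum_squares_bound)
  also have "\<dots> = lbar^2 + (\<integral>z. (ell z)^2 \<partial>Z)" using ell_square_integrable by (simp add: M.prob_space)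
  also have "\<dots> \<le> 2 * lbar * lbar" using ell_bound by (simp add: power2_eq_square)
  finally have "(2 * lbar) * (\<integral>z. ell z \<partial>Z) \<le> (2 * lbar) * lbar" by simp
  then show ?thesis using lbar_pos by simp
qed

lemma gbar_lipschitz:
  assumes "x \<in> U" "y \<in> U" shows "\<bar>gbar x - gbar y\<bar> \<le> lbar * norm (x - y)"
proof -
  have "\<bar>gbar x - gbar y\<bar> = \<bar>\<integral>z. g x z - g y z \<partial>Z\<bar>"
    using g_integrable by (simp add: gbar_def)
  also have "\<dots> \<le> (\<integral>z. \<bar>g x z - g y z\<bar> \<partial>Z)" by (rule integral_abs_bound)
  also have "\<dots> \<le> (\<integral>z. ell z * norm (x - y) \<partial>Z)"
    using g_integrable integrable_ell assms g_lipschitz by (intro integral_mono) auto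
  also have "\<dots> \<le> lbar * norm (x - y)" using integral_ell_le by (simp add: mult_right_mono)
  finally show ?thesis .
qed

lemma gbar_gderiv: "\<exists>D. (\<forall>x. GDERIV gbar x :> D x) \<and> L-lipschitz_on UNIV D"
  using gbar_smooth unfolding smooth_fun_def gbar_def[abs_def] .

lemma continuous_on_gbar: "continuous_on UNIV gbar"
  using continuous_on_smooth_fun[OF gbar_smooth] by (simp add: gbar_def[abs_def])

lemma borel_measurable_gbar [measurable]: "gbar \<in> borel_measurable borel"
  by (rule borel_measurable_continuous_onI[OF continuous_on_gbar])

lemma uniformly_continuous_on_avg:
  assumes "\<zeta> \<in> space S"
  shows "uniformly_continuous_on C (\<lambda>y. 1 / real N * (\<Sum>i<N. g y (\<zeta> i)))"
proof (rule uniformly_continuous_on_Lipschitz_bound)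
  show "0 \<le> 1 / real N * (\<Sum>i<N. ell (\<zeta> i))" using ell_nonneg by (simp add: sum_nonneg)
  fix x y assume "x \<in> C" "y \<in> C"
  then have xy: "x \<in> U" "y \<in> U" using C_subset_U by auto
  have "\<bar>(\<Sum>i<N. g x (\<zeta> i)) - (\<Sum>i<N. g y (\<zeta> i))\<bar> \<le> (\<Sum>i<N. \<bar>g x (\<zeta> i) - g y (\<zeta> i)\<bar>)"
    by (simp add: sum_subtractf[symmetric])
  also have "\<dots> \<le> (\<Sum>i<N. ell (\<zeta> i) * norm (x - y))"
    using assms by (intro sum_mono g_lipschitz xy) (simp add: space_S_iff)
  finally have "\<bar>(\<Sum>i<N. g x (\<zeta> i)) - (\<Sum>i<N. g y (\<zeta> i))\<bar> \<le> (\<Sum>i<N. ell (\<zeta> i)) * norm (x - y)"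
    by (simp add: sum_distrib_right)
  then have "1 / real N * \<bar>(\<Sum>i<N. g x (\<zeta> i)) - (\<Sum>i<N. g y (\<zeta> i))\<bar> \<le> 1 / real N * ((\<Sum>i<N. ell (\<zeta> i)) * norm (x - y))"
    by (intro mult_left_mono) auto
  then show "\<bar>1 / real N * (\<Sum>i<N. g x (\<zeta> i)) - 1 / real N * (\<Sum>i<N. g y (\<zeta> i))\<bar> \<le> 1 / real N * (\<Sum>i<N. ell (\<zeta> i)) * norm (x - y)"
    unfolding right_diff_distrib[symmetric] abs_mult by simp
qed

lemma closed_epi_hr: "closed (epi_on C hr)"
proof -
  have "epi_on C hr = epi h"
  proof -
    have "(x \<in> C \<and> hr x \<le> t) = (h x \<le> ereal t)" for x t
      by (cases "x \<in> C") (simp_all add: h_eq_hr h_eq_inf)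
    then show ?thesis by (auto simp: epi_on_def epi_def)
  qed
  then show ?thesis using h_closed by simp
qed

lemma continuous_on_prox: "continuous_on UNIV (\<lambda>y. lam / 2 * (norm (y - x :: 'a))^2)"
  by (intro continuous_intros)

text \<open>For closedness, \<open>hr\<close> comes first because its epigraph is the one known to
  be closed; the average is added by uniform continuity on \<open>C\<close>, the quadratic by
  continuity everywhere.\<close>

lemma growth_min_emp_min:
  assumes "\<zeta> \<in> space S" "N > 0" "0 \<le> lam"
  shows "growth_min (\<mu> + lam) C (emp lam N x \<zeta>) (emp_min lam N x \<zeta>)"
proof -
  have "closed (epi_on C (\<lambda>y. hr y + 1 / real N * (\<Sum>i<N. g y (\<zeta> i)) + lam / 2 * (norm (y - x))^2))"
    by (intro closed_epi_on_add_continuous closed_epi_on_add closed_epi_hr uniformly_continuous_on_avg assms continuous_on_prox)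
  then have "closed (epi_on C (emp lam N x \<zeta>))" by (simp add: emp_def[abs_def] add_ac)
  moreover have "strongly_convex_on (\<mu> + lam) C (emp lam N x \<zeta>)"
    unfolding emp_def[abs_def] by (intro strongly_convex_on_add_prox sc_avg assms)
  moreover have "\<mu> + lam > 0" using mu_pos assms by simp
  ultimately show ?thesis unfolding emp_min_def
    using strongly_convex_attains_min[OF _ _ _ C_nonempty] growth_min_arg_min_on by metis
qed

lemma growth_min_pop_min:
  assumes "0 \<le> lam"
  shows "growth_min (\<mu> + lam) C (pop lam x) (pop_min lam x)"
proof -
  have "closed (epi_on C (\<lambda>y. hr y + gbar y + lam / 2 * (norm (y - x))^2))"
    by (intro closed_epi_on_add_continuous closed_epi_hr continuous_on_gbar continuous_on_prox)
  then have "closed (epi_on C (pop lam x))" by (simp add: pop_def[abs_def] add_ac)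
  moreover have "strongly_convex_on (\<mu> + lam) C (pop lam x)"
    unfolding pop_def[abs_def] by (intro strongly_convex_on_add_prox sc_gbar)
  moreover have "\<mu> + lam > 0" using mu_pos assms by simp
  ultimately show ?thesis unfolding pop_min_def
    using strongly_convex_attains_min[OF _ _ _ C_nonempty] growth_min_arg_min_on by metis
qed

lemma emp_min_in_C: "\<zeta> \<in> space S \<Longrightarrow> N > 0 \<Longrightarrow> 0 \<le> lam \<Longrightarrow> emp_min lam N x \<zeta> \<in> C"
  using growth_min_emp_min by (auto simp: growth_min_def)

lemma pop_min_in_C: "0 \<le> lam \<Longrightarrow> pop_min lam x \<in> C"
  using growth_min_pop_min by (auto simp: growth_min_def)

lemma depends_on_first_emp_min: "depends_on_first N (emp_min lam N x)"
  unfolding depends_on_first_def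
proof (intro allI impI)
  fix w w' :: "nat \<Rightarrow> 'z" assume "\<forall>i<N. w i = w' i"
  then have "emp lam N x w = emp lam N x w'" by (simp add: emp_def fun_eq_iff)
  then show "emp_min lam N x w = emp_min lam N x w'" by (simp add: emp_min_def)
qed

text \<open>Joint in center and samples, because the center of a stage is itself computed from
  earlier samples.\<close>

lemma measurable_emp_min:
  assumes lam: "0 \<le> lam" and N: "N > 0"
  shows "(\<lambda>p. emp_min lam N (fst p) (snd p)) \<in> borel_measurable (borel \<Otimes>\<^sub>M S)"
proof -
  obtain D where D: "countable D" "D \<subseteq> C"
    "\<And>y e. y \<in> C \<Longrightarrow> e > 0 \<Longrightarrow> \<exists>d\<in>D. dist d y < e \<and> \<bar>hr d - hr y\<bar> < e"
    using countable_graph_dense[of C hr] by metis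
  have sp: "snd p \<in> space S" if "p \<in> space (borel \<Otimes>\<^sub>M S)" for p :: "'a \<times> (nat \<Rightarrow> 'z)"
    using that by (auto simp: space_pair_measure)
  show ?thesis
    unfolding emp_min_def
  proof (rule borel_measurable_arg_min_on[OF D(1,2)])
    show "\<mu> + lam > 0" using mu_pos lam by simp
    fix p :: "'a \<times> (nat \<Rightarrow> 'z)" assume p: "p \<in> space (borel \<Otimes>\<^sub>M S)"
    show "\<exists>x. growth_min (\<mu> + lam) C (emp lam N (fst p) (snd p)) x"
      using growth_min_emp_min[OF sp[OF p] N lam] by blast
    fix y and e :: real assume y: "y \<in> C" "e > 0"
    have "continuous_on C (\<lambda>y. 1 / real N * (\<Sum>i<N. g y (snd p i)) + lam / 2 * (norm (y - fst p))^2)"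
      using uniformly_continuous_imp_continuous[OF uniformly_continuous_on_avg[OF sp[OF p], of N]]
      by (intro continuous_on_add continuous_on_subset[OF continuous_on_prox]) auto
    from graph_dense_add_continuous[OF D(2,3) this y]
    show "\<exists>d\<in>D. emp lam N (fst p) (snd p) d < emp lam N (fst p) (snd p) y + e"
      unfolding emp_def by (simp add: add_ac)
  next
    fix y :: 'a
    show "(\<lambda>p. emp lam N (fst p) (snd p) y) \<in> borel_measurable (borel \<Otimes>\<^sub>M S)"
      unfolding emp_def by measurable
  qed
qed

lemma measurable_emp_min' [measurable (raw)]:
  assumes "0 \<le> lam" "N > 0" "X \<in> borel_measurable Q" "Y \<in> measurable Q S"
  shows "(\<lambda>w. emp_min lam N (X w) (Y w)) \<in> borel_measurable Q"
  using measurable_compose[OF measurable_Pair[OF assms(3,4)] measurable_emp_min[OF assms(1,2)]] by simp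

lemma measurable_pop_min:
  assumes lam: "0 \<le> lam"
  shows "pop_min lam \<in> borel_measurable borel"
proof -
  obtain D where D: "countable D" "D \<subseteq> C"
    "\<And>y e. y \<in> C \<Longrightarrow> e > 0 \<Longrightarrow> \<exists>d\<in>D. dist d y < e \<and> \<bar>hr d - hr y\<bar> < e"
    using countable_graph_dense[of C hr] by metis
  have "(\<lambda>x. arg_min_on (pop lam x) C) \<in> borel_measurable borel"
  proof (rule borel_measurable_arg_min_on[OF D(1,2)])
    show "\<mu> + lam > 0" using mu_pos lam by simp
    fix x :: 'a
    show "\<exists>y. growth_min (\<mu> + lam) C (pop lam x) y"
      using growth_min_pop_min[OF lam] by blast
    fix y and e :: real assume y: "y \<in> C" "e > 0"
    have "continuous_on C (\<lambda>y. gbar y + lam / 2 * (norm (y - x))^2)"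
      by (intro continuous_on_add continuous_on_subset[OF continuous_on_prox] continuous_on_subset[OF continuous_on_gbar]) auto
    from graph_dense_add_continuous[OF D(2,3) this y]
    show "\<exists>d\<in>D. pop lam x d < pop lam x y + e"
      unfolding pop_def by (simp add: add_ac)
  next
    fix y :: 'a
    show "(\<lambda>x. pop lam x y) \<in> borel_measurable borel"
      unfolding pop_def by measurable
  qed
  then show ?thesis by (simp add: pop_min_def[abs_def])
qed

lemma measurable_h [measurable]: "h \<in> borel_measurable borel"
proof (rule borel_measurableI_le)
  fix y :: ereal
  show "{x \<in> space borel. h x \<le> y} \<in> sets borel"
  proof (cases y)
    case (real r)
    have "closed ((\<lambda>x. (x, r)) -` epi h)"
      using closed_vimage[OF h_closed, of "\<lambda>x. (x, r)"] by (simp add: continuous_intros)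
    moreover have "(\<lambda>x. (x, r)) -` epi h = {x \<in> space borel. h x \<le> y}"
      by (auto simp: epi_def real)
    ultimately show ?thesis by (metis borel_closed)
  next
    case PInf then show ?thesis by simp
  next
    case MInf then show ?thesis using h_not_minus_inf by simp
  qed
qed

lemma measurable_hr [measurable]: "hr \<in> borel_measurable borel"
  unfolding hr_def[abs_def] by measurable

end

section \<open>Stability of empirical risk minimization\<close>

lemma (in sequence_space) integrable_reindex:
  fixes u :: "_ \<Rightarrow> real"
  assumes int: "integrable S u" and f: "inj f"
  shows "integrable S (\<lambda>w. u (\<lambda>i. w (f i)))"
proof -
  have "distr S S (\<lambda>w i. w (f i)) = S"
    using distr_PiM_reindex[of UNIV "\<lambda>_. M" f UNIV] prob_space_M f by (simp add: restrict_def)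
  then have "integrable (distr S S (\<lambda>w i. w (f i))) u" using int by simp
  then show ?thesis by (rule integrable_distr[rotated]) auto
qed

text \<open>Exceeding three times the bound on the mean has probability at most 1/3; this is the
  origin of the threshold 2/3 for a single trial.\<close>

lemma (in sequence_space) prob_Markov:
  fixes u :: "_ \<Rightarrow> real"
  assumes int: "integrable S u" and nn: "\<And>w. w \<in> space S \<Longrightarrow> 0 \<le> u w"
    and le: "(\<integral>w. u w \<partial>S) \<le> c" and c: "c > 0"
  shows "measure S {w \<in> space S. u w \<le> 3 * c} \<ge> 2 / 3"
proof -
  have [measurable]: "u \<in> borel_measurable S" using int by auto
  define E where "E = {w \<in> space S. u w \<le> 3 * c}"
  have [measurable]: "E \<in> sets S" unfolding E_def by measurable
  have iE: "integrable S (indicat_real (space S - E))"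
    by (rule P.integrable_const_bound[of _ 1]) (auto split: split_indicator)
  have "measure S (space S - E) = (\<integral>w. indicator (space S - E) w \<partial>S)" by simp
  also have "\<dots> \<le> (\<integral>w. 1 / (3 * c) * u w \<partial>S)"
  proof (rule integral_mono[OF iE integrable_mult_right[OF int]])
    fix w assume w: "w \<in> space S"
    show "indicat_real (space S - E) w \<le> 1 / (3 * c) * u w"
      using w c nn[OF w] by (auto simp: E_def field_simps split: split_indicator)
  qed
  also have "\<dots> = 1 / (3 * c) * (\<integral>w. u w \<partial>S)" by simp
  also have "\<dots> \<le> 1 / (3 * c) * c" using le c by (intro mult_left_mono) auto
  also have "\<dots> = 1 / 3" using c by simp
  finally show ?thesis using P.prob_compl[of E] unfolding E_def[symmetric] by simp
qed

section \<open>Expected gap by exchange with a ghost sample\<close>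

context composite begin

definition "gap lam x y = pop lam x y - pop lam x (pop_min lam x)"

lemma gap_growth:
  assumes "0 \<le> lam" "y \<in> C"
  shows "(\<mu> + lam) / 2 * (norm (y - pop_min lam x))^2 \<le> gap lam x y"
  using growth_min_pop_min[OF assms(1), of x] assms(2) by (auto simp: growth_min_def gap_def)

lemma gap_nonneg:
  assumes "0 \<le> lam" "y \<in> C" shows "0 \<le> gap lam x y"
proof -
  have "0 \<le> (\<mu> + lam) / 2 * (norm (y - pop_min lam x))^2" using mu_pos assms by simp
  then show ?thesis using gap_growth[OF assms, of x] by linarith
qed

lemma norm_le_of_gap_le:
  assumes "0 \<le> lam" "y \<in> C" "gap lam x y \<le> e" "(\<mu> + lam) / 2 * R^2 = e" "0 \<le> R"
  shows "norm (y - pop_min lam x) \<le> R"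
proof (rule power2_le_imp_le)
  have "(\<mu> + lam) / 2 * (norm (y - pop_min lam x))^2 \<le> (\<mu> + lam) / 2 * R^2"
    using gap_growth[OF assms(1,2), of x] assms(3,4) by linarith
  moreover have "0 < (\<mu> + lam) / 2" using mu_pos assms(1) by simp
  ultimately show "(norm (y - pop_min lam x))^2 \<le> R^2"
    by (simp only: mult_le_cancel_left_pos)
qed (rule assms(5))

lemma measurable_gap [measurable]:
  assumes [measurable]: "X \<in> borel_measurable N" "Y \<in> borel_measurable N" and lam: "0 \<le> lam"
  shows "(\<lambda>w. gap lam (X w) (Y w)) \<in> borel_measurable N"
proof -
  note [measurable] = measurable_pop_min[OF lam]
  show ?thesis unfolding gap_def pop_def by measurable
qed

lemma integrable_ell_mult: "integrable S (\<lambda>w. ell (w i) * ell (w j))"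
proof (rule Bochner_Integration.integrable_bound)
  show "integrable S (\<lambda>w. (ell (w i))^2 + (ell (w j))^2)"
    by (intro Bochner_Integration.integrable_add integrable_component[OF ell_square_integrable])
  show "AE w in S. norm (ell (w i) * ell (w j)) \<le> norm ((ell (w i))^2 + (ell (w j))^2)"
  proof (rule AE_I2)
    fix w
    have "2 * ell (w i) * ell (w j) \<le> (ell (w i))^2 + (ell (w j))^2" by (rule sum_squares_bound)
    moreover have "0 \<le> ell (w i) * ell (w j)" using ell_nonneg by simp
    ultimately have "ell (w i) * ell (w j) \<le> (ell (w i))^2 + (ell (w j))^2" by linarith
    then show "norm (ell (w i) * ell (w j)) \<le> norm ((ell (w i))^2 + (ell (w j))^2)"
      using ell_nonneg by simp
  qed
qed simp

lemma integral_ell_sq_component_le: "(\<integral>w. (ell (w i))^2 \<partial>S) \<le> lbar^2"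
  using ell_bound integral_component[of "\<lambda>z. (ell z)^2" i] by simp

lemma integral_ell_mult_le: "(\<integral>w. ell (w i) * ell (w j) \<partial>S) \<le> lbar^2"
proof -
  have i: "integrable S (\<lambda>w. (ell (w k))^2)" for k by (rule integrable_component[OF ell_square_integrable])
  have "(\<integral>w. 2 * (ell (w i) * ell (w j)) \<partial>S) \<le> (\<integral>w. (ell (w i))^2 + (ell (w j))^2 \<partial>S)"
    by (intro integral_mono integrable_mult_right integrable_ell_mult Bochner_Integration.integrable_add i)
       (use sum_squares_bound in \<open>simp add: mult.assoc[symmetric]\<close>)
  also have "\<dots> = (\<integral>w. (ell (w i))^2 \<partial>S) + (\<integral>w. (ell (w j))^2 \<partial>S)"
    by (intro Bochner_Integration.integral_add i)
  also have "\<dots> \<le> 2 * lbar^2" using integral_ell_sq_component_le[of i] integral_ell_sq_component_le[of j] by simp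
  finally show ?thesis by simp
qed

lemma le_of_mult_square_le:
  fixes d :: real
  assumes "\<nu> * d^2 \<le> b * d" "\<nu> > 0" "0 \<le> d" "0 \<le> b"
  shows "d \<le> b / \<nu>"
proof (cases "d = 0")
  case True then show ?thesis using assms by simp
next
  case False
  then have "d > 0" using assms by simp
  moreover have "(\<nu> * d) * d \<le> b * d" using assms(1) by (simp add: power2_eq_square mult.assoc)
  ultimately have "\<nu> * d \<le> b" by simp
  then show ?thesis using assms(2) by (simp add: pos_le_divide_eq mult.commute)
qed

context
  fixes lam :: real and N :: nat and x :: 'a
  assumes lam: "0 \<le> lam" and N: "N > 0"
begin

abbreviation "W \<equiv> emp_min lam N x"
abbreviation "xs \<equiv> pop_min lam x"

lemma nu_pos: "\<mu> + lam > 0"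
  using mu_pos lam by simp

lemma W_U: "\<zeta> \<in> space S \<Longrightarrow> W \<zeta> \<in> U" and xs_U: "xs \<in> U"
  using emp_min_in_C[OF _ N lam] pop_min_in_C[OF lam] C_subset_U by blast+

text \<open>The sample \<open>\<zeta> N\<close> is not used by \<open>W \<zeta>\<close> and plays the role of a ghost sample: exchanging it with
  \<open>\<zeta> i\<close> preserves the distribution and turns a fresh sample into a training sample.\<close>

lemma emp_min_stable:
  assumes \<zeta>: "\<zeta> \<in> space S" and i: "i < N"
  defines "\<zeta>' \<equiv> (\<lambda>k. \<zeta> (Transposition.transpose i N k))"
  shows "norm (W \<zeta>' - W \<zeta>) \<le> (ell (\<zeta> i) + ell (\<zeta> N)) / ((\<mu> + lam) * real N)"
proof -
  have \<zeta>': "\<zeta>' \<in> space S" using \<zeta> by (simp add: \<zeta>'_def space_S_iff)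
  define d where "d = norm (W \<zeta>' - W \<zeta>)"
  define a where "a = W \<zeta>"
  define b where "b = W \<zeta>'"
  have C: "a \<in> C" "b \<in> C" using emp_min_in_C[OF _ N lam] \<zeta> \<zeta>' by (auto simp: a_def b_def)
  then have U: "a \<in> U" "b \<in> U" using C_subset_U by auto
  have 1: "emp lam N x \<zeta> a + (\<mu> + lam) / 2 * d^2 \<le> emp lam N x \<zeta> b"
    using growth_min_emp_min[OF \<zeta> N lam, of x] C by (simp add: growth_min_def a_def b_def d_def)
  have 2: "emp lam N x \<zeta>' b + (\<mu> + lam) / 2 * d^2 \<le> emp lam N x \<zeta>' a"
    using growth_min_emp_min[OF \<zeta>' N lam, of x] C by (simp add: growth_min_def a_def b_def d_def norm_minus_commute)
  have S: "(\<Sum>k<N. g y (\<zeta> k)) - (\<Sum>k<N. g y (\<zeta>' k)) = g y (\<zeta> i) - g y (\<zeta> N)" for y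
  proof -
    have "(\<Sum>k\<in>{..<N} - {i}. g y (\<zeta> k)) = (\<Sum>k\<in>{..<N} - {i}. g y (\<zeta>' k))"
      by (intro sum.cong) (auto simp: \<zeta>'_def Transposition.transpose_def)
    then show ?thesis using i by (simp add: sum.remove[of "{..<N}" i] \<zeta>'_def)
  qed
  have D: "emp lam N x \<zeta> y - emp lam N x \<zeta>' y = 1 / real N * (g y (\<zeta> i) - g y (\<zeta> N))" for y
  proof -
    have "emp lam N x \<zeta> y - emp lam N x \<zeta>' y = 1 / real N * ((\<Sum>k<N. g y (\<zeta> k)) - (\<Sum>k<N. g y (\<zeta>' k)))"
      unfolding emp_def right_diff_distrib by linarith
    then show ?thesis unfolding S .
  qed
  have zz: "\<zeta> i \<in> space Z" "\<zeta> N \<in> space Z" using \<zeta> by (auto simp: space_S_iff)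
  have "(g b (\<zeta> i) - g b (\<zeta> N)) - (g a (\<zeta> i) - g a (\<zeta> N)) \<le> (ell (\<zeta> i) + ell (\<zeta> N)) * d"
    using g_lipschitz[OF U(2,1) zz(1)] g_lipschitz[OF U(2,1) zz(2)]
    unfolding a_def[symmetric] b_def[symmetric] d_def distrib_right by linarith
  then have 3: "1 / real N * ((g b (\<zeta> i) - g b (\<zeta> N)) - (g a (\<zeta> i) - g a (\<zeta> N))) \<le> 1 / real N * ((ell (\<zeta> i) + ell (\<zeta> N)) * d)"
    by (intro mult_left_mono) auto
  \<comment> \<open>The two growth inequalities are added: \<open>hr\<close> and the quadratic
    cancel, and only the loss differences of the exchanged samples remain, with weight
    \<open>1 / real N\<close>.\<close>
  have "(\<mu> + lam) * d^2 = (\<mu> + lam) / 2 * d^2 + (\<mu> + lam) / 2 * d^2" by simp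
  also have "\<dots> \<le> 1 / real N * ((g b (\<zeta> i) - g b (\<zeta> N)) - (g a (\<zeta> i) - g a (\<zeta> N)))"
    unfolding right_diff_distrib[of "1 / real N" "g b (\<zeta> i) - g b (\<zeta> N)"] D[symmetric] using 1 2 by linarith
  also have "\<dots> \<le> ((ell (\<zeta> i) + ell (\<zeta> N)) / real N) * d" using 3 by simp
  finally have "d \<le> ((ell (\<zeta> i) + ell (\<zeta> N)) / real N) / (\<mu> + lam)"
    using nu_pos ell_nonneg N by (intro le_of_mult_square_le) (auto simp: d_def)
  then show ?thesis by (simp add: d_def mult.commute)
qed

text \<open>A crude bound that serves integrability. Growth of the empirical and of the population
  objective is compared at each other's minimizers, and the smooth parts are controlled by Lipschitz
  continuity.\<close>

lemma emp_min_distance: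
  assumes \<zeta>: "\<zeta> \<in> space S"
  shows "norm (W \<zeta> - xs) \<le> (lbar + 1 / real N * (\<Sum>i<N. ell (\<zeta> i))) / (\<mu> + lam)"
proof -
  define d where "d = norm (W \<zeta> - xs)"
  have C: "W \<zeta> \<in> C" "xs \<in> C" using emp_min_in_C[OF \<zeta> N lam] pop_min_in_C[OF lam] by auto
  note U = W_U[OF \<zeta>] xs_U
  have 1: "emp lam N x \<zeta> (W \<zeta>) + (\<mu> + lam) / 2 * d^2 \<le> emp lam N x \<zeta> xs"
    using growth_min_emp_min[OF \<zeta> N lam, of x] C by (simp add: growth_min_def d_def norm_minus_commute)
  have 2: "pop lam x xs + (\<mu> + lam) / 2 * d^2 \<le> pop lam x (W \<zeta>)"
    using growth_min_pop_min[OF lam, of x] C by (simp add: growth_min_def d_def)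
  have 3: "gbar (W \<zeta>) - gbar xs \<le> lbar * d" using gbar_lipschitz[OF U] by (simp add: d_def)
  have "(\<Sum>i<N. g xs (\<zeta> i)) - (\<Sum>i<N. g (W \<zeta>) (\<zeta> i)) \<le> (\<Sum>i<N. ell (\<zeta> i) * d)"
    unfolding sum_subtractf[symmetric]
  proof (rule sum_mono)
    fix i
    have "\<zeta> i \<in> space Z" using \<zeta> by (simp add: space_S_iff)
    from g_lipschitz[OF U this] show "g xs (\<zeta> i) - g (W \<zeta>) (\<zeta> i) \<le> ell (\<zeta> i) * d"
      unfolding d_def by linarith
  qed
  then have "1 / real N * ((\<Sum>i<N. g xs (\<zeta> i)) - (\<Sum>i<N. g (W \<zeta>) (\<zeta> i))) \<le> 1 / real N * ((\<Sum>i<N. ell (\<zeta> i)) * d)"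
    unfolding sum_distrib_right by (intro mult_left_mono) auto
  then have 4: "1 / real N * (\<Sum>i<N. g xs (\<zeta> i)) - 1 / real N * (\<Sum>i<N. g (W \<zeta>) (\<zeta> i)) \<le> (1 / real N * (\<Sum>i<N. ell (\<zeta> i))) * d"
    unfolding right_diff_distrib by simp
  have "(\<mu> + lam) * d^2 = (\<mu> + lam) / 2 * d^2 + (\<mu> + lam) / 2 * d^2" by simp
  also have "\<dots> \<le> (lbar + 1 / real N * (\<Sum>i<N. ell (\<zeta> i))) * d"
    using 1 2 3 4 unfolding emp_def pop_def distrib_right by linarith
  finally have le: "(\<mu> + lam) * d^2 \<le> (lbar + 1 / real N * (\<Sum>i<N. ell (\<zeta> i))) * d" .
  have b0: "0 \<le> lbar + 1 / real N * (\<Sum>i<N. ell (\<zeta> i))"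
    using lbar_pos ell_nonneg by (intro add_nonneg_nonneg mult_nonneg_nonneg sum_nonneg) auto
  have "d \<le> (lbar + 1 / real N * (\<Sum>i<N. ell (\<zeta> i))) / (\<mu> + lam)"
    by (rule le_of_mult_square_le[OF le nu_pos _ b0]) (simp add: d_def)
  then show ?thesis by (simp add: d_def)
qed

lemma measurable_W [measurable]: "W \<in> borel_measurable S"
  by (rule measurable_emp_min'[OF lam N]) auto

definition "bound w = (lbar + 1 / real N * (\<Sum>i<N. ell (w i))) / (\<mu> + lam)"

lemma bound_nonneg: "0 \<le> bound w"
  unfolding bound_def using ell_nonneg lbar_pos N
  by (intro divide_nonneg_pos nu_pos add_nonneg_nonneg mult_nonneg_nonneg sum_nonneg) auto

lemma integrable_ell_bound: "integrable S (\<lambda>w. ell (w j) * bound w)"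
proof -
  have "integrable S (\<lambda>w. (lbar * ell (w j) + 1 / real N * (\<Sum>i<N. ell (w i) * ell (w j))) / (\<mu> + lam))"
    by (intro integrable_divide_zero Bochner_Integration.integrable_add integrable_mult_right
        Bochner_Integration.integrable_sum integrable_ell_mult integrable_component[OF integrable_ell] impI)
  then show ?thesis unfolding bound_def by (simp add: sum_distrib_left distrib_left mult_ac)
qed

lemma integrable_bound': "integrable S bound"
  unfolding bound_def
  by (intro integrable_divide_zero Bochner_Integration.integrable_add integrable_mult_right
        Bochner_Integration.integrable_sum integrable_component[OF integrable_ell] impI P.integrable_const)

text \<open>Excess loss over the population minimizer on sample \<open>j\<close>: a training loss
  for \<open>j < N\<close>, a test loss for \<open>j = N\<close>. Subtracting the loss at
  \<open>xs\<close> makes it dominated by \<open>ell (w j) * bound w\<close>.\<close>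

definition "Dl j w = g (W w) (w j) - g xs (w j)"

lemma integrable_Dl: "integrable S (Dl j)"
proof (rule Bochner_Integration.integrable_bound[OF integrable_ell_bound[of j]])
  show "Dl j \<in> borel_measurable S" unfolding Dl_def by measurable
  show "AE w in S. norm (Dl j w) \<le> norm (ell (w j) * bound w)"
  proof (rule AE_I2)
    fix w assume w: "w \<in> space S"
    have "norm (Dl j w) \<le> ell (w j) * norm (W w - xs)"
      unfolding Dl_def real_norm_def using w by (intro g_lipschitz W_U xs_U) (auto simp: space_S_iff)
    also have "\<dots> \<le> ell (w j) * bound w"
      unfolding bound_def using emp_min_distance[OF w] ell_nonneg by (intro mult_left_mono)
    finally show "norm (Dl j w) \<le> norm (ell (w j) * bound w)" using ell_nonneg bound_nonneg by simp
  qed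
qed

text \<open>The minimizer \<open>W w\<close> is determined by the first \<open>N\<close> samples, so
  the sample with index \<open>N\<close> can be integrated out for fixed \<open>W w\<close>.\<close>

lemma integral_Dl_fresh: "(\<integral>w. Dl N w \<partial>S) = (\<integral>w. gbar (W w) - gbar xs \<partial>S)"
proof -
  have Wc: "W (comb_seq N w w') = W w" for w w'
    using depends_on_first_emp_min by (rule depends_on_first_comb_seq)
  have inner: "(\<integral>w'. Dl N (comb_seq N w w') \<partial>S) = gbar (W w) - gbar xs" for w
  proof -
    have "(\<integral>w'. Dl N (comb_seq N w w') \<partial>S) = (\<integral>w'. g (W w) (w' 0) - g xs (w' 0) \<partial>S)"
      by (simp add: Dl_def Wc comb_seq_def)
    also have "\<dots> = (\<integral>w'. g (W w) (w' 0) \<partial>S) - (\<integral>w'. g xs (w' 0) \<partial>S)"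
      by (intro Bochner_Integration.integral_diff integrable_component g_integrable)
    also have "\<dots> = gbar (W w) - gbar xs"
      using integral_component[of "g (W w)" 0] integral_component[of "g xs" 0] g_integrable
      by (simp add: gbar_def borel_measurable_integrable)
    finally show ?thesis .
  qed
  have "(\<integral>w. Dl N w \<partial>S) = (\<integral>w. (\<integral>w'. Dl N (comb_seq N w w') \<partial>S) \<partial>S)"
    by (rule integral_comb_seq[OF integrable_Dl])
  then show ?thesis by (simp only: inner)
qed

text \<open>Exchanging samples \<open>i\<close> and \<open>N\<close> preserves the expected test
  loss but makes both losses refer to the sample \<open>w i\<close>, with minimizers that differ in
  one training sample. Stability and the Lipschitz bound leave products of two moduli, each of
  expectation at most \<open>lbar^2\<close>.\<close>

lemma integral_Dl_diff_le:
  assumes i: "i < N"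
  shows "(\<integral>w. Dl N w \<partial>S) - (\<integral>w. Dl i w \<partial>S) \<le> 2 * lbar^2 / ((\<mu> + lam) * real N)"
proof -
  define \<pi> where "\<pi> = Transposition.transpose i N"
  have inj: "inj \<pi>" unfolding \<pi>_def by simp
  have iD: "integrable S (\<lambda>w. Dl N (\<lambda>k. w (\<pi> k)))" by (rule integrable_reindex[OF integrable_Dl inj])
  have meas: "Dl N \<in> borel_measurable S" using integrable_Dl by auto
  have ip: "integrable S (\<lambda>w. (ell (w i) * ell (w i) + ell (w i) * ell (w N)) / ((\<mu> + lam) * real N))"
    by (intro integrable_divide_zero Bochner_Integration.integrable_add integrable_ell_mult impI)
  have "(\<integral>w. Dl N w \<partial>S) - (\<integral>w. Dl i w \<partial>S) = (\<integral>w. Dl N (\<lambda>k. w (\<pi> k)) - Dl i w \<partial>S)"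
    using integral_reindex[OF meas inj] Bochner_Integration.integral_diff[OF iD integrable_Dl[of i]] by simp
  also have "\<dots> \<le> (\<integral>w. (ell (w i) * ell (w i) + ell (w i) * ell (w N)) / ((\<mu> + lam) * real N) \<partial>S)"
  proof (rule integral_mono[OF Bochner_Integration.integrable_diff[OF iD integrable_Dl] ip])
    fix w assume w: "w \<in> space S"
    define w' where "w' = (\<lambda>k. w (\<pi> k))"
    have w': "w' \<in> space S" using w by (simp add: w'_def space_S_iff)
    have "Dl N w' - Dl i w = g (W w') (w i) - g (W w) (w i)"
      by (simp add: Dl_def w'_def \<pi>_def)
    also have "\<dots> \<le> ell (w i) * norm (W w' - W w)"
      using g_lipschitz[OF W_U[OF w'] W_U[OF w], of "w i"] w by (simp add: space_S_iff)
    also have "\<dots> \<le> ell (w i) * ((ell (w i) + ell (w N)) / ((\<mu> + lam) * real N))"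
      unfolding w'_def \<pi>_def using emp_min_stable[OF w i] ell_nonneg by (intro mult_left_mono)
    also have "\<dots> = (ell (w i) * ell (w i) + ell (w i) * ell (w N)) / ((\<mu> + lam) * real N)"
      by (simp add: distrib_left)
    finally show "Dl N (\<lambda>k. w (\<pi> k)) - Dl i w \<le> (ell (w i) * ell (w i) + ell (w i) * ell (w N)) / ((\<mu> + lam) * real N)"
      unfolding w'_def .
  qed
  also have "\<dots> = ((\<integral>w. ell (w i) * ell (w i) \<partial>S) + (\<integral>w. ell (w i) * ell (w N) \<partial>S)) / ((\<mu> + lam) * real N)"
    using integrable_ell_mult by simp
  also have "\<dots> \<le> (2 * lbar^2) / ((\<mu> + lam) * real N)"
    using integral_ell_mult_le[of i i] integral_ell_mult_le[of i N] nu_pos N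
    by (intro divide_right_mono) auto
  finally show ?thesis .
qed

text \<open>Since \<open>W w\<close> minimizes the empirical objective, the terms \<open>hr\<close>
  and the quadratic in the gap can be traded for the empirical excess loss; what remains is
  population minus training loss.\<close>

lemma gap_emp_min_le:
  assumes w: "w \<in> space S"
  shows "gap lam x (W w) \<le> (gbar (W w) - gbar xs) - 1 / real N * (\<Sum>i<N. Dl i w)"
proof -
  have "emp lam N x w (W w) + (\<mu> + lam) / 2 * (norm (xs - W w))^2 \<le> emp lam N x w xs"
    using growth_min_emp_min[OF w N lam, of x] pop_min_in_C[OF lam, of x] by (simp add: growth_min_def)
  moreover have "0 \<le> (\<mu> + lam) / 2 * (norm (xs - W w))^2" using nu_pos by simp
  ultimately have 1: "emp lam N x w (W w) \<le> emp lam N x w xs" by linarith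
  have 2: "1 / real N * (\<Sum>i<N. Dl i w) = 1 / real N * (\<Sum>i<N. g (W w) (w i)) - 1 / real N * (\<Sum>i<N. g xs (w i))"
    unfolding Dl_def sum_subtractf right_diff_distrib ..
  show ?thesis using 1 unfolding 2 gap_def pop_def emp_def by linarith
qed

lemma integrable_gbar_gap: "integrable S (\<lambda>w. gbar (W w) - gbar xs)"
proof (rule Bochner_Integration.integrable_bound[OF integrable_mult_right[OF integrable_bound', of lbar]])
  show "AE w in S. norm (gbar (W w) - gbar xs) \<le> norm (lbar * bound w)"
  proof (rule AE_I2)
    fix w assume w: "w \<in> space S"
    have "\<bar>gbar (W w) - gbar xs\<bar> \<le> lbar * norm (W w - xs)" by (rule gbar_lipschitz[OF W_U[OF w] xs_U])
    also have "\<dots> \<le> lbar * bound w" unfolding bound_def using emp_min_distance[OF w] lbar_pos by (intro mult_left_mono) auto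
    finally show "norm (gbar (W w) - gbar xs) \<le> norm (lbar * bound w)" using lbar_pos bound_nonneg by simp
  qed
qed measurable

lemma integrable_upper: "integrable S (\<lambda>w. (gbar (W w) - gbar xs) - 1 / real N * (\<Sum>i<N. Dl i w))"
  by (intro Bochner_Integration.integrable_diff integrable_gbar_gap integrable_mult_right Bochner_Integration.integrable_sum integrable_Dl)

lemma integrable_gap: "integrable S (\<lambda>w. gap lam x (W w))"
proof (rule Bochner_Integration.integrable_bound[OF integrable_upper])
  show "(\<lambda>w. gap lam x (W w)) \<in> borel_measurable S" using lam by measurable
  show "AE w in S. norm (gap lam x (W w)) \<le> norm ((gbar (W w) - gbar xs) - 1 / real N * (\<Sum>i<N. Dl i w))"
  proof (rule AE_I2)
    fix w assume w: "w \<in> space S"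
    show "norm (gap lam x (W w)) \<le> norm ((gbar (W w) - gbar xs) - 1 / real N * (\<Sum>i<N. Dl i w))"
      using gap_emp_min_le[OF w] gap_nonneg[OF lam emp_min_in_C[OF w N lam, of x], of x] unfolding real_norm_def by linarith
  qed
qed

text \<open>Every training index contributes the same stability bound to the average difference
  between test and training loss, so no uniform convergence over \<open>C\<close> and no dependence
  on the dimension enters.\<close>

lemma expected_gap_le: "(\<integral>w. gap lam x (W w) \<partial>S) \<le> 2 * lbar^2 / ((\<mu> + lam) * real N)"
proof -
  define c where "c = 2 * lbar^2 / ((\<mu> + lam) * real N)"
  have "(\<integral>w. gap lam x (W w) \<partial>S) \<le> (\<integral>w. (gbar (W w) - gbar xs) - 1 / real N * (\<Sum>i<N. Dl i w) \<partial>S)"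
    by (rule integral_mono[OF integrable_gap integrable_upper gap_emp_min_le])
  also have "\<dots> = (\<integral>w. gbar (W w) - gbar xs \<partial>S) - (\<integral>w. 1 / real N * (\<Sum>i<N. Dl i w) \<partial>S)"
    by (intro Bochner_Integration.integral_diff integrable_gbar_gap integrable_mult_right Bochner_Integration.integrable_sum integrable_Dl)
  also have "(\<integral>w. 1 / real N * (\<Sum>i<N. Dl i w) \<partial>S) = 1 / real N * (\<Sum>i<N. \<integral>w. Dl i w \<partial>S)"
    by (subst integral_mult_right_zero, subst Bochner_Integration.integral_sum) (auto simp: integrable_Dl)
  also have "(\<integral>w. gbar (W w) - gbar xs \<partial>S) - 1 / real N * (\<Sum>i<N. \<integral>w. Dl i w \<partial>S)
      = 1 / real N * (\<Sum>i<N. (\<integral>w. Dl N w \<partial>S) - (\<integral>w. Dl i w \<partial>S))"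
    unfolding integral_Dl_fresh[symmetric] using N by (simp add: sum_subtractf right_diff_distrib diff_divide_distrib)
  also have "\<dots> \<le> 1 / real N * (\<Sum>i<N. c)"
    unfolding c_def using integral_Dl_diff_le by (intro mult_left_mono sum_mono) auto
  also have "\<dots> = c" using N by simp
  finally show ?thesis unfolding c_def .
qed

lemma prob_gap_le: "measure S {w \<in> space S. gap lam x (W w) \<le> 6 * lbar^2 / ((\<mu> + lam) * real N)} \<ge> 2 / 3"
proof -
  have "measure S {w \<in> space S. gap lam x (W w) \<le> 3 * (2 * lbar^2 / ((\<mu> + lam) * real N))} \<ge> 2 / 3"
    using nu_pos N lbar_pos gap_nonneg[OF lam emp_min_in_C[OF _ N lam, of _ x]]
    by (intro prob_Markov integrable_gap expected_gap_le) auto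
  then show ?thesis by simp
qed

end

end

section \<open>Stochastic gradients\<close>

lemma GDERIV_line_limit:
  assumes D: "GDERIV f x :> D" and t: "t \<longlonglongrightarrow> 0" "\<And>n. t n \<noteq> (0::real)"
  shows "(\<lambda>n. (f (x + t n *\<^sub>R v) - f x) / t n) \<longlonglongrightarrow> v \<bullet> D"
proof -
  have f: "(f has_derivative (\<lambda>h. h \<bullet> D)) (at (x + 0 *\<^sub>R v))"
    using D by (simp add: gderiv_def)
  have l: "((\<lambda>s::real. x + s *\<^sub>R v) has_derivative (\<lambda>s. s *\<^sub>R v)) (at 0)"
    by (auto intro!: derivative_eq_intros)
  have "((\<lambda>s. f (x + s *\<^sub>R v)) has_derivative (\<lambda>s. (s *\<^sub>R v) \<bullet> D)) (at 0)"
    by (rule has_derivative_compose[OF l f])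
  moreover have "(\<lambda>s. (s *\<^sub>R v) \<bullet> D) = (*) (v \<bullet> D)" by (simp add: fun_eq_iff)
  ultimately have "((\<lambda>s. f (x + s *\<^sub>R v)) has_real_derivative (v \<bullet> D)) (at 0)"
    by (simp only: has_field_derivative_def)
  then have lim: "((\<lambda>s. (f (x + s *\<^sub>R v) - f x) / s) \<longlongrightarrow> v \<bullet> D) (at 0)"
    by (simp add: DERIV_def)
  have "filterlim t (at 0) sequentially"
    unfolding filterlim_at using t by auto
  from filterlim_compose[OF lim this] show ?thesis .
qed

lemma harmonic_null: "(\<lambda>n. r * (1 / real (Suc n))) \<longlonglongrightarrow> 0"
proof -
  have "(\<lambda>n. r * (1 / real (Suc n))) \<longlonglongrightarrow> r * 0"
    by (intro tendsto_mult_left LIMSEQ_Suc[OF lim_1_over_n])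
  then show ?thesis by simp
qed

lemma GDERIV_unique:
  assumes "GDERIV f x :> D" "GDERIV f x :> D'" shows "D = D'"
proof -
  have "(D - D') \<bullet> D = (D - D') \<bullet> D'"
    by (rule LIMSEQ_unique[OF GDERIV_line_limit[OF assms(1) harmonic_null[of 1]] GDERIV_line_limit[OF assms(2) harmonic_null[of 1]]]) auto
  then have "(D - D') \<bullet> (D - D') = 0" by (simp add: inner_diff_right)
  then show ?thesis by simp
qed

lemma grad_eqI: "GDERIV f x :> D \<Longrightarrow> grad f x = D"
  unfolding grad_def using GDERIV_unique by blast

lemma line_steps_in_open:
  fixes v :: "'a::real_normed_vector"
  assumes U: "open U" "x \<in> U" and v: "v \<noteq> 0"
  obtains t where "t \<longlonglongrightarrow> 0" "\<And>n. t n > 0" "\<And>n. x + t n *\<^sub>R v \<in> U"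
proof -
  obtain r where r: "r > 0" "ball x r \<subseteq> U" using U openE by blast
  define t where "t = (\<lambda>n. r / norm v / 2 * (1 / real (Suc n)))"
  show thesis
  proof
    show "t \<longlonglongrightarrow> 0" unfolding t_def by (rule harmonic_null)
    show "t n > 0" for n using r v by (simp add: t_def)
    fix n
    have "norm (t n *\<^sub>R v) = r / 2 * (1 / real (Suc n))" using v r by (simp add: t_def)
    also have "\<dots> \<le> r / 2 * 1" using r by (intro mult_left_mono) auto
    also have "\<dots> < r" using r by simp
    finally show "x + t n *\<^sub>R v \<in> U" by (intro subsetD[OF r(2)]) (simp add: dist_norm)
  qed
qed

text \<open>Difference quotients in the direction \<open>D\<close> itself tend to
  \<open>D \<bullet> D\<close> and stay below \<open>B * norm D\<close>.\<close>

lemma norm_gradient_le: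
  assumes D: "GDERIV f x :> D" and U: "open U" "x \<in> U"
    and lip: "\<And>y. y \<in> U \<Longrightarrow> \<bar>f y - f x\<bar> \<le> B * norm (y - x)"
    and B: "0 \<le> B"
  shows "norm D \<le> B"
proof (cases "D = 0")
  case True then show ?thesis using B by simp
next
  case False
  obtain t where t: "t \<longlonglongrightarrow> 0" and tpos: "\<And>n. t n > 0" and inU: "\<And>n. x + t n *\<^sub>R D \<in> U"
    using line_steps_in_open[OF U False] by metis
  have lim: "(\<lambda>n. (f (x + t n *\<^sub>R D) - f x) / t n) \<longlonglongrightarrow> D \<bullet> D"
    using tpos by (intro GDERIV_line_limit[OF D t]) (simp add: less_imp_neq[symmetric])
  have "(f (x + t n *\<^sub>R D) - f x) / t n \<le> B * norm D" for n
  proof -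
    from lip[OF inU[of n]] have "f (x + t n *\<^sub>R D) - f x \<le> (B * norm D) * t n" using tpos[of n] by (simp add: mult_ac)
    then show ?thesis using tpos[of n] by (simp add: pos_divide_le_eq)
  qed
  then have "D \<bullet> D \<le> B * norm D" by (intro LIMSEQ_le_const2[OF lim]) auto
  then have "norm D * norm D \<le> B * norm D" by (simp add: power2_norm_eq_inner[symmetric] power2_eq_square)
  then show ?thesis using False by simp
qed

text \<open>The small increments that violate the error bound form an open set by continuity of
  \<open>f\<close>, so if there were any, one would lie in \<open>Q\<close>. For countable
  \<open>Q\<close> differentiability thus becomes a countable condition.\<close>

lemma has_derivative_if_dense:
  fixes f :: "'a::euclidean_space \<Rightarrow> real"
  assumes U: "open U" "x \<in> U" and f: "continuous_on U f"
    and Q: "\<And>X. open X \<Longrightarrow> X \<noteq> {} \<Longrightarrow> \<exists>d\<in>Q. d \<in> X"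
    and le: "\<And>k. \<exists>n. \<forall>y\<in>Q. norm y < 1 / real (Suc n) \<longrightarrow>
               \<bar>f (x + y) - f x - y \<bullet> c\<bar> \<le> norm y / real (Suc k)"
  shows "GDERIV f x :> c"
  unfolding gderiv_def has_derivative_at_alt
proof (intro conjI allI impI)
  show "bounded_linear (\<lambda>h. h \<bullet> c)" by (rule bounded_linear_inner_left)
  fix e :: real assume e: "e > 0"
  obtain k where k: "1 / real (Suc k) < e" using e nat_approx_posE by blast
  obtain n where n: "\<forall>y\<in>Q. norm y < 1 / real (Suc n) \<longrightarrow> \<bar>f (x + y) - f x - y \<bullet> c\<bar> \<le> norm y / real (Suc k)"
    using le by blast
  obtain r where r: "r > 0" "ball x r \<subseteq> U" using U openE by blast
  define d where "d = min r (1 / real (Suc n))"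
  have d: "d > 0" using r by (simp add: d_def)
  define q where "q = (\<lambda>y. \<bar>f (x + y) - f x - y \<bullet> c\<bar> - norm y / real (Suc k))"
  have "(+) x ` ball 0 d \<subseteq> U" using r by (auto simp: d_def dist_norm)
  then have "continuous_on (ball 0 d) (\<lambda>y. f (x + y))"
    by (intro continuous_on_compose2[OF f] continuous_intros) auto
  then have cq: "continuous_on (ball 0 d) q"
    unfolding q_def by (intro continuous_intros) auto
  define X where "X = ball 0 d \<inter> q -` {0<..}"
  have "open X" unfolding X_def by (rule continuous_open_preimage[OF cq]) auto
  have "X = {}"
  proof (rule ccontr)
    assume "X \<noteq> {}"
    then obtain y where "y \<in> Q" "y \<in> X" using Q[OF \<open>open X\<close>] by blast
    then show False using n by (auto simp: X_def q_def d_def)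
  qed
  show "\<exists>d>0. \<forall>y. norm (y - x) < d \<longrightarrow> norm (f y - f x - (y - x) \<bullet> c) \<le> e * norm (y - x)"
  proof (intro exI conjI allI impI)
    fix y assume y: "norm (y - x) < d"
    then have "y - x \<notin> X" "y - x \<in> ball 0 d" using \<open>X = {}\<close> by auto
    then have "\<bar>f (x + (y - x)) - f x - (y - x) \<bullet> c\<bar> \<le> norm (y - x) / real (Suc k)"
      by (simp add: X_def q_def)
    also have "\<dots> = 1 / real (Suc k) * norm (y - x)" by simp
    also have "\<dots> \<le> e * norm (y - x)" using k by (intro mult_right_mono) auto
    finally show "norm (f y - f x - (y - x) \<bullet> c) \<le> e * norm (y - x)" by simp
  qed (rule d)
qed

section \<open>Measurability and moments of the stochastic gradient\<close>

locale composite_grad = composite Z g h ell U \<mu> L lbar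
  for Z :: "'z measure" and g :: "'a::euclidean_space \<Rightarrow> 'z \<Rightarrow> real" and h ell U \<mu> L lbar +
  assumes g_gradient_exists: "\<And>x. x \<in> effdom h \<Longrightarrow> AE z in Z. \<exists>D. GDERIV (\<lambda>y. g y z) x :> D"
begin

text \<open>The gradient without the regularization term, cut off outside \<open>U\<close>, where
  \<open>g\<close> is not known to be continuous in its first argument.\<close>

definition "G x z = (if x \<in> U then grad (\<lambda>y. g y z) x else 0)"

definition "gradbar = (SOME D. (\<forall>x. GDERIV gbar x :> D x) \<and> L-lipschitz_on UNIV D)"

lemma gradbar: "GDERIV gbar x :> gradbar x" "L-lipschitz_on UNIV gradbar"
  using someI_ex[OF gbar_gderiv] unfolding gradbar_def by blast+

lemma continuous_on_g: "z \<in> space Z \<Longrightarrow> continuous_on U (\<lambda>y. g y z)"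
  by (intro uniformly_continuous_imp_continuous uniformly_continuous_on_Lipschitz_bound[where B = "ell z"] g_lipschitz ell_nonneg)

text \<open>The vector of partial derivatives as limits of difference quotients, measurable whether
  or not the gradient exists. The factor 1 makes the step sizes an instance of
  \<open>harmonic_null\<close>.\<close>

definition "cand x z = (\<Sum>b\<in>Basis. Lim sequentially (\<lambda>n. (g (x + (1 * (1 / real (Suc n))) *\<^sub>R b) z - g x z) / (1 * (1 / real (Suc n)))) *\<^sub>R b)"

lemma cand_eqI:
  assumes D: "GDERIV (\<lambda>y. g y z) x :> D" shows "cand x z = D"
proof -
  have "Lim sequentially (\<lambda>n. (g (x + (1 * (1 / real (Suc n))) *\<^sub>R b) z - g x z) / (1 * (1 / real (Suc n)))) = b \<bullet> D" for b
    by (rule limI[OF GDERIV_line_limit[OF D harmonic_null]]) simp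
  then have "cand x z = (\<Sum>b\<in>Basis. (b \<bullet> D) *\<^sub>R b)" unfolding cand_def by (simp only:)
  also have "\<dots> = (\<Sum>b\<in>Basis. (D \<bullet> b) *\<^sub>R b)" by (intro sum.cong refl arg_cong2[where f = scaleR] inner_commute)
  also have "\<dots> = D" by (rule euclidean_representation)
  finally show ?thesis .
qed

lemma measurable_cand: "(\<lambda>p. cand (fst p) (snd p)) \<in> borel_measurable (borel \<Otimes>\<^sub>M Z)"
  unfolding cand_def by measurable

text \<open>As \<open>g\<close> is continuous in its first argument on \<open>U\<close>, differentiability only has to be tested on
  increments from a countable dense set. Where it fails, \<open>grad\<close> has the fixed value
  \<open>THE D. False\<close>.\<close>

lemma measurable_G: "(\<lambda>p. G (fst p) (snd p)) \<in> borel_measurable (borel \<Otimes>\<^sub>M Z)"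
proof -
  obtain Q :: "'a set" where Q: "countable Q" "\<And>X. open X \<Longrightarrow> X \<noteq> {} \<Longrightarrow> \<exists>d\<in>Q. d \<in> X"
    using countable_dense_setE by metis
  have "Q \<noteq> {}" using Q(2)[of UNIV] by auto
  then obtain e :: "nat \<Rightarrow> 'a" where Qe: "Q = range e" using Q(1) uncountable_def by metis
  define P where "P = (\<lambda>p. \<forall>k::nat. \<exists>n::nat. \<forall>y\<in>Q. norm y < 1 / real (Suc n) \<longrightarrow>
     \<bar>g (fst p + y) (snd p) - g (fst p) (snd p) - y \<bullet> cand (fst p) (snd p)\<bar> \<le> norm y / real (Suc k))"
  note [measurable] = measurable_cand
  define R where "R = (\<lambda>k n y p. norm y < 1 / real (Suc n) \<longrightarrow>
     \<bar>g (fst p + y) (snd p) - g (fst p) (snd p) - y \<bullet> cand (fst p) (snd p)\<bar> \<le> norm y / real (Suc k))"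
  have R: "Measurable.pred (borel \<Otimes>\<^sub>M Z) (R k n y)" for y k n
    unfolding R_def by measurable
  have "P = (\<lambda>p. \<forall>k::nat. \<exists>n::nat. \<forall>i::nat. R k n (e i) p)"
    unfolding P_def R_def Qe by auto
  then have [measurable]: "Measurable.pred (borel \<Otimes>\<^sub>M Z) P"
    using R by (simp only:) (intro pred_intros_countable, blast)
  have U [measurable]: "U \<in> sets borel" using U_nbhd by simp
  have PD: "P (x, z) \<longleftrightarrow> (\<exists>D. GDERIV (\<lambda>y. g y z) x :> D)" if "x \<in> U" "z \<in> space Z" for x z
  proof
    assume "P (x, z)"
    then have "GDERIV (\<lambda>y. g y z) x :> cand x z"
      unfolding P_def using that by (intro has_derivative_if_dense[OF U_nbhd(1) _ continuous_on_g Q(2)]) auto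
    then show "\<exists>D. GDERIV (\<lambda>y. g y z) x :> D" by blast
  next
    assume "\<exists>D. GDERIV (\<lambda>y. g y z) x :> D"
    then have D: "GDERIV (\<lambda>y. g y z) x :> cand x z" using cand_eqI by blast
    show "P (x, z)"
      unfolding P_def fst_conv snd_conv
    proof
      fix k :: nat
      obtain d where d: "d > 0" "\<And>y. norm (y - x) < d \<Longrightarrow>
          norm (g y z - g x z - (y - x) \<bullet> cand x z) \<le> 1 / real (Suc k) * norm (y - x)"
        using D unfolding gderiv_def has_derivative_at_alt by (metis of_nat_0_less_iff zero_less_Suc zero_less_divide_1_iff)
      obtain n where n: "1 / real (Suc n) < d" using d(1) nat_approx_posE by blast
      show "\<exists>n. \<forall>y\<in>Q. norm y < 1 / real (Suc n) \<longrightarrow> \<bar>g (x + y) z - g x z - y \<bullet> cand x z\<bar> \<le> norm y / real (Suc k)"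
      proof (intro exI ballI impI)
        fix y :: 'a assume "norm y < 1 / real (Suc n)"
        then show "\<bar>g (x + y) z - g x z - y \<bullet> cand x z\<bar> \<le> norm y / real (Suc k)"
          using d(2)[of "x + y"] n by simp
      qed
    qed
  qed
  have "G x z = (if x \<in> U then if P (x, z) then cand x z else (THE D. False) else 0)" if "z \<in> space Z" for x z
  proof (cases "x \<in> U \<and> \<not> P (x, z)")
    case True
    then have "\<not> (\<exists>D. GDERIV (\<lambda>y. g y z) x :> D)" using PD that by blast
    then show ?thesis using True by (simp add: G_def grad_def)
  next
    case False
    show ?thesis
    proof (cases "x \<in> U")
      case True
      with False PD[OF True that] obtain D where D: "GDERIV (\<lambda>y. g y z) x :> D" by auto
      show ?thesis using True False grad_eqI[OF D] cand_eqI[OF D] by (simp add: G_def)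
    qed (simp add: G_def)
  qed
  then have "(\<lambda>p. G (fst p) (snd p)) \<in> borel_measurable (borel \<Otimes>\<^sub>M Z) \<longleftrightarrow>
      (\<lambda>p. if fst p \<in> U then if P p then cand (fst p) (snd p) else (THE D. False) else 0) \<in> borel_measurable (borel \<Otimes>\<^sub>M Z)"
    by (intro measurable_cong) (auto simp: space_pair_measure)
  also have "\<dots>" by measurable
  finally show ?thesis .
qed

lemma measurable_G' [measurable (raw)]:
  assumes "X \<in> borel_measurable N" "Y \<in> measurable N Z"
  shows "(\<lambda>w. G (X w) (Y w)) \<in> borel_measurable N"
  using measurable_compose[OF measurable_Pair[OF assms] measurable_G] by simp

context
  fixes x :: 'a assumes x: "x \<in> C"
begin

lemma x_U: "x \<in> U" using x C_subset_U by blast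

lemma AE_G: "AE z in Z. GDERIV (\<lambda>y. g y z) x :> G x z \<and> norm (G x z) \<le> ell z"
proof -
  have "AE z in Z. \<exists>D. GDERIV (\<lambda>y. g y z) x :> D" using x by (intro g_gradient_exists) (simp add: C_def)
  with AE_space show ?thesis
  proof eventually_elim
    case (elim z)
    then obtain D where D: "GDERIV (\<lambda>y. g y z) x :> D" by blast
    then have "G x z = D" using x_U grad_eqI by (auto simp: G_def)
    moreover have "norm D \<le> ell z"
      using elim(1) x_U by (intro norm_gradient_le[OF D U_nbhd(1)] g_lipschitz ell_nonneg)
    ultimately show ?case using D by simp
  qed
qed

lemma measurable_Gx [measurable]: "G x \<in> borel_measurable Z"
  by (rule measurable_G') auto

lemma integrable_G: "integrable Z (G x)"
  by (rule Bochner_Integration.integrable_bound[OF integrable_ell]) (use AE_G ell_nonneg in auto)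

text \<open>Differentiation under the integral sign, tested in each direction \<open>v\<close>: the
  difference quotients are dominated by \<open>ell z * norm v\<close>, and openness of
  \<open>U\<close> keeps the points \<open>x + t n *\<^sub>R v\<close> where that bound
  holds.\<close>

lemma integral_G: "(\<integral>z. G x z \<partial>Z) = gradbar x"
proof -
  have eq: "v \<bullet> (\<integral>z. G x z \<partial>Z) = v \<bullet> gradbar x" for v
  proof (cases "v = 0")
    case False
    obtain t where t0: "t \<longlonglongrightarrow> 0" and tpos: "\<And>n. t n > 0" and inU: "\<And>n. x + t n *\<^sub>R v \<in> U"
      using line_steps_in_open[OF U_nbhd(1) x_U False] by metis
    from tpos have tne: "t n \<noteq> 0" for n by (metis less_irrefl)
    have "(\<lambda>n. \<integral>z. (g (x + t n *\<^sub>R v) z - g x z) / t n \<partial>Z) \<longlonglongrightarrow> (\<integral>z. v \<bullet> G x z \<partial>Z)"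
    proof (rule integral_dominated_convergence[where w = "\<lambda>z. ell z * norm v"])
      show "integrable Z (\<lambda>z. ell z * norm v)" using integrable_ell by simp
      show "AE z in Z. (\<lambda>n. (g (x + t n *\<^sub>R v) z - g x z) / t n) \<longlonglongrightarrow> v \<bullet> G x z"
        using AE_G by eventually_elim (intro GDERIV_line_limit t0 tne, blast)
      fix n
      show "AE z in Z. norm ((g (x + t n *\<^sub>R v) z - g x z) / t n) \<le> ell z * norm v"
      proof (rule AE_I2)
        fix z assume "z \<in> space Z"
        from g_lipschitz[OF inU x_U this, of n]
        have "\<bar>g (x + t n *\<^sub>R v) z - g x z\<bar> \<le> (ell z * norm v) * t n" using tpos[of n] by (simp add: mult_ac)
        then show "norm ((g (x + t n *\<^sub>R v) z - g x z) / t n) \<le> ell z * norm v"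
          using tpos[of n] by (simp add: pos_divide_le_eq)
      qed
    qed (use g_integrable in \<open>auto intro!: borel_measurable_divide borel_measurable_diff borel_measurable_integrable\<close>)
    moreover have "(\<integral>z. (g (x + t n *\<^sub>R v) z - g x z) / t n \<partial>Z) = (gbar (x + t n *\<^sub>R v) - gbar x) / t n" for n
      using g_integrable by (simp add: gbar_def)
    moreover have "(\<integral>z. v \<bullet> G x z \<partial>Z) = v \<bullet> (\<integral>z. G x z \<partial>Z)" using integrable_G by simp
    ultimately have "(\<lambda>n. (gbar (x + t n *\<^sub>R v) - gbar x) / t n) \<longlonglongrightarrow> v \<bullet> (\<integral>z. G x z \<partial>Z)"
      by (simp only:)
    then show ?thesis using GDERIV_line_limit[OF gradbar(1) t0 tne] LIMSEQ_unique by blast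
  qed simp
  have "((\<integral>z. G x z \<partial>Z) - gradbar x) \<bullet> ((\<integral>z. G x z \<partial>Z) - gradbar x) = 0"
    using eq by (simp add: inner_diff_right)
  then show ?thesis by simp
qed

lemma integrable_G_sq: "integrable Z (\<lambda>z. (norm (G x z))^2)"
proof (rule Bochner_Integration.integrable_bound[OF ell_square_integrable])
  show "AE z in Z. norm ((norm (G x z))^2) \<le> norm ((ell z)^2)"
    using AE_G by eventually_elim (simp add: power_mono)
qed simp

text \<open>Centering at the mean can only lower the second moment, and \<open>norm (G x z)\<close>
  is at most \<open>ell z\<close> almost surely. The algorithm allows for the variance
  \<open>4 * lbar^2\<close>, four times as much.\<close>

lemma deviation_G:
  "integrable Z (\<lambda>z. (norm (G x z - gradbar x))^2)" "(\<integral>z. (norm (G x z - gradbar x))^2 \<partial>Z) \<le> lbar^2"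
proof -
  have ex: "(norm (G x z - gradbar x))^2 = (norm (G x z))^2 - 2 * (G x z \<bullet> gradbar x) + (norm (gradbar x))^2" for z
    by (simp add: power2_norm_eq_inner inner_diff_left inner_diff_right inner_commute)
  have i1: "integrable Z (\<lambda>z. 2 * (G x z \<bullet> gradbar x))" using integrable_G by simp
  have i2: "integrable Z (\<lambda>z. (norm (G x z))^2 - 2 * (G x z \<bullet> gradbar x))"
    by (rule Bochner_Integration.integrable_diff[OF integrable_G_sq i1])
  show "integrable Z (\<lambda>z. (norm (G x z - gradbar x))^2)"
    unfolding ex using i2 by simp
  have "(\<integral>z. (norm (G x z - gradbar x))^2 \<partial>Z) = (\<integral>z. (norm (G x z))^2 - 2 * (G x z \<bullet> gradbar x) \<partial>Z) + (norm (gradbar x))^2"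
    unfolding ex using i2 by (simp add: M.prob_space)
  also have "(\<integral>z. (norm (G x z))^2 - 2 * (G x z \<bullet> gradbar x) \<partial>Z) = (\<integral>z. (norm (G x z))^2 \<partial>Z) - (\<integral>z. 2 * (G x z \<bullet> gradbar x) \<partial>Z)"
    by (rule Bochner_Integration.integral_diff[OF integrable_G_sq i1])
  also have "(\<integral>z. 2 * (G x z \<bullet> gradbar x) \<partial>Z) = 2 * (norm (gradbar x))^2"
    using integrable_G by (simp add: integral_G power2_norm_eq_inner)
  also have "(\<integral>z. (norm (G x z))^2 \<partial>Z) \<le> (\<integral>z. (ell z)^2 \<partial>Z)"
  proof (rule integral_mono_AE[OF integrable_G_sq ell_square_integrable])
    show "AE z in Z. (norm (G x z))^2 \<le> (ell z)^2"
      using AE_G by eventually_elim (simp add: power_mono)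
  qed
  finally have "(\<integral>z. (norm (G x z - gradbar x))^2 \<partial>Z) \<le> (\<integral>z. (ell z)^2 \<partial>Z) - (norm (gradbar x))^2" by simp
  then show "(\<integral>z. (norm (G x z - gradbar x))^2 \<partial>Z) \<le> lbar^2"
    using ell_bound zero_le_power2[of "norm (gradbar x)"] by linarith
qed

lemma prob_avg_gradient:
  assumes n: "n > 0"
  shows "measure S {w \<in> space S. norm ((1 / real n) *\<^sub>R (\<Sum>i<n. G x (w i)) - gradbar x) \<le> sqrt (3 * (lbar^2 / real n))} \<ge> 2 / 3"
proof -
  define \<xi> where "\<xi> = (\<lambda>z. G x z - gradbar x)"
  have [measurable]: "\<xi> \<in> borel_measurable Z" unfolding \<xi>_def by measurable
  have sm: "integrable S (\<lambda>w. (norm (\<Sum>i<n. \<xi> (w i)))^2) \<and>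
         (\<integral>w. (norm (\<Sum>i<n. \<xi> (w i)))^2 \<partial>S) = real n * (\<integral>z. (norm (\<xi> z))^2 \<partial>Z)"
    using deviation_G(1) integrable_G
    by (intro second_moment_sum) (auto simp: \<xi>_def integral_G M.prob_space)
  have eq: "(1 / real n) *\<^sub>R (\<Sum>i<n. G x (w i)) - gradbar x = (1 / real n) *\<^sub>R (\<Sum>i<n. \<xi> (w i))" for w
    using n by (simp add: \<xi>_def sum_subtractf scaleR_diff_right sum_constant_scaleR)
  have sq: "(norm ((1 / real n) *\<^sub>R v))^2 = 1 / (real n)^2 * (norm v)^2" for v :: 'a
    by (simp add: power_mult_distrib power_divide)
  have "measure S {w \<in> space S. (norm ((1 / real n) *\<^sub>R (\<Sum>i<n. \<xi> (w i))))^2 \<le> 3 * (lbar^2 / real n)} \<ge> 2 / 3"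
  proof (rule prob_Markov)
    show "integrable S (\<lambda>w. (norm ((1 / real n) *\<^sub>R (\<Sum>i<n. \<xi> (w i))))^2)"
      unfolding sq using sm by (intro integrable_mult_right) blast
    have "(\<integral>w. (norm ((1 / real n) *\<^sub>R (\<Sum>i<n. \<xi> (w i))))^2 \<partial>S) = 1 / (real n)^2 * (real n * (\<integral>z. (norm (\<xi> z))^2 \<partial>Z))"
      unfolding sq using sm by simp
    also have "\<dots> = (\<integral>z. (norm (\<xi> z))^2 \<partial>Z) / real n" by (simp add: power2_eq_square)
    also have "\<dots> \<le> lbar^2 / real n" using deviation_G(2) by (intro divide_right_mono) (auto simp: \<xi>_def)
    finally show "(\<integral>w. (norm ((1 / real n) *\<^sub>R (\<Sum>i<n. \<xi> (w i))))^2 \<partial>S) \<le> lbar^2 / real n" .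
    show "lbar^2 / real n > 0" using n lbar_pos by simp
  qed simp
  moreover have "(norm v)^2 \<le> 3 * (lbar^2 / real n) \<longleftrightarrow> norm v \<le> sqrt (3 * (lbar^2 / real n))" for v :: 'a
    by (metis norm_ge_zero real_sqrt_le_iff real_sqrt_abs abs_norm_cancel)
  ultimately show ?thesis by (simp only: eq)
qed

end

end

section \<open>Runs of the algorithm\<close>

lemma run_draw: "run_state (draw w n) s = (map w [s..<s + n], s + n)"
  by (simp add: draw_def)

lemma run_choose_from: "run_state (choose_from pick w I) s = (pick (map w [0..<s]) I, s)"
  by (simp add: choose_from_def)

lemma run_traverse_list_const:
  assumes "\<And>s. run_state A s = (a s, s + n)"
  shows "run_state (traverse_list (\<lambda>_. A) xs) s = (map (\<lambda>k. a (s + k * n)) [0..<length xs], s + length xs * n)"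
proof (induction xs arbitrary: s)
  case (Cons x xs)
  have "map (\<lambda>k. a (s + k * n)) [0..<Suc (length xs)] = a s # map (\<lambda>k. a (s + n + k * n)) [0..<length xs]"
    by (simp only: upt_conv_Cons[OF zero_less_Suc] map_Suc_upt[symmetric] list.map map_map) (simp add: comp_def add.assoc)
  then show ?case by (simp add: assms Cons.IH add.assoc del: upt_Suc)
qed simp

lemma run_repeat_calls:
  assumes "\<And>s. run_state A s = (a s, s + n)"
  shows "run_state (repeat_calls m A) s = (map (\<lambda>k. a (s + k * n)) [0..<m], s + m * n)"
  unfolding repeat_calls_def using run_traverse_list_const[OF assms, of "[0..<m]" s] by simp

lemma run_ERM:
  "run_state (ERM g h w n lam x) s =
     (ARG_MIN (empirical_objective g h (map w [s..<s + nat \<lceil>n\<rceil>]) lam x) y. True, s + nat \<lceil>n\<rceil>)"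
  by (simp add: ERM_def run_draw)

text \<open>Results of the calls as a function of the stream and a starting position: the state
  monad disappears, and call \<open>k\<close> reads its own block of \<open>N\<close>
  samples.\<close>

definition "ERM_calls g h w N lam x s m =
  map (\<lambda>k. ARG_MIN (empirical_objective g h (map w [s + k * N..<s + k * N + N]) lam x) y. True) [0..<m]"

lemma run_repeat_ERM:
  "run_state (repeat_calls m (ERM g h w n lam x)) s =
     (ERM_calls g h w (nat \<lceil>n\<rceil>) lam x s m, s + m * nat \<lceil>n\<rceil>)"
  unfolding ERM_calls_def by (rule run_repeat_calls) (rule run_ERM)

lemma length_ERM_calls [simp]: "length (ERM_calls g h w N lam x s m) = m"
  by (simp add: ERM_calls_def)

lemma run_ERM_R:
  "run_state (ERM_R g h pick w n m lam x) s =
     (let ys = ERM_calls g h w (nat \<lceil>n\<rceil>) lam x s m; s' = s + m * nat \<lceil>n\<rceil>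
      in (ys ! pick (map w [0..<s']) (central_indices ys), s'))"
  by (simp add: ERM_R_def run_repeat_ERM run_choose_from Let_def)

definition "gradient_calls g w n lam xT xhat s m =
  map (\<lambda>k. (1 / real n) *\<^sub>R (\<Sum>z\<leftarrow>map w [s + k * n..<s + k * n + n]. grad (\<lambda>x. g x z) xhat + lam *\<^sub>R (xhat - xT))) [0..<m]"

lemma length_gradient_calls [simp]: "length (gradient_calls g w n lam xT xhat s m) = m"
  by (simp add: gradient_calls_def)

lemma run_repeat_gradient:
  "run_state (repeat_calls m (averaged_gradient g w n lam xT xhat)) s =
     (gradient_calls g w n lam xT xhat s m, s + m * n)"
  unfolding gradient_calls_def
  by (rule run_repeat_calls) (simp add: averaged_gradient_def run_draw comp_def)

lemma run_robust_gap_step: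
  "run_state (robust_gap_step g h pick w \<mu> L lbar \<delta> m lamT xT) s =
    (let N = nat \<lceil>gap_ERM_size \<mu> L lbar \<delta> lamT\<rceil>; n = gap_grad_size \<mu> L lbar \<delta> lamT;
         us = ERM_calls g h w N lamT xT s m; s' = s + m * N; I1 = extract_indices dist us;
         vs = gradient_calls g w n lamT xT (us ! pick (map w [0..<s']) I1) s' m; s'' = s' + m * n;
         v = vs ! pick (map w [0..<s'']) (central_indices vs)
     in ({us ! i | i. i \<in> I1 \<inter> extract_indices (gap_pseudometric h v) us}, s''))"
  by (simp add: robust_gap_step_def run_repeat_ERM run_choose_from run_repeat_gradient Let_def)

text \<open>The number of samples read before stage \<open>j\<close>. It does not depend on the
  outcomes, so each block has a fixed place in the stream.\<close>

definition "stage_pos \<mu> lbar \<delta> lam m j = m * (\<Sum>i<j. nat \<lceil>stage_size \<mu> lbar \<delta> (prev_reg lam i)\<rceil>)"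

lemma stage_pos_Suc:
  "stage_pos \<mu> lbar \<delta> lam m (Suc j) = stage_pos \<mu> lbar \<delta> lam m j + m * nat \<lceil>stage_size \<mu> lbar \<delta> (prev_reg lam j)\<rceil>"
  by (simp add: stage_pos_def distrib_left)

primrec stage_point where
  "stage_point g h pick \<mu> lbar lam \<delta> m w 0 = 0"
| "stage_point g h pick \<mu> lbar lam \<delta> m w (Suc j) =
    (let ys = ERM_calls g h w (nat \<lceil>stage_size \<mu> lbar \<delta> (prev_reg lam j)\<rceil>) (prev_reg lam j)
           (stage_point g h pick \<mu> lbar lam \<delta> m w j) (stage_pos \<mu> lbar \<delta> lam m j) m
     in ys ! pick (map w [0..<stage_pos \<mu> lbar \<delta> lam m (Suc j)]) (central_indices ys))"

declare stage_point.simps(2) [simp del]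

lemma run_boost_stages:
  "run_state (boost_stages g h pick w \<mu> lbar lam \<delta> m j) 0 =
     (stage_point g h pick \<mu> lbar lam \<delta> m w j, stage_pos \<mu> lbar \<delta> lam m j)"
proof (induction j)
  case 0 show ?case by (simp add: stage_pos_def)
next
  case (Suc j) then show ?case by (simp add: run_ERM_R stage_pos_Suc stage_point.simps(2) Let_def)
qed

lemma run_BoostERMC:
  "run_state (BoostERMC g h pick w \<mu> L lbar lam \<delta> T m) 0 =
    run_state (robust_gap_step g h pick w \<mu> L lbar \<delta> m (lam T) (stage_point g h pick \<mu> lbar lam \<delta> m w (Suc T)))
      (stage_pos \<mu> lbar \<delta> lam m (Suc T))"
  unfolding BoostERMC_def by (simp only: run_state_bind run_boost_stages prod.case)

lemma snd_run_BoostERMC: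
  "snd (run_state (BoostERMC g h pick w \<mu> L lbar lam \<delta> T m) 0) = BoostERMC_samples \<mu> L lbar lam \<delta> T m"
  unfolding run_BoostERMC run_robust_gap_step
  by (simp add: Let_def BoostERMC_samples_def stage_pos_def lessThan_Suc_atMost)

lemma BoostERMC_nonempty_if_odd:
  assumes "odd m"
  shows "fst (run_state (BoostERMC g h pick w \<mu> L lbar lam \<delta> T m) 0) \<noteq> {}"
proof -
  have ne: "{us ! i | i. i \<in> extract_indices \<rho> us \<inter> extract_indices \<rho>' us} \<noteq> {}" if "length us = m"
    for \<rho> \<rho>' :: "'a \<Rightarrow> 'a \<Rightarrow> real" and us
    using extract_indices_odd_intersect[of us \<rho> \<rho>'] that assms by blast
  show ?thesis
    unfolding run_BoostERMC run_robust_gap_step Let_def fst_conv by (rule ne) simp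
qed

lemma sum_list_upt_shift:
  fixes f :: "nat \<Rightarrow> 'b::comm_monoid_add"
  shows "(\<Sum>i\<leftarrow>[s..<s + n]. f i) = (\<Sum>i<n. f (s + i))"
  by (induction n) (simp_all add: add.commute)

context composite begin

text \<open>Off \<open>C\<close> the objective is infinite and on \<open>C\<close> it equals
  \<open>emp\<close>, so both problems have the same minimizers; uniqueness removes the choice
  hidden in \<open>ARG_MIN\<close>.\<close>

lemma emp_min_eq_ARG_MIN:
  assumes lam: "0 \<le> lam" and N: "N > 0" and w: "w \<in> space S"
  shows "(ARG_MIN (empirical_objective g h (map w [s..<s + N]) lam x) y. True) = emp_min lam N x (shift s w)"
proof -
  have sh: "shift s w \<in> space S" using w by (simp add: space_S_iff shift_def)
  define F where "F = empirical_objective g h (map w [s..<s + N]) lam x"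
  have sum: "(\<Sum>z\<leftarrow>map w [s..<s + N]. g y z) = (\<Sum>i<N. g y (shift s w i))" for y
    by (simp add: comp_def sum_list_upt_shift shift_def)
  have FC: "F y = ereal (emp lam N x (shift s w) y)" if "y \<in> C" for y
    unfolding F_def empirical_objective_def emp_def sum by (simp add: h_eq_hr[OF that])
  have Fn: "F y = \<infinity>" if "y \<notin> C" for y
    unfolding F_def empirical_objective_def by (simp add: h_eq_inf[OF that])
  note gm = growth_min_emp_min[OF sh N lam, of x]
  have pos: "\<mu> + lam > 0" using mu_pos lam by simp
  show ?thesis
    unfolding F_def[symmetric]
  proof (rule arg_minI)
    define a where "a = emp_min lam N x (shift s w)"
    have aC: "a \<in> C" using emp_min_in_C[OF sh N lam] by (simp add: a_def)
    have le: "emp lam N x (shift s w) a \<le> emp lam N x (shift s w) y" if "y \<in> C" for y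
    proof -
      have "0 \<le> (\<mu> + lam) / 2 * (norm (y - a))^2" using pos by simp
      then show ?thesis using gm that unfolding growth_min_def a_def by fastforce
    qed
    show "\<not> F y < F (emp_min lam N x (shift s w))" for y
      unfolding a_def[symmetric] FC[OF aC] using le[of y] FC[of y] Fn[of y]
      by (cases "y \<in> C") (simp_all add: not_less)
    show "y = emp_min lam N x (shift s w)" if y: "\<forall>z. True \<longrightarrow> \<not> F z < F y" for y
    proof (rule growth_min_unique[OF gm pos])
      have "\<not> F a < F y" using y by blast
      then show yC: "y \<in> C" using Fn[of y] FC[OF aC] by (cases "y \<in> C") auto
      show "emp lam N x (shift s w) y \<le> emp lam N x (shift s w) (emp_min lam N x (shift s w))"
        using \<open>\<not> F a < F y\<close> unfolding FC[OF aC] FC[OF yC] a_def[symmetric] by simp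
    qed
  qed simp
qed

section \<open>Propagation of errors\<close>

definition "fr y = gbar y + hr y"

lemma pop_fr: "pop lam x y = fr y + lam / 2 * (norm (y - x))^2"
  by (simp add: pop_def fr_def)

lemma pop_min_le: "0 \<le> lam \<Longrightarrow> y \<in> C \<Longrightarrow> pop lam x (pop_min lam x) \<le> pop lam x y"
  using gap_nonneg[of lam y x] by (simp add: gap_def)

lemma INF_objective: "(INF y. ereal (gbar y) + h y) = ereal (fr (pop_min 0 x))"
proof (rule antisym)
  have C: "pop_min 0 x \<in> C" by (rule pop_min_in_C) simp
  show "(INF y. ereal (gbar y) + h y) \<le> ereal (fr (pop_min 0 x))"
    by (rule INF_lower2[of "pop_min 0 x"]) (simp_all add: fr_def h_eq_hr[OF C])
  show "ereal (fr (pop_min 0 x)) \<le> (INF y. ereal (gbar y) + h y)"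
  proof (rule INF_greatest)
    fix y show "ereal (fr (pop_min 0 x)) \<le> ereal (gbar y) + h y"
    proof (cases "y \<in> C")
      case True
      then show ?thesis using pop_min_le[of 0 y x] by (simp add: pop_fr h_eq_hr) (simp add: fr_def)
    qed (simp add: h_eq_inf)
  qed
qed

text \<open>Each stage raises the optimal value of the regularized problem by at most \<open>2 \<delta>\<close>, because
  the minimizer of the previous problem is an admissible competitor.\<close>

lemma boost_value:
  assumes lam: "\<And>j. 0 \<le> l j" "\<And>j. l (Suc j) \<le> 2 * (\<mu> + l j)" and l0: "l 0 = 0" and \<delta>: "0 \<le> \<delta>"
    and close: "\<And>j. j < n \<Longrightarrow> (\<mu> + l j) / 2 * (norm (X (Suc j) - pop_min (l j) (X j)))^2 \<le> \<delta>"
  shows "pop (l n) (X n) (pop_min (l n) (X n)) \<le> fr (pop_min 0 (X 0)) + 2 * real n * \<delta>"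
  using close
proof (induction n)
  case 0 show ?case by (simp add: l0 pop_fr)
next
  case (Suc n)
  define a where "a = pop_min (l n) (X n)"
  define d where "d = (norm (a - X (Suc n)))^2"
  have aC: "a \<in> C" unfolding a_def by (rule pop_min_in_C[OF lam(1)])
  have "(\<mu> + l n) / 2 * d \<le> \<delta>" using Suc.prems[of n] by (simp add: a_def d_def norm_minus_commute)
  \<comment> \<open>The growth limit on the weights enters here: half the new weight is at most the
    curvature \<open>\<mu> + l n\<close> that controlled the previous distance.\<close>
  moreover have "l (Suc n) / 2 * d \<le> (\<mu> + l n) * d"
    using lam(2)[of n] by (intro mult_right_mono) (auto simp: d_def)
  ultimately have *: "l (Suc n) / 2 * d \<le> 2 * \<delta>" by simp
  have "pop (l (Suc n)) (X (Suc n)) (pop_min (l (Suc n)) (X (Suc n))) \<le> pop (l (Suc n)) (X (Suc n)) a"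
    by (rule pop_min_le[OF lam(1) aC])
  also have "\<dots> \<le> fr a + 2 * \<delta>" using * by (simp add: pop_fr d_def)
  also have "fr a \<le> pop (l n) (X n) a" using lam(1)[of n] by (simp add: pop_fr)
  also have "pop (l n) (X n) a \<le> fr (pop_min 0 (X 0)) + 2 * real n * \<delta>"
    unfolding a_def using Suc by simp
  finally show ?case by (simp add: algebra_simps)
qed

end

context composite_grad begin

text \<open>The mean value theorem between \<open>b\<close> and \<open>a\<close> evaluates the
  gradient at an intermediate point, which is within \<open>K\<close> of \<open>c\<close> because
  balls are convex; the gradient of \<open>s\<close> is Lipschitz with constant
  \<open>L + lam\<close>. Linearizing at a third point \<open>c\<close> reflects that the gradient
  is estimated at one point only.\<close>

lemma smooth_part_bound:
  fixes a b c xT :: 'a and lam K :: real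
  assumes lam: "0 \<le> lam" and K: "norm (a - c) \<le> K" "norm (b - c) \<le> K"
  defines "s \<equiv> (\<lambda>y. gbar y + lam / 2 * (norm (y - xT))^2)"
    and "Ds \<equiv> (\<lambda>y. gradbar y + lam *\<^sub>R (y - xT))"
  shows "\<bar>s a - s b - (a - b) \<bullet> Ds c\<bar> \<le> (L + lam) * K * norm (a - b)"
proof -
  have sd: "(s has_derivative (\<lambda>h. h \<bullet> Ds y)) (at y)" for y
  proof -
    have "(gbar has_derivative (\<lambda>h. h \<bullet> gradbar y)) (at y)" using gradbar(1) by (simp add: gderiv_def)
    then show ?thesis
      unfolding s_def Ds_def power2_norm_eq_inner
      by (auto intro!: derivative_eq_intros simp: fun_eq_iff inner_add_right inner_commute algebra_simps)
  qed
  have "\<exists>t\<in>{0..1}. s (b + 1 *\<^sub>R (a - b)) - s (b + 0 *\<^sub>R (a - b)) = (\<lambda>u. (u *\<^sub>R (a - b)) \<bullet> Ds (b + t *\<^sub>R (a - b))) (1 - 0)"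
  proof (rule mvt_very_simple)
    fix t :: real
    have "((\<lambda>u::real. b + u *\<^sub>R (a - b)) has_derivative (\<lambda>u. u *\<^sub>R (a - b))) (at t)"
      by (auto intro!: derivative_eq_intros)
    from has_derivative_compose[OF this sd]
    show "((\<lambda>u. s (b + u *\<^sub>R (a - b))) has_derivative (\<lambda>u. (u *\<^sub>R (a - b)) \<bullet> Ds (b + t *\<^sub>R (a - b)))) (at t within {0..1})"
      by (rule has_derivative_at_withinI)
  qed simp
  then obtain t where t: "t \<in> {0..1}" and eq: "s a - s b = (a - b) \<bullet> Ds (b + t *\<^sub>R (a - b))" by auto
  define p where "p = b + t *\<^sub>R (a - b)"
  have "p - c = (1 - t) *\<^sub>R (b - c) + t *\<^sub>R (a - c)" by (simp add: p_def algebra_simps)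
  then have "norm (p - c) \<le> (1 - t) * norm (b - c) + t * norm (a - c)"
    using t norm_triangle_ineq[of "(1 - t) *\<^sub>R (b - c)" "t *\<^sub>R (a - c)"] by simp
  also have "\<dots> \<le> (1 - t) * K + t * K" using t K by (intro add_mono mult_left_mono) auto
  finally have pc: "norm (p - c) \<le> K" by (simp add: algebra_simps)
  have "norm (gradbar p - gradbar c) \<le> L * norm (p - c)"
    using lipschitz_onD[OF gradbar(2), of p c] by (simp add: dist_norm)
  moreover have "Ds p - Ds c = (gradbar p - gradbar c) + lam *\<^sub>R (p - c)" by (simp add: Ds_def algebra_simps)
  ultimately have "norm (Ds p - Ds c) \<le> (L + lam) * norm (p - c)"
    using norm_triangle_ineq[of "gradbar p - gradbar c" "lam *\<^sub>R (p - c)"] lam by (simp add: distrib_right)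
  also have "\<dots> \<le> (L + lam) * K" using pc L_pos lam by (intro mult_left_mono) auto
  finally have D: "norm (Ds p - Ds c) \<le> (L + lam) * K" .
  have "s a - s b - (a - b) \<bullet> Ds c = (a - b) \<bullet> (Ds p - Ds c)" by (simp add: eq p_def inner_diff_right)
  then have "\<bar>s a - s b - (a - b) \<bullet> Ds c\<bar> \<le> norm (a - b) * norm (Ds p - Ds c)"
    using Cauchy_Schwarz_ineq2[of "a - b" "Ds p - Ds c"] by simp
  also have "\<dots> \<le> norm (a - b) * ((L + lam) * K)" using D by (intro mult_left_mono) auto
  finally show ?thesis by (simp add: mult_ac)
qed

text \<open>Near the minimizer \<open>c\<close> the linearized gap
  \<open>hr y - hr c + v \<bullet> (y - c)\<close> differs from the true one by an error of second
  order in distances, plus the gradient error times the distance. A majority is small in both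
  senses: extraction by distance keeps the linearization valid, and extraction by the pseudometric
  bounds the linearized gap of the returned point.\<close>

lemma robust_gap_deterministic:
  assumes lam: "0 \<le> lam" and R: "0 \<le> R" "(\<mu> + lam) / 2 * R^2 = e" and e: "0 < e"
    and us: "\<And>k. k < length us \<Longrightarrow> us ! k \<in> C"
    and maj: "length us < 2 * card {k. k < length us \<and> gap lam xT (us ! k) \<le> e}"
    and i0: "i0 \<in> extract_indices dist us"
    and v: "norm (v - (gradbar (us ! i0) + lam *\<^sub>R (us ! i0 - xT))) \<le> \<eta>"
    and i: "i \<in> extract_indices dist us" "i \<in> extract_indices (gap_pseudometric h v) us"
  shows "gap lam xT (us ! i) \<le> 3 * e + 30 * (L + lam) * R^2 + 6 * \<eta> * R"
proof -
  define c where "c = pop_min lam xT"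
  define xh where "xh = us ! i0"
  define Ds where "Ds = (\<lambda>y. gradbar y + lam *\<^sub>R (y - xT))"
  define s where "s = (\<lambda>y. gbar y + lam / 2 * (norm (y - xT))^2)"
  have cC: "c \<in> C" unfolding c_def by (rule pop_min_in_C[OF lam])
  have \<eta>: "0 \<le> \<eta>" using v norm_ge_zero order_trans by blast
  have good: "dist (us ! k) c \<le> R" if "k < length us" "gap lam xT (us ! k) \<le> e" for k
    unfolding dist_norm c_def using that us R by (intro norm_le_of_gap_le[OF lam]) auto
  have "card {k. k < length us \<and> gap lam xT (us ! k) \<le> e} \<le> card {k. k < length us \<and> dist (us ! k) c \<le> R}"
    using good by (intro card_mono) auto
  then have maj1: "length us < 2 * card {k. k < length us \<and> dist (us ! k) c \<le> R}" using maj by linarith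
  have I1: "norm (us ! k - c) \<le> 3 * R" if "k \<in> extract_indices dist us" for k
    using pseudometric.extract_indices_close[OF pseudometric_dist maj1 that] by (simp add: dist_norm)
  have xh: "norm (xh - c) \<le> 3 * R" unfolding xh_def by (rule I1[OF i0])
  \<comment> \<open>The bound \<open>r\<close> on the distance from \<open>c\<close> will be
    \<open>R\<close> for the good majority and \<open>3 * R\<close> for the returned point. The
    linearization point \<open>xh\<close> is itself within \<open>3 * R\<close> of \<open>c\<close>,
    hence \<open>r + 3 * R\<close>.\<close>
  have dev: "\<bar>gap lam xT y - (hr y - hr c + v \<bullet> (y - c))\<bar> \<le> ((L + lam) * (r + 3 * R) + \<eta>) * r"
    if y: "norm (y - c) \<le> r" for y r
  proof -
    have r: "0 \<le> r" using y norm_ge_zero order_trans by blast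
    have "norm (y - xh) \<le> r + 3 * R"
      using norm_triangle_ineq[of "y - c" "c - xh"] y xh by (simp add: norm_minus_commute)
    moreover have "norm (c - xh) \<le> r + 3 * R" using xh r by (simp add: norm_minus_commute)
    ultimately have 1: "\<bar>s y - s c - (y - c) \<bullet> Ds xh\<bar> \<le> (L + lam) * (r + 3 * R) * norm (y - c)"
      unfolding s_def Ds_def by (rule smooth_part_bound[OF lam])
    have "\<bar>(y - c) \<bullet> (Ds xh - v)\<bar> \<le> norm (y - c) * norm (Ds xh - v)" by (rule Cauchy_Schwarz_ineq2)
    also have "\<dots> \<le> norm (y - c) * \<eta>"
      using v unfolding Ds_def xh_def by (intro mult_left_mono) (auto simp: norm_minus_commute)
    finally have 2: "\<bar>(y - c) \<bullet> (Ds xh - v)\<bar> \<le> \<eta> * norm (y - c)" by (simp add: mult.commute)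
    have "gap lam xT y - (hr y - hr c + v \<bullet> (y - c)) = (s y - s c - (y - c) \<bullet> Ds xh) + (y - c) \<bullet> (Ds xh - v)"
      unfolding gap_def pop_def s_def c_def[symmetric] inner_diff_right[of "y - c" "Ds xh" v] inner_commute[of v "y - c"]
      by linarith
    then have "\<bar>gap lam xT y - (hr y - hr c + v \<bullet> (y - c))\<bar> \<le> ((L + lam) * (r + 3 * R) + \<eta>) * norm (y - c)"
      using 1 2 unfolding distrib_right by linarith
    also have "\<dots> \<le> ((L + lam) * (r + 3 * R) + \<eta>) * r"
      using y L_pos lam r R(1) \<eta> by (intro mult_left_mono) auto
    finally show ?thesis .
  qed
  define \<rho>0 where "\<rho>0 = e + ((L + lam) * (R + 3 * R) + \<eta>) * R"
  have gp: "gap_pseudometric h v y c = \<bar>hr y - hr c + v \<bullet> (y - c)\<bar>" for y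
    by (simp add: gap_pseudometric_def hr_def)
  have "gap_pseudometric h v (us ! k) c \<le> \<rho>0" if k: "k < length us" "gap lam xT (us ! k) \<le> e" for k
    using dev[of "us ! k" R] good[OF k] gap_nonneg[OF lam us[OF k(1)], of xT] k(2)
    unfolding gp \<rho>0_def dist_norm by linarith
  then have "card {k. k < length us \<and> gap lam xT (us ! k) \<le> e} \<le> card {k. k < length us \<and> gap_pseudometric h v (us ! k) c \<le> \<rho>0}"
    by (intro card_mono) auto
  then have maj2: "length us < 2 * card {k. k < length us \<and> gap_pseudometric h v (us ! k) c \<le> \<rho>0}" using maj by linarith
  have "\<bar>hr (us ! i) - hr c + v \<bullet> (us ! i - c)\<bar> \<le> 3 * \<rho>0"
    using pseudometric.extract_indices_close[OF pseudometric_gap maj2 i(2)] by (simp add: gp)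
  then have "gap lam xT (us ! i) \<le> 3 * \<rho>0 + ((L + lam) * (3 * R + 3 * R) + \<eta>) * (3 * R)"
    using dev[OF I1[OF i(1)]] by linarith
  \<comment> \<open>Of the 30, 12 come from three times the error for the good majority and 18 from
    the error at the returned point; each of the two contributes 3 to the 6.\<close>
  also have "\<dots> = 3 * e + 30 * (L + lam) * R^2 + 6 * \<eta> * R"
    unfolding \<rho>0_def by (simp add: algebra_simps power2_eq_square)
  finally show ?thesis .
qed

end

section \<open>Success probability\<close>

lemma ERM_calls_cong:
  assumes "\<And>i. i < s + m * N \<Longrightarrow> w i = w' i"
  shows "ERM_calls g h w N lam x s m = ERM_calls g h w' N lam x s m"
  unfolding ERM_calls_def
proof (intro map_cong refl)
  fix k assume "k \<in> set [0..<m]"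
  then have "Suc k \<le> m" by (simp only: set_upt atLeastLessThan_iff Suc_le_eq)
  then have "Suc k * N \<le> m * N" by (rule mult_le_mono1)
  then have le: "k * N + N \<le> m * N" unfolding mult_Suc by linarith
  have "map w [s + k * N..<s + k * N + N] = map w' [s + k * N..<s + k * N + N]"
  proof (intro map_cong refl assms)
    fix i assume "i \<in> set [s + k * N..<s + k * N + N]"
    then have "i < s + k * N + N" by (simp only: set_upt atLeastLessThan_iff)
    then show "i < s + m * N" using le by linarith
  qed
  then show "(ARG_MIN (empirical_objective g h (map w [s + k * N..<s + k * N + N]) lam x) y. True) =
      (ARG_MIN (empirical_objective g h (map w' [s + k * N..<s + k * N + N]) lam x) y. True)"
    by (rule arg_cong[where f = "\<lambda>zs. ARG_MIN (empirical_objective g h zs lam x) y. True"])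
qed

lemma depends_on_firstI:
  "(\<And>w w'. (\<And>i. i < n \<Longrightarrow> w i = w' i) \<Longrightarrow> f w = f w') \<Longrightarrow> depends_on_first n f"
  unfolding depends_on_first_def by blast

lemma depends_on_firstD:
  "depends_on_first n f \<Longrightarrow> (\<And>i. i < n \<Longrightarrow> w i = w' i) \<Longrightarrow> f w = f w'"
  unfolding depends_on_first_def by blast

lemma sets_mem_finite_valued:
  assumes "I \<in> measurable N (count_space A)"
  shows "{w \<in> space N. i \<in> I w} \<in> sets N"
proof -
  have "I -` {J \<in> A. i \<in> J} \<inter> space N \<in> sets N" by (rule measurable_sets[OF assms]) auto
  moreover have "I -` {J \<in> A. i \<in> J} \<inter> space N = {w \<in> space N. i \<in> I w}"
    using measurable_space[OF assms] by auto
  ultimately show ?thesis by simp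
qed

lemma le_mult_nat_ceiling:
  assumes "0 < (b::real)"
  shows "a \<le> b * real (nat \<lceil>a / b\<rceil>)"
proof -
  have "a / b \<le> real (nat \<lceil>a / b\<rceil>)" by linarith
  then show ?thesis using assms by (simp add: pos_divide_le_eq mult.commute)
qed

text \<open>\<open>lam_step\<close> limits the rise of the optimal value between stages, and
  \<open>lam_T\<close> keeps the condition number \<open>kap\<close> of the final problem away from
  0.\<close>

locale boosting = composite_grad Z g h ell U \<mu> L lbar
  for Z :: "'z measure" and g :: "'a::euclidean_space \<Rightarrow> 'z \<Rightarrow> real" and h ell U \<mu> L lbar +
  fixes lam :: "nat \<Rightarrow> real" and \<delta> :: real and T m :: nat and pick :: "'z list \<Rightarrow> nat set \<Rightarrow> nat"
  assumes lam_nonneg: "\<And>j. 0 \<le> lam j"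
    and lam_step: "\<And>j. prev_reg lam (Suc j) \<le> 2 * (\<mu> + prev_reg lam j)"
    and lam_T: "\<mu> \<le> lam T"
    and delta_pos: "\<delta> > 0" and m_pos: "m > 0"
    and pick_mem: "\<And>zs I. finite I \<Longrightarrow> I \<noteq> {} \<Longrightarrow> pick zs I \<in> I"
    and pick_measurable: "\<And>s I. finite I \<Longrightarrow> I \<noteq> {} \<Longrightarrow>
                            (\<lambda>w. pick (map w [0..<s]) I) \<in> measurable (\<Pi>\<^sub>M i\<in>(UNIV :: nat set). Z) (count_space UNIV)"
begin

abbreviation "l \<equiv> prev_reg lam"
abbreviation "Nst j \<equiv> nat \<lceil>stage_size \<mu> lbar \<delta> (l j)\<rceil>"
abbreviation "ps \<equiv> stage_pos \<mu> lbar \<delta> lam m"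
abbreviation "X j w \<equiv> stage_point g h pick \<mu> lbar lam \<delta> m w j"

lemma l_nonneg: "0 \<le> l j"
  using lam_nonneg by (simp add: prev_reg_def split: nat.split)

lemma mu_l_pos: "0 < \<mu> + l j"
  using l_nonneg[of j] mu_pos by simp

lemma Nst_pos: "Nst j > 0"
proof -
  have "stage_size \<mu> lbar \<delta> (l j) > 0"
    unfolding stage_size_def using lbar_pos delta_pos mu_l_pos[of j] by (intro divide_pos_pos mult_pos_pos) auto
  then show ?thesis by simp
qed

lemma shift_S: "w \<in> space S \<Longrightarrow> shift s w \<in> space S"
  by (simp add: space_S_iff shift_def)

lemma nth_ERM_calls:
  assumes "0 \<le> lm" "N > 0" "w \<in> space S" "k < m"
  shows "ERM_calls g h w N lm x s m ! k = emp_min lm N x (shift (s + k * N) w)"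
  using assms emp_min_eq_ARG_MIN[OF assms(1-3), of "s + k * N" x] by (simp add: ERM_calls_def)

lemma nth_ERM_calls_in_C:
  assumes "0 \<le> lm" "N > 0" "w \<in> space S" "k < m"
  shows "ERM_calls g h w N lm x s m ! k \<in> C"
  using nth_ERM_calls[OF assms] emp_min_in_C[OF shift_S[OF assms(3)] assms(2,1)] by simp

lemma measurable_nth_ERM_calls:
  assumes "0 \<le> lm" "N > 0" "k < m" and [measurable]: "Y \<in> borel_measurable S"
  shows "(\<lambda>w. ERM_calls g h w N lm (Y w) s m ! k) \<in> borel_measurable S"
proof -
  have "(\<lambda>w. emp_min lm N (Y w) (shift (s + k * N) w)) \<in> borel_measurable S"
    by (rule measurable_emp_min'[OF assms(1,2)]) measurable
  then show ?thesis using nth_ERM_calls[OF assms(1,2) _ assms(3)] by (subst measurable_cong) auto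
qed

lemma pick_in: "J \<in> Pow {..<m} - {{}} \<Longrightarrow> pick zs J \<in> J"
  using pick_mem[of J] finite_subset[of J "{..<m}"] by blast

lemma pick_meas: "J \<in> Pow {..<m} - {{}} \<Longrightarrow> (\<lambda>w. pick (map w [0..<s]) J) \<in> measurable S (count_space UNIV)"
  by (rule pick_measurable) (auto intro: finite_subset)

lemma central_pick:
  fixes ys :: "'b::metric_space list"
  assumes "length ys = m" shows "pick zs (central_indices ys) \<in> central_indices ys"
proof (rule pick_in)
  have "ys \<noteq> []" using assms m_pos by auto
  then show "central_indices ys \<in> Pow {..<m} - {{}}"
    using central_indices_nonempty[of ys] assms by (auto simp: central_indices_def)
qed

lemma extract_pick:
  assumes "length ys = m" shows "pick zs (extract_indices \<rho> ys) \<in> extract_indices \<rho> ys"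
proof (rule pick_in)
  have "ys \<noteq> []" using assms m_pos by auto
  then show "extract_indices \<rho> ys \<in> Pow {..<m} - {{}}"
    using extract_indices_nonempty[of ys \<rho>] extract_indices_subset[of \<rho> ys] assms by auto
qed

text \<open>The rule \<open>pick\<close> sees only samples already drawn, so each iterate is a
  function of the prefix read so far.\<close>

lemma depends_X: "depends_on_first (ps j) (X j)"
proof (induction j)
  case 0 show ?case by (simp add: depends_on_first_def)
next
  case (Suc j)
  show ?case
  proof (rule depends_on_firstI)
    fix w w' :: "nat \<Rightarrow> 'z" assume eq: "\<And>i. i < ps (Suc j) \<Longrightarrow> w i = w' i"
    have "X j w = X j w'" using eq by (intro depends_on_firstD[OF Suc]) (simp add: stage_pos_Suc)
    moreover have "ERM_calls g h w (Nst j) (l j) x (ps j) m = ERM_calls g h w' (Nst j) (l j) x (ps j) m" for x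
      using eq by (intro ERM_calls_cong) (simp add: stage_pos_Suc)
    moreover have "map w [0..<ps (Suc j)] = map w' [0..<ps (Suc j)]" using eq by (intro map_cong) auto
    ultimately show "X (Suc j) w = X (Suc j) w'" by (simp only: stage_point.simps(2))
  qed
qed

lemma measurable_X [measurable]: "X j \<in> borel_measurable S"
proof (induction j)
  case (Suc j)
  note [measurable] = Suc
  have m: "(\<lambda>w. ERM_calls g h w (Nst j) (l j) (X j w) (ps j) m ! k) \<in> borel_measurable S" if "k < m" for k
    by (intro measurable_nth_ERM_calls l_nonneg Nst_pos that Suc)
  show ?case
    unfolding stage_point.simps Let_def
    by (rule borel_measurable_nth_index[OF m])
       (auto intro!: measurable_central_indices m m_pos pick_meas pick_in)
qed simp

text \<open>The threshold is three times the bound on the expected gap. A tie counts as failure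
  because selection needs a strict majority.\<close>

definition "bad lm N Y s =
  {w \<in> space S. 2 * card {k. k < m \<and> gap lm (Y w) (emp_min lm N (Y w) (shift (s + k * N) w))
     \<le> 6 * lbar^2 / ((\<mu> + lm) * real N)} \<le> m}"

lemma prob_bad:
  assumes lm: "0 \<le> lm" and N: "N > 0" and Y: "Y \<in> borel_measurable S" "depends_on_first s Y"
  shows "measure S (bad lm N Y s) \<le> exp (- real m / 18)" "bad lm N Y s \<in> sets S"
proof -
  define Pr where "Pr = (\<lambda>x \<zeta>. gap lm x (emp_min lm N x \<zeta>) \<le> 6 * lbar^2 / ((\<mu> + lm) * real N))"
  have 1: "Measurable.pred (borel \<Otimes>\<^sub>M S) (\<lambda>p. Pr (fst p) (snd p))"
  proof -
    have [measurable]: "(\<lambda>p. emp_min lm N (fst p) (snd p)) \<in> borel_measurable (borel \<Otimes>\<^sub>M S)"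
      by (rule measurable_emp_min[OF lm N])
    have [measurable]: "(\<lambda>p. gap lm (fst p) (emp_min lm N (fst p) (snd p))) \<in> borel_measurable (borel \<Otimes>\<^sub>M S)"
      by (rule measurable_gap[OF _ _ lm]) measurable
    show ?thesis unfolding Pr_def by measurable
  qed
  have 2: "depends_on_first N (Pr x)" for x
    using depends_on_first_emp_min[of N lm x] unfolding depends_on_first_def Pr_def by metis
  have 3: "measure S {z \<in> space S. Pr (Y w) z} \<ge> 2 / 3" for w
    unfolding Pr_def by (rule prob_gap_le[OF lm N])
  show "measure S (bad lm N Y s) \<le> exp (- real m / 18)" "bad lm N Y s \<in> sets S"
    unfolding bad_def by (rule prob_fresh_minority[OF Y 1 2 3, of m, unfolded Pr_def])+
qed

text \<open>A majority has gap at most \<open>\<tau>\<close>, hence distance at most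
  \<open>R\<close> from the minimizer. Selection triples the distance, so its square grows by 9, and
  9 times the 6 in \<open>\<tau>\<close> is the 54 of the stage size.\<close>

lemma stage_close:
  assumes w: "w \<in> space S" and nb: "w \<notin> bad (l j) (Nst j) (X j) (ps j)"
  shows "(\<mu> + l j) / 2 * (norm (X (Suc j) w - pop_min (l j) (X j w)))^2 \<le> \<delta>"
proof -
  define N where "N = Nst j"
  define \<nu> where "\<nu> = \<mu> + l j"
  define x where "x = X j w"
  define c where "c = pop_min (l j) x"
  define ys where "ys = ERM_calls g h w N (l j) x (ps j) m"
  define \<tau> where "\<tau> = 6 * lbar^2 / (\<nu> * real N)"
  define R where "R = sqrt (2 * \<tau> / \<nu>)"
  have \<nu>: "\<nu> > 0" using mu_l_pos by (simp add: \<nu>_def)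
  have N: "N > 0" unfolding N_def by (rule Nst_pos)
  have \<tau>: "\<tau> > 0" unfolding \<tau>_def using \<nu> N lbar_pos by simp
  have R: "0 \<le> R" "\<nu> / 2 * R^2 = \<tau>" using \<nu> \<tau> by (simp_all add: R_def)
  have len: "length ys = m" by (simp add: ys_def)
  have nth: "ys ! k = emp_min (l j) N x (shift (ps j + k * N) w)" if "k < m" for k
    unfolding ys_def by (rule nth_ERM_calls[OF l_nonneg N w that])
  have good: "dist (ys ! k) c \<le> R" if "k < m" "gap (l j) x (ys ! k) \<le> \<tau>" for k
    unfolding dist_norm c_def
    using that R nth_ERM_calls_in_C[OF l_nonneg N w] unfolding ys_def \<nu>_def by (intro norm_le_of_gap_le[OF l_nonneg]) auto
  have "m < 2 * card {k. k < m \<and> gap (l j) x (ys ! k) \<le> \<tau>}"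
  proof -
    have "{k. k < m \<and> gap (l j) x (ys ! k) \<le> \<tau>} =
        {k. k < m \<and> gap (l j) x (emp_min (l j) N x (shift (ps j + k * N) w)) \<le> \<tau>}" using nth by auto
    then show ?thesis using nb w unfolding bad_def \<tau>_def \<nu>_def N_def x_def by simp
  qed
  also have "2 * card {k. k < m \<and> gap (l j) x (ys ! k) \<le> \<tau>} \<le> 2 * card {k. k < length ys \<and> dist (ys ! k) c \<le> R}"
    using good len by (intro mult_left_mono card_mono) auto
  finally have maj: "length ys < 2 * card {k. k < length ys \<and> dist (ys ! k) c \<le> R}" using len by simp
  have "dist (X (Suc j) w) c \<le> 3 * R"
    using central_indices_close[OF maj central_pick[OF len]]
    by (simp add: Let_def ys_def N_def x_def stage_point.simps(2))
  then have "(norm (X (Suc j) w - c))^2 \<le> (3 * R)^2" unfolding dist_norm by (intro power_mono) auto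
  then have "\<nu> / 2 * (norm (X (Suc j) w - c))^2 \<le> \<nu> / 2 * (3 * R)^2" using \<nu> by (intro mult_left_mono) auto
  also have "\<dots> = 9 * (\<nu> / 2 * R^2)" by (simp add: power_mult_distrib)
  also have "\<dots> = 9 * \<tau>" by (simp only: R(2))
  also have "\<dots> \<le> \<delta>"
  proof -
    have "54 * lbar^2 \<le> (\<nu> * \<delta>) * real N"
      unfolding N_def stage_size_def \<nu>_def using mu_l_pos delta_pos by (intro le_mult_nat_ceiling) simp
    then show ?thesis unfolding \<tau>_def using \<nu> N by (simp add: pos_divide_le_eq mult_ac)
  qed
  finally show ?thesis unfolding \<nu>_def c_def x_def .
qed

section \<open>The final gap estimation step\<close>

abbreviation "lT \<equiv> lam T"
abbreviation "N1 \<equiv> nat \<lceil>gap_ERM_size \<mu> L lbar \<delta> lT\<rceil>"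
abbreviation "n2 \<equiv> gap_grad_size \<mu> L lbar \<delta> lT"
abbreviation "xT w \<equiv> X (Suc T) w"
abbreviation "s1 \<equiv> ps (Suc T)"
abbreviation "s2 \<equiv> s1 + m * N1"
definition "us w = ERM_calls g h w N1 lT (xT w) s1 m"
definition "xh w = us w ! pick (map w [0..<s2]) (extract_indices dist (us w))"
definition "vs w = gradient_calls g w n2 lT (xT w) (xh w) s2 m"
definition "vv w = vs w ! pick (map w [0..<s2 + m * n2]) (central_indices (vs w))"
definition "result w = {us w ! i | i. i \<in> extract_indices dist (us w) \<inter> extract_indices (gap_pseudometric h (vv w)) (us w)}"

lemma fst_run_eq_result: "fst (run_state (BoostERMC g h pick w \<mu> L lbar lam \<delta> T m) 0) = result w"
  unfolding run_BoostERMC run_robust_gap_step Let_def fst_conv result_def vv_def vs_def xh_def us_def ..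

definition "mu' = \<mu> + lT"
definition "kap = (L + lT) / mu'"
definition "eps' = gap_accuracy \<mu> L \<delta> lT"

lemma mu'_pos: "mu' > 0" using mu_pos lam_nonneg[of T] by (simp add: mu'_def)

text \<open>The condition number may be less than \<open>1\<close>, because \<open>h\<close> can contribute to the strong convexity.\<close>

lemma kap: "1 / 2 \<le> kap"
proof -
  have "mu' \<le> 2 * (L + lT)" using lam_T L_pos by (simp add: mu'_def)
  then show ?thesis unfolding kap_def using mu'_pos by (simp add: pos_le_divide_eq)
qed

lemma delta_eq: "\<delta> = 222 * kap * eps'"
  unfolding eps'_def gap_accuracy_def kap_def mu'_def[symmetric] using mu'_pos L_pos lam_nonneg[of T] by simp

lemma eps'_pos: "eps' > 0"
proof (rule ccontr)
  assume "\<not> eps' > 0"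
  then have "222 * kap * eps' \<le> 0" using kap by (intro mult_nonneg_nonpos) auto
  then show False using delta_eq delta_pos by linarith
qed

lemma N1: "N1 > 0" "6 * lbar^2 / (mu' * real N1) \<le> eps'"
proof -
  have eq: "gap_ERM_size \<mu> L lbar \<delta> lT = 6 * lbar^2 / (mu' * eps')" by (simp add: gap_ERM_size_def mu'_def eps'_def)
  show "N1 > 0" unfolding eq using mu'_pos eps'_pos lbar_pos by simp
  moreover have "6 * lbar^2 \<le> (mu' * eps') * real N1"
    unfolding eq using mu'_pos eps'_pos by (intro le_mult_nat_ceiling) simp
  ultimately show "6 * lbar^2 / (mu' * real N1) \<le> eps'" using mu'_pos by (simp add: pos_divide_le_eq mult_ac)
qed

lemma n2: "n2 > 0" "lbar^2 / real n2 \<le> kap^2 * mu' * eps' / 12"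
proof -
  \<comment> \<open>The 12 combines the factor 3 of the sample size with the variance bound
    \<open>4 * lbar^2\<close>.\<close>
  have eq: "n2 = nat \<lceil>12 * lbar^2 / (kap^2 * mu' * eps')\<rceil>"
    by (simp add: gap_grad_size_def mu'_def eps'_def kap_def Let_def)
  have p: "kap^2 * mu' * eps' > 0" using mu'_pos eps'_pos kap by simp
  then show n: "n2 > 0" unfolding eq using lbar_pos by simp
  have "12 * lbar^2 \<le> (kap^2 * mu' * eps') * real n2"
    unfolding eq using p by (rule le_mult_nat_ceiling)
  then show "lbar^2 / real n2 \<le> kap^2 * mu' * eps' / 12" using n by (simp add: pos_divide_le_eq)
qed

lemma length_us [simp]: "length (us w) = m" by (simp add: us_def)
lemma length_vs [simp]: "length (vs w) = m" by (simp add: vs_def)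

lemma us_in_C: "w \<in> space S \<Longrightarrow> k < m \<Longrightarrow> us w ! k \<in> C"
  unfolding us_def by (rule nth_ERM_calls_in_C[OF lam_nonneg N1(1)])

lemma measurable_us: "k < m \<Longrightarrow> (\<lambda>w. us w ! k) \<in> borel_measurable S"
  unfolding us_def by (intro measurable_nth_ERM_calls lam_nonneg N1(1) measurable_X)

lemma extract_lt: "i \<in> extract_indices \<rho> (us w) \<Longrightarrow> i < m"
  using extract_indices_subset[of \<rho> "us w"] by auto

lemma xh_in_C: "w \<in> space S \<Longrightarrow> xh w \<in> C"
  unfolding xh_def by (rule us_in_C[OF _ extract_lt[OF extract_pick[OF length_us]]])

lemma measurable_I1: "(\<lambda>w. extract_indices dist (us w)) \<in> measurable S (count_space (Pow {..<m} - {{}}))"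
  by (rule measurable_extract_indices[OF length_us m_pos]) (intro borel_measurable_dist measurable_us)

lemma measurable_xh [measurable]: "xh \<in> borel_measurable S"
  unfolding xh_def[abs_def]
  by (rule borel_measurable_nth_index[OF measurable_us measurable_I1 pick_meas pick_in])

text \<open>Everything entering \<open>xh\<close>, including the choice by \<open>pick\<close>, is
  read before position \<open>s2\<close>, so the gradient samples are fresh relative to the point at
  which they are evaluated.\<close>

lemma depends_xh: "depends_on_first s2 xh"
proof (rule depends_on_firstI)
  fix w w' :: "nat \<Rightarrow> 'z" assume eq: "\<And>i. i < s2 \<Longrightarrow> w i = w' i"
  have "xT w = xT w'" using eq by (intro depends_on_firstD[OF depends_X]) simp
  moreover have "ERM_calls g h w N1 lT x s1 m = ERM_calls g h w' N1 lT x s1 m" for x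
    using eq by (intro ERM_calls_cong) simp
  ultimately have "us w = us w'" by (simp only: us_def)
  moreover have "map w [0..<s2] = map w' [0..<s2]" using eq by (intro map_cong) auto
  ultimately show "xh w = xh w'" by (simp only: xh_def)
qed

definition "avg x \<zeta> = (1 / real n2) *\<^sub>R (\<Sum>i<n2. G x (\<zeta> i))"

lemma nth_vs:
  assumes w: "w \<in> space S" and k: "k < m"
  shows "vs w ! k = avg (xh w) (shift (s2 + k * n2) w) + lT *\<^sub>R (xh w - xT w)"
proof -
  have "xh w \<in> U" using xh_in_C[OF w] C_subset_U by blast
  then have "vs w ! k = (1 / real n2) *\<^sub>R (\<Sum>i<n2. G (xh w) (shift (s2 + k * n2) w i) + lT *\<^sub>R (xh w - xT w))"
    using k by (simp add: vs_def gradient_calls_def comp_def sum_list_upt_shift shift_def G_def)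
  also have "\<dots> = avg (xh w) (shift (s2 + k * n2) w) + lT *\<^sub>R (xh w - xT w)"
    using n2(1) by (simp add: avg_def sum.distrib scaleR_add_right sum_constant_scaleR)
  finally show ?thesis .
qed

lemma measurable_avg:
  assumes [measurable]: "Y \<in> borel_measurable Q" "V \<in> measurable Q S"
  shows "(\<lambda>w. avg (Y w) (V w)) \<in> borel_measurable Q"
proof -
  have c: "(\<lambda>w. V w i) \<in> measurable Q Z" for i
    by (rule measurable_compose[OF assms(2) measurable_component_singleton[OF UNIV_I]])
  show ?thesis
    unfolding avg_def
    by (intro borel_measurable_scaleR borel_measurable_const borel_measurable_sum measurable_G' assms(1) c)
qed

lemma measurable_vs: "k < m \<Longrightarrow> (\<lambda>w. vs w ! k) \<in> borel_measurable S"
proof -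
  assume k: "k < m"
  have "(\<lambda>w. avg (xh w) (shift (s2 + k * n2) w) + lT *\<^sub>R (xh w - xT w)) \<in> borel_measurable S"
    by (intro borel_measurable_add measurable_avg borel_measurable_scaleR borel_measurable_diff
        measurable_xh measurable_X measurable_shift borel_measurable_const)
  then show ?thesis using nth_vs[OF _ k] by (subst measurable_cong) auto
qed

lemma measurable_vv [measurable]: "vv \<in> borel_measurable S"
  unfolding vv_def[abs_def]
  by (rule borel_measurable_nth_index[OF measurable_vs
        measurable_central_indices[OF length_vs m_pos measurable_vs] pick_meas pick_in])

lemma measurable_I2:
  "(\<lambda>w. extract_indices (gap_pseudometric h (vv w)) (us w)) \<in> measurable S (count_space (Pow {..<m} - {{}}))"
proof (rule measurable_extract_indices[OF length_us m_pos])
  fix i k assume ik: "i < m" "k < m"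
  note [measurable] = measurable_us[OF ik(1)] measurable_us[OF ik(2)]
  show "(\<lambda>w. gap_pseudometric h (vv w) (us w ! i) (us w ! k)) \<in> borel_measurable S"
    unfolding gap_pseudometric_def hr_def[symmetric] by measurable
qed

definition "bad_grad = {w \<in> space S. 2 * card {k. k < m \<and>
   norm (avg (xh w) (shift (s2 + k * n2) w) - gradbar (xh w)) \<le> sqrt (3 * (lbar^2 / real n2))} \<le> m}"

lemma prob_bad_grad: "measure S bad_grad \<le> exp (- real m / 18)" "bad_grad \<in> sets S"
proof -
  define Pr where "Pr = (\<lambda>x \<zeta>. norm (avg x \<zeta> - gradbar x) \<le> sqrt (3 * (lbar^2 / real n2)))"
  have 1: "Measurable.pred (borel \<Otimes>\<^sub>M S) (\<lambda>p. Pr (fst p) (snd p))"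
  proof -
    have [measurable]: "(\<lambda>p. avg (fst p) (snd p)) \<in> borel_measurable (borel \<Otimes>\<^sub>M S)"
      by (rule measurable_avg) measurable
    have [measurable]: "gradbar \<in> borel_measurable borel"
      by (rule borel_measurable_continuous_onI[OF lipschitz_on_continuous_on[OF gradbar(2)]])
    show ?thesis unfolding Pr_def by measurable
  qed
  have 2: "depends_on_first n2 (Pr x)" for x
    by (rule depends_on_firstI) (simp add: Pr_def avg_def)
  have 3: "measure S {z \<in> space S. Pr (xh w) z} \<ge> 2 / 3" if "w \<in> space S" for w
    unfolding Pr_def avg_def by (rule prob_avg_gradient[OF xh_in_C[OF that] n2(1)])
  show "measure S bad_grad \<le> exp (- real m / 18)"
    unfolding bad_grad_def by (rule prob_fresh_minority(1)[OF measurable_xh depends_xh 1 2 3, of m, unfolded Pr_def])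
  show "bad_grad \<in> sets S"
    unfolding bad_grad_def by (rule prob_fresh_minority(2)[OF measurable_xh depends_xh 1 2 3, of m, unfolded Pr_def])
qed

text \<open>The deterministic bound applies with gradient error \<open>3 * q\<close>. Its terms are
  at most 6, 60 and 18 times \<open>kap * eps'\<close>, the first because \<open>kap\<close> is at
  least 1/2; their sum stays below the factor 222 that relates \<open>\<delta>\<close> to
  \<open>eps'\<close>.\<close>

lemma final_gap:
  assumes w: "w \<in> space S" and nb: "w \<notin> bad lT N1 (X (Suc T)) s1" "w \<notin> bad_grad"
    and y: "y \<in> result w"
  shows "gap lT (xT w) y \<le> \<delta>"
proof -
  obtain i where i: "y = us w ! i" "i \<in> extract_indices dist (us w)" "i \<in> extract_indices (gap_pseudometric h (vv w)) (us w)"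
    using y unfolding result_def by blast
  define R where "R = sqrt (2 * eps' / mu')"
  define q where "q = sqrt (3 * (lbar^2 / real n2))"
  define Ds where "Ds = gradbar (xh w) + lT *\<^sub>R (xh w - xT w)"
  have R: "0 \<le> R" "mu' / 2 * R^2 = eps'" "R^2 = 2 * eps' / mu'" using mu'_pos eps'_pos by (simp_all add: R_def)
  have nth: "us w ! k = emp_min lT N1 (xT w) (shift (s1 + k * N1) w)" if "k < m" for k
    unfolding us_def by (rule nth_ERM_calls[OF lam_nonneg N1(1) w that])
  have "m < 2 * card {k. k < m \<and> gap lT (xT w) (emp_min lT N1 (xT w) (shift (s1 + k * N1) w)) \<le> 6 * lbar^2 / (mu' * real N1)}"
    using nb(1) w unfolding bad_def mu'_def by simp
  also have "\<dots> \<le> 2 * card {k. k < length (us w) \<and> gap lT (xT w) (us w ! k) \<le> eps'}"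
    using N1(2) nth by (intro mult_left_mono card_mono) auto
  finally have maj: "length (us w) < 2 * card {k. k < length (us w) \<and> gap lT (xT w) (us w ! k) \<le> eps'}" by simp
  have "m < 2 * card {k. k < m \<and> norm (avg (xh w) (shift (s2 + k * n2) w) - gradbar (xh w)) \<le> q}"
    using nb(2) w unfolding bad_grad_def q_def by simp
  also have "\<dots> \<le> 2 * card {k. k < length (vs w) \<and> dist (vs w ! k) Ds \<le> q}"
    using nth_vs[OF w] by (intro mult_left_mono card_mono) (auto simp: dist_norm Ds_def)
  finally have majv: "length (vs w) < 2 * card {k. k < length (vs w) \<and> dist (vs w ! k) Ds \<le> q}" by simp
  have v: "norm (vv w - Ds) \<le> 3 * q"
    using central_indices_close[OF majv central_pick[OF length_vs]] by (simp add: vv_def dist_norm)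
  have "gap lT (xT w) (us w ! i) \<le> 3 * eps' + 30 * (L + lT) * R^2 + 6 * (3 * q) * R"
    by (rule robust_gap_deterministic[OF lam_nonneg R(1) R(2)[unfolded mu'_def] eps'_pos us_in_C[OF w] maj
          extract_pick[OF length_us] v[unfolded Ds_def xh_def] i(2,3)]) (simp only: length_us)
  also have "\<dots> = 3 * eps' + 60 * kap * eps' + 18 * (q * R)"
  proof -
    have "30 * (L + lT) * R^2 = 60 * kap * eps'" unfolding R(3) kap_def by simp
    moreover have "6 * (3 * q) * R = 18 * (q * R)" by simp
    ultimately show ?thesis by (simp only:)
  qed
  also have "\<dots> \<le> 222 * kap * eps'"
  proof -
    \<comment> \<open>The gradient accuracy is tuned to the radius: the square of
      \<open>q * R\<close> is at most half the square of \<open>kap * eps'\<close>.\<close>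
    have "q * R \<le> kap * eps'"
    proof (rule power2_le_imp_le)
      have "(q * R)^2 = 3 * (lbar^2 / real n2) * (2 * eps' / mu')"
        using R(3) by (simp add: q_def power_mult_distrib)
      also have "\<dots> \<le> 3 * (kap^2 * mu' * eps' / 12) * (2 * eps' / mu')"
        using n2(2) mu'_pos eps'_pos by (intro mult_right_mono mult_left_mono) auto
      also have "\<dots> = 1 / 2 * (kap * eps')^2" using mu'_pos by (simp add: power2_eq_square)
      also have "\<dots> \<le> (kap * eps')^2" by simp
      finally show "(q * R)^2 \<le> (kap * eps')^2" .
      show "0 \<le> kap * eps'" using kap eps'_pos by simp
    qed
    moreover have "1 / 2 * eps' \<le> kap * eps'" using kap eps'_pos by (intro mult_right_mono) auto
    moreover have "60 * kap * eps' = 60 * (kap * eps')" "222 * kap * eps' = 222 * (kap * eps')" by simp_all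
    ultimately show ?thesis using eps'_pos by linarith
  qed
  finally show ?thesis unfolding i(1) using delta_eq by linarith
qed

text \<open>Recentring over \<open>T + 1\<close> stages costs
  \<open>2 * real (Suc T) * \<delta>\<close> and the final step another \<open>\<delta>\<close>. The
  regularization is nonnegative, so a bound for the regularized objective also bounds
  \<open>fr\<close>.\<close>

lemma result_good:
  assumes w: "w \<in> space S" and nb: "\<And>j. j \<le> T \<Longrightarrow> w \<notin> bad (l j) (Nst j) (X j) (ps j)"
    "w \<notin> bad lT N1 (X (Suc T)) s1" "w \<notin> bad_grad"
    and y: "y \<in> result w"
  shows "fr y \<le> fr (pop_min 0 0) + (2 * real T + 3) * \<delta>"
proof -
  have "pop (l (Suc T)) (X (Suc T) w) (pop_min (l (Suc T)) (X (Suc T) w))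
      \<le> fr (pop_min 0 (X 0 w)) + 2 * real (Suc T) * \<delta>"
  proof (rule boost_value[where X = "\<lambda>j. X j w"])
    fix j assume "j < Suc T"
    then show "(\<mu> + l j) / 2 * (norm (X (Suc j) w - pop_min (l j) (X j w)))^2 \<le> \<delta>"
      by (intro stage_close[OF w nb(1)]) simp
  qed (use l_nonneg lam_step delta_pos in \<open>auto simp: prev_reg_def\<close>)
  moreover have "l (Suc T) = lT" by (simp add: prev_reg_def)
  moreover have "gap lT (xT w) y \<le> \<delta>" by (rule final_gap[OF w nb(2,3) y])
  moreover have "fr y \<le> pop lT (xT w) y" using lam_nonneg[of T] by (simp add: pop_fr)
  moreover have "2 * real (Suc T) * \<delta> + \<delta> = (2 * real T + 3) * \<delta>" by (simp add: algebra_simps)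
  moreover have "X 0 w = 0" by simp
  ultimately show ?thesis unfolding gap_def by (simp only:)
qed

text \<open>The error \<open>(2 * real T + 4) * \<delta>\<close> is exactly the target accuracy. All
  points of \<open>result w\<close> have to be accurate, which covers the arbitrary final
  choice.\<close>

definition "good = {w \<in> space S. \<forall>y\<in>result w. fr y \<le> fr (pop_min 0 0) + (2 * real T + 4) * \<delta>}"

lemma sets_good: "good \<in> sets S"
proof -
  have "good = {w \<in> space S. \<forall>i\<in>{..<m}. i \<in> extract_indices dist (us w) \<longrightarrow>
      i \<in> extract_indices (gap_pseudometric h (vv w)) (us w) \<longrightarrow>
      fr (us w ! i) \<le> fr (pop_min 0 0) + (2 * real T + 4) * \<delta>}"
    unfolding good_def result_def using extract_lt by blast
  also have "\<dots> \<in> sets S"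
  proof (rule sets.sets_Collect_finite_All)
    fix i assume "i \<in> {..<m}"
    then have [measurable]: "(\<lambda>w. us w ! i) \<in> borel_measurable S" using measurable_us by simp
    have [measurable]: "Measurable.pred S (\<lambda>w. i \<in> extract_indices dist (us w))"
      "Measurable.pred S (\<lambda>w. i \<in> extract_indices (gap_pseudometric h (vv w)) (us w))"
      using sets_mem_finite_valued[OF measurable_I1] sets_mem_finite_valued[OF measurable_I2] by (auto simp: pred_def)
    have [measurable]: "fr \<in> borel_measurable borel" unfolding fr_def[abs_def] by measurable
    show "{w \<in> space S. i \<in> extract_indices dist (us w) \<longrightarrow>
      i \<in> extract_indices (gap_pseudometric h (vv w)) (us w) \<longrightarrow>
      fr (us w ! i) \<le> fr (pop_min 0 0) + (2 * real T + 4) * \<delta>} \<in> sets S" by measurable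
  qed simp
  finally show ?thesis .
qed

text \<open>Union bound over \<open>T + 1\<close> stages, the final minimizers and the final
  gradients, each failing with probability at most \<open>exp (- real m / 18)\<close>.\<close>

lemma prob_good: "measure S good \<ge> 1 - (real T + 3) * exp (- real m / 18)"
proof -
  define q where "q = exp (- real m / 18)"
  define E where "E = (\<lambda>j. bad (l j) (Nst j) (X j) (ps j))"
  define F where "F = bad lT N1 (X (Suc T)) s1"
  have E: "measure S (E j) \<le> q" "E j \<in> sets S" for j
    unfolding E_def q_def by (intro prob_bad l_nonneg Nst_pos measurable_X depends_X)+
  have F: "measure S F \<le> q" "F \<in> sets S"
    unfolding F_def q_def by (intro prob_bad lam_nonneg N1(1) measurable_X depends_X)+
  have H: "measure S bad_grad \<le> q" "bad_grad \<in> sets S"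
    unfolding q_def by (rule prob_bad_grad)+
  have "space S - good \<subseteq> (\<Union>j\<le>T. E j) \<union> (F \<union> bad_grad)"
  proof
    fix w assume w: "w \<in> space S - good"
    show "w \<in> (\<Union>j\<le>T. E j) \<union> (F \<union> bad_grad)"
    proof (rule ccontr)
      assume n: "w \<notin> (\<Union>j\<le>T. E j) \<union> (F \<union> bad_grad)"
      have "fr y \<le> fr (pop_min 0 0) + (2 * real T + 4) * \<delta>" if "y \<in> result w" for y
      proof -
        have "fr y \<le> fr (pop_min 0 0) + (2 * real T + 3) * \<delta>"
          using w n that by (intro result_good[of w]) (auto simp: E_def F_def)
        also have "\<dots> \<le> fr (pop_min 0 0) + (2 * real T + 4) * \<delta>" using delta_pos by (intro add_left_mono mult_right_mono) auto
        finally show ?thesis .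
      qed
      then show False using w unfolding good_def by blast
    qed
  qed
  then have "measure S (space S - good) \<le> measure S ((\<Union>j\<le>T. E j) \<union> (F \<union> bad_grad))"
    using E F H by (intro P.finite_measure_mono) auto
  also have "\<dots> \<le> measure S (\<Union>j\<le>T. E j) + measure S (F \<union> bad_grad)"
    using E F H by (intro measure_Un_le) auto
  also have "measure S (\<Union>j\<le>T. E j) \<le> (\<Sum>j\<le>T. measure S (E j))"
    using E by (intro measure_UNION_le) auto
  also have "(\<Sum>j\<le>T. measure S (E j)) \<le> (\<Sum>j\<le>T. q)" using E by (intro sum_mono) auto
  also have "measure S (F \<union> bad_grad) \<le> measure S F + measure S bad_grad" using F H by (intro measure_Un_le) auto
  also have "\<dots> \<le> q + q" using F H by simp
  finally have "measure S (space S - good) \<le> (real T + 3) * q" by (simp add: algebra_simps)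
  then show ?thesis using P.prob_compl[OF sets_good] unfolding q_def by simp
qed

end

section \<open>Sample complexity\<close>

lemma real_nat_ceiling_le: "0 \<le> x \<Longrightarrow> real (nat \<lceil>x\<rceil>) \<le> x + 1"
  by linarith

lemma kappa_le_two_power_num_stages:
  assumes "\<kappa> > 0" shows "\<kappa> \<le> 2 ^ num_stages \<kappa>"
proof -
  have "\<kappa> = 2 powr (log 2 \<kappa>)" using assms by simp
  also have "\<dots> \<le> 2 powr real (num_stages \<kappa>)"
    unfolding num_stages_def by (intro powr_mono) linarith+
  also have "\<dots> = 2 ^ num_stages \<kappa>" by (simp add: powr_realpow)
  finally show ?thesis .
qed

lemma reg_params_ge: "0 < \<mu> \<Longrightarrow> \<mu> \<le> reg_params \<mu> i"
  by (simp add: reg_params_def)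

text \<open>Each of the \<open>T + 3\<close> batches costs at most \<open>2664 * (r * D) + 1\<close>
  samples per trial, the 1 from rounding up. The 2664 is 6 times 222 times the condition number,
  which the assumption on \<open>L\<close> keeps at most 2; for the gradients it is 12 times 222.
  The 5328 comes from \<open>D \<le> 2 * (real T + 3)\<close>.\<close>

lemma BoostERMC_samples_le:
  fixes \<mu> L lbar \<epsilon> :: real
  assumes pos: "\<mu> > 0" "L > 0" "lbar > 0" "\<epsilon> > 0" and L: "L \<le> reg_params \<mu> T"
  defines "r \<equiv> lbar^2 / (\<epsilon> * \<mu>)"
  shows "real (BoostERMC_samples \<mu> L lbar (reg_params \<mu>) (stage_accuracy T \<epsilon>) T m)
    \<le> real m * ((real T + 3) * (5328 * r * (real T + 3) + 1))"
proof -
  define \<delta> where "\<delta> = stage_accuracy T \<epsilon>"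
  define D where "D = 4 + 2 * real T"
  define lT where "lT = reg_params \<mu> T"
  define B where "B = 2664 * (r * D) + 1"
  have D: "D > 0" by (simp add: D_def)
  have r: "r > 0" using pos by (simp add: r_def)
  have \<delta>: "\<delta> = \<epsilon> / D" by (simp add: \<delta>_def stage_accuracy_def D_def)
  have \<delta>0: "\<delta> > 0" using \<delta> D pos by simp
  have rD: "r * D = lbar^2 / (\<mu> * \<delta>)" unfolding \<delta> r_def using D pos by simp
  have lT: "lT \<ge> \<mu>" "lT \<ge> L" using reg_params_ge[OF pos(1)] L by (auto simp: lT_def)
  have base: "lbar^2 / (a * \<delta>) \<le> r * D" if "a \<ge> \<mu>" for a
    unfolding rD using that pos \<delta>0 by (intro divide_left_mono mult_right_mono mult_pos_pos) auto
  have stage: "real (nat \<lceil>stage_size \<mu> lbar \<delta> (prev_reg (reg_params \<mu>) j)\<rceil>) \<le> B" for j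
  proof -
    define a where "a = \<mu> + prev_reg (reg_params \<mu>) j"
    have a: "a \<ge> \<mu>" using reg_params_ge[OF pos(1)] pos(1) order_trans[of 0 \<mu>]
      by (auto simp: a_def prev_reg_def reg_params_def split: nat.split)
    have eq: "stage_size \<mu> lbar \<delta> (prev_reg (reg_params \<mu>) j) = 54 * (lbar^2 / (a * \<delta>))"
      by (simp add: stage_size_def a_def)
    have nn: "0 \<le> lbar^2 / (a * \<delta>)" using a pos \<delta>0 by simp
    then have "real (nat \<lceil>54 * (lbar^2 / (a * \<delta>))\<rceil>) \<le> 54 * (lbar^2 / (a * \<delta>)) + 1"
      by (intro real_nat_ceiling_le) simp
    also have "\<dots> \<le> 2664 * (r * D) + 1" using base[OF a] nn by (intro add_mono mult_mono) auto
    finally show ?thesis unfolding eq B_def .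
  qed
  define \<mu>' where "\<mu>' = \<mu> + lT"
  define L' where "L' = L + lT"
  have \<mu>': "\<mu>' > 0" "\<mu>' \<ge> \<mu>" and L': "L' > 0" "L' \<ge> \<mu>" "L' \<le> 2 * \<mu>'"
    using lT pos by (auto simp: \<mu>'_def L'_def)
  have e': "gap_accuracy \<mu> L \<delta> lT = \<delta> * \<mu>' / (222 * L')" by (simp add: gap_accuracy_def \<mu>'_def L'_def)
  have N1: "real (nat \<lceil>gap_ERM_size \<mu> L lbar \<delta> lT\<rceil>) \<le> B"
  proof -
    have eq: "gap_ERM_size \<mu> L lbar \<delta> lT = 1332 * (L' / \<mu>') * (lbar^2 / (\<mu>' * \<delta>))"
      unfolding gap_ERM_size_def e' \<mu>'_def[symmetric] using \<mu>' L' \<delta>0 by (simp add: field_simps)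
    have "1332 * (L' / \<mu>') \<le> 2664" using L' \<mu>' by (simp add: pos_divide_le_eq)
    then have "1332 * (L' / \<mu>') * (lbar^2 / (\<mu>' * \<delta>)) \<le> 2664 * (r * D)"
      using base[OF \<mu>'(2)] \<mu>' \<delta>0 by (intro mult_mono) auto
    moreover have "0 \<le> 1332 * (L' / \<mu>') * (lbar^2 / (\<mu>' * \<delta>))" using L' \<mu>' \<delta>0 by simp
    ultimately show ?thesis unfolding eq B_def using real_nat_ceiling_le[of "1332 * (L' / \<mu>') * (lbar^2 / (\<mu>' * \<delta>))"]
      by linarith
  qed
  have n2: "real (gap_grad_size \<mu> L lbar \<delta> lT) \<le> B"
  proof -
    have "3 * (4 * lbar^2) / ((L' / \<mu>')^2 * \<mu>' * (\<delta> * \<mu>' / (222 * L'))) = 2664 * (lbar^2 / (L' * \<delta>))"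
      using \<mu>' L' \<delta>0 by (simp add: field_simps power2_eq_square)
    then have eq: "gap_grad_size \<mu> L lbar \<delta> lT = nat \<lceil>2664 * (lbar^2 / (L' * \<delta>))\<rceil>"
      by (simp add: gap_grad_size_def Let_def e' \<mu>'_def[symmetric] L'_def[symmetric])
    have "0 \<le> 2664 * (lbar^2 / (L' * \<delta>))" using L' \<delta>0 by simp
    from real_nat_ceiling_le[OF this] show ?thesis unfolding eq B_def using base[OF L'(2)] by linarith
  qed
  have "real (BoostERMC_samples \<mu> L lbar (reg_params \<mu>) \<delta> T m)
      = real m * ((\<Sum>j\<le>T. real (nat \<lceil>stage_size \<mu> lbar \<delta> (prev_reg (reg_params \<mu>) j)\<rceil>))
         + real (nat \<lceil>gap_ERM_size \<mu> L lbar \<delta> lT\<rceil>) + real (gap_grad_size \<mu> L lbar \<delta> lT))"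
    unfolding BoostERMC_samples_def lT_def[symmetric] by (simp only: of_nat_add of_nat_mult of_nat_sum distrib_left)
  also have "\<dots> \<le> real m * ((\<Sum>j\<le>T. B) + B + B)"
    using stage N1 n2 by (intro mult_left_mono add_mono sum_mono) auto
  also have "(\<Sum>j\<le>T. B) + B + B = (real T + 3) * B" by (simp add: algebra_simps)
  also have "real m * ((real T + 3) * B) \<le> real m * ((real T + 3) * (5328 * r * (real T + 3) + 1))"
  proof (intro mult_left_mono)
    have "r * D \<le> r * (2 * (real T + 3))" using r by (intro mult_left_mono) (auto simp: D_def)
    moreover have "5328 * r * (real T + 3) = 2664 * (r * (2 * (real T + 3)))" by simp
    ultimately show "B \<le> 5328 * r * (real T + 3) + 1" unfolding B_def by linarith
  qed auto
  finally show ?thesis unfolding \<delta>_def .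
qed

text \<open>The lower bound \<open>b\<close> on the three factors absorbs additive constants:
  \<open>b \<le> y\<close> gives \<open>1 \<le> y / b\<close>, so rounding errors and
  \<open>ln c2\<close> become multiples of the factors, with a witness that depends on
  \<open>b\<close> alone.\<close>

lemma BoostERMC_samples_bigo:
  fixes b :: real
  assumes b: "b > 0"
  shows "\<exists>C::real. \<forall>(\<mu>::real) (L::real) (lbar::real) (\<epsilon>::real) (p::real).
          let \<kappa> = L / \<mu>; T = num_stages \<kappa>; m = num_trials T p; \<delta> = stage_accuracy T \<epsilon> in
            \<mu> > 0 \<and> L > 0 \<and> lbar > 0 \<and> \<epsilon> > 0 \<and> 0 < p \<and> p < 1 \<and>
            b \<le> ln \<kappa> \<and> b \<le> ln (ln \<kappa> / p) \<and> b \<le> lbar^2 / (\<epsilon> * \<mu>) \<longrightarrow>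
            real (BoostERMC_samples \<mu> L lbar (reg_params \<mu>) \<delta> T m)
              \<le> C * ((ln \<kappa>)^2 * ln (ln \<kappa> / p) * (lbar^2 / (\<epsilon> * \<mu>)))"
proof -
  \<comment> \<open>\<open>c2\<close> bounds \<open>real T + 3\<close> by
    \<open>ln \<kappa>\<close>, the 4 being 3 plus one for the ceiling. \<open>c3\<close> bounds the
    number of trials, where \<open>c2\<close> enters through a logarithm. \<open>c4\<close> absorbs
    the rounding of the batches, using \<open>3 \<le> real T + 3\<close>.\<close>
  define c2 where "c2 = 1 / ln 2 + 4 / b"
  define c3 where "c3 = 18 * (\<bar>ln c2\<bar> / b + 1) + 1 / b"
  define c4 where "c4 = 5328 + 1 / (b * 3)"
  have ln2: "ln 2 > (0::real)" by simp
  have c2: "c2 > 0" unfolding c2_def using b ln2 by (intro add_pos_pos divide_pos_pos) auto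
  have c3: "c3 > 0" unfolding c3_def using b by (intro add_nonneg_pos mult_nonneg_nonneg add_nonneg_nonneg) auto
  have c4: "c4 > 0" unfolding c4_def using b by (intro add_pos_pos) auto
  show ?thesis
    unfolding Let_def
  proof (intro exI[of _ "c3 * (c2^2 * c4)"] allI impI, elim conjE)
    fix \<mu> L lbar \<epsilon> p :: real
    assume pos: "\<mu> > 0" "L > 0" "lbar > 0" "\<epsilon> > 0" and p: "0 < p" "p < 1"
      and a: "b \<le> ln (L / \<mu>)" and q: "b \<le> ln (ln (L / \<mu>) / p)" and r: "b \<le> lbar^2 / (\<epsilon> * \<mu>)"
    define \<kappa> where "\<kappa> = L / \<mu>"
    define T where "T = num_stages \<kappa>"
    define m where "m = num_trials T p"
    define A where "A = ln \<kappa>"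
    define Q where "Q = ln (A / p)"
    define R where "R = lbar^2 / (\<epsilon> * \<mu>)"
    have A: "b \<le> A" and Q: "b \<le> Q" and R: "b \<le> R" using a q r by (simp_all add: A_def Q_def R_def \<kappa>_def)
    have \<kappa>: "\<kappa> > 0" using pos by (simp add: \<kappa>_def)
    have one: "1 \<le> y / b" if "b \<le> y" for y using that b by simp
    have T3: "real T + 3 \<le> c2 * A"
    proof -
      have "0 \<le> log 2 \<kappa>" unfolding log_def A_def[symmetric] using A b by (intro divide_nonneg_pos) auto
      then have "real T \<le> log 2 \<kappa> + 1" unfolding T_def num_stages_def by (rule real_nat_ceiling_le)
      also have "log 2 \<kappa> = A / ln 2" by (simp add: A_def log_def)
      finally have "real T + 3 \<le> A / ln 2 + 4 * 1" by simp
      also have "\<dots> \<le> A / ln 2 + 4 * (A / b)" using one[OF A] by simp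
      finally show ?thesis by (simp add: c2_def distrib_right)
    qed
    have M: "real m \<le> c3 * Q"
    proof -
      have "1 \<le> (real T + 3) / p" using p by simp
      then have "0 \<le> 18 * ln ((real T + 3) / p)" by (intro mult_nonneg_nonneg ln_ge_zero) auto
      then have "real m \<le> 18 * ln ((real T + 3) / p) + 1" unfolding m_def num_trials_def by (rule real_nat_ceiling_le)
      also have "ln ((real T + 3) / p) \<le> ln (c2 * (A / p))"
      proof -
        have "(real T + 3) / p \<le> c2 * A / p" using T3 p by (intro divide_right_mono) auto
        moreover have "0 < (real T + 3) / p" using p by (intro divide_pos_pos) auto
        ultimately show ?thesis by (metis ln_mono times_divide_eq_right)
      qed
      also have "ln (c2 * (A / p)) = ln c2 + Q" unfolding Q_def using c2 A b p by (intro ln_mult_pos) auto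
      also have "ln c2 + Q \<le> \<bar>ln c2\<bar> * (Q / b) + Q"
      proof -
        have "\<bar>ln c2\<bar> * 1 \<le> \<bar>ln c2\<bar> * (Q / b)" using one[OF Q] by (intro mult_left_mono) auto
        then show ?thesis using abs_ge_self[of "ln c2"] by linarith
      qed
      finally have "real m \<le> 18 * (\<bar>ln c2\<bar> * (Q / b) + Q) + 1" by simp
      also have "\<dots> \<le> 18 * (\<bar>ln c2\<bar> * (Q / b) + Q) + Q / b" using one[OF Q] by simp
      also have "\<dots> = c3 * Q" by (simp add: c3_def algebra_simps)
      finally show ?thesis .
    qed
    have "L \<le> reg_params \<mu> T"
      using kappa_le_two_power_num_stages[OF \<kappa>] pos unfolding T_def reg_params_def \<kappa>_def
      by (simp add: pos_divide_le_eq mult.commute)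
    then have "real (BoostERMC_samples \<mu> L lbar (reg_params \<mu>) (stage_accuracy T \<epsilon>) T m)
        \<le> real m * ((real T + 3) * (5328 * R * (real T + 3) + 1))"
      unfolding R_def by (rule BoostERMC_samples_le[OF pos])
    also have "\<dots> \<le> (c3 * Q) * ((real T + 3) * (c4 * R * (real T + 3)))"
    proof (intro mult_mono M mult_left_mono)
      define u where "u = R / (b * 3) * (real T + 3)"
      have "3 \<le> real T + 3" by simp
      then have "1 * 3 \<le> R / b * (real T + 3)" using one[OF R] R b by (intro mult_mono) auto
      moreover have "R / b * (real T + 3) = 3 * u" unfolding u_def using b by simp
      ultimately have "1 \<le> u" by linarith
      moreover have "c4 * R * (real T + 3) = 5328 * R * (real T + 3) + u"
        by (simp add: c4_def u_def distrib_right)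
      ultimately show "5328 * R * (real T + 3) + 1 \<le> c4 * R * (real T + 3)" by linarith
      show "0 \<le> c3 * Q" using c3 Q b by simp
      have "0 \<le> 5328 * R * (real T + 3)" using R b by (intro mult_nonneg_nonneg) auto
      then show nn: "0 \<le> 5328 * R * (real T + 3) + 1" by linarith
      show "0 \<le> (real T + 3) * (5328 * R * (real T + 3) + 1)" by (intro mult_nonneg_nonneg nn) auto
    qed auto
    also have "\<dots> = (c3 * Q * c4 * R) * (real T + 3)^2" by (simp add: power2_eq_square)
    also have "\<dots> \<le> (c3 * Q * c4 * R) * (c2 * A)^2"
      using T3 c3 c4 Q R b by (intro mult_left_mono power_mono mult_nonneg_nonneg) auto
    also have "\<dots> = c3 * (c2^2 * c4) * (A^2 * Q * R)" by (simp add: power_mult_distrib)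
    finally show "real (BoostERMC_samples \<mu> L lbar (reg_params \<mu>) (stage_accuracy (num_stages (L / \<mu>)) \<epsilon>) (num_stages (L / \<mu>))
          (num_trials (num_stages (L / \<mu>)) p))
        \<le> c3 * (c2^2 * c4) * ((ln (L / \<mu>))^2 * ln (ln (L / \<mu>) / p) * (lbar^2 / (\<epsilon> * \<mu>)))"
      unfolding A_def Q_def R_def \<kappa>_def T_def m_def .
  qed
qed

section \<open>Changing the integrand on a null set of samples\<close>

lemma ERM_calls_objective_cong:
  assumes "\<And>i y. g y (w i) = g' y (w i)"
  shows "ERM_calls g h w N lam x s m = ERM_calls g' h w N lam x s m"
proof -
  have "(\<Sum>z\<leftarrow>map w js. g y z) = (\<Sum>z\<leftarrow>map w js. g' y z)" for js y
    using assms by (simp add: comp_def)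
  then have "empirical_objective g h (map w js) lam x = empirical_objective g' h (map w js) lam x" for js
    unfolding empirical_objective_def length_map by (simp only:)
  then show ?thesis unfolding ERM_calls_def by (simp only:)
qed

lemma gradient_calls_objective_cong:
  assumes "\<And>i y. g y (w i) = g' y (w i)"
  shows "gradient_calls g w n lam xT xhat s m = gradient_calls g' w n lam xT xhat s m"
  unfolding gradient_calls_def map_map comp_def using assms by simp

text \<open>A run evaluates \<open>g\<close> only at the samples of its stream, so integrands that
  agree there give the same run, including every arbitrary choice.\<close>

lemma run_BoostERMC_objective_cong:
  assumes "\<And>i y. g y (w i) = g' y (w i)"
  shows "run_state (BoostERMC g h pick w \<mu> L lbar lam \<delta> T m) 0 = run_state (BoostERMC g' h pick w \<mu> L lbar lam \<delta> T m) 0"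
proof -
  have "stage_point g h pick \<mu> lbar lam \<delta> m w j = stage_point g' h pick \<mu> lbar lam \<delta> m w j" for j
  proof (induction j)
    case (Suc j)
    show ?case
      unfolding stage_point.simps Let_def Suc ERM_calls_objective_cong[of g w g', OF assms] by (rule refl)
  qed simp
  then show ?thesis
    unfolding run_BoostERMC run_robust_gap_step
    by (simp only: ERM_calls_objective_cong[of g w g', OF assms] gradient_calls_objective_cong[of g w g', OF assms])
qed

lemma (in boosting) in_result_iff:
  assumes w: "w \<in> space S" and e: "e = (2 * real T + 4) * \<delta>"
  shows "(\<forall>x\<in>result w. (ereal (gbar x) + h x) - (INF y. ereal (gbar y) + h y) \<le> ereal e) \<longleftrightarrow> w \<in> good"
proof -
  have "(ereal (gbar x) + h x) - (INF y. ereal (gbar y) + h y) \<le> ereal e \<longleftrightarrow> fr x \<le> fr (pop_min 0 0) + e"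
    if "x \<in> result w" for x
  proof -
    have "x \<in> C" using that us_in_C[OF w extract_lt] unfolding result_def by blast
    then show ?thesis unfolding INF_objective[of 0] by (auto simp: h_eq_hr fr_def)
  qed
  then show ?thesis unfolding good_def e using w by auto
qed

text \<open>\<open>A\<close> differs from the measurable set \<open>B\<close> by a subset of a null
  set, so it is measurable in the completion; its measurability in \<open>Q\<close> itself need not
  be decided.\<close>

lemma completion_measure_ge:
  assumes "prob_space Q" and B: "B \<in> sets Q" and N: "N \<in> null_sets Q"
    and eq: "\<And>w. w \<in> space Q \<Longrightarrow> w \<notin> N \<Longrightarrow> w \<in> A \<longleftrightarrow> w \<in> B" and A: "A \<subseteq> space Q"
  shows "measure (completion Q) A \<ge> measure Q B"
proof -
  interpret prob_space Q by fact
  interpret c: prob_space "completion Q" by (rule prob_space_completion)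
  have BN: "B - N \<in> sets Q" using B N by auto
  have "A \<in> sets (completion Q)"
  proof (rule sets_completionI[OF _ _ N BN])
    show "A = (B - N) \<union> (A \<inter> N)" using eq A sets.sets_into_space[OF B] by auto
  qed auto
  moreover have "B - N \<subseteq> A" using eq sets.sets_into_space[OF B] by auto
  ultimately have "measure (completion Q) (B - N) \<le> measure (completion Q) A" by (intro c.finite_measure_mono)
  moreover have "measure (completion Q) (B - N) = measure Q (B - N)" by (rule measure_completion[OF BN])
  moreover have "measure Q (B - N) = measure Q B" by (rule measure_Diff_null_set[OF B N])
  ultimately show ?thesis by simp
qed

theorem corollary6p9:
  fixes P :: "'z measure"
    and g :: "'a::euclidean_space \<Rightarrow> 'z \<Rightarrow> real"
    and gbar :: "'a \<Rightarrow> real"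
    and h f :: "'a \<Rightarrow> ereal"
    and ell :: "'z \<Rightarrow> real"
    and U :: "'a set"
    and \<mu> L lbar \<epsilon> p \<delta> \<kappa> :: real
    and lam :: "nat \<Rightarrow> real"
    and T m :: nat
    and pick :: "'z list \<Rightarrow> nat set \<Rightarrow> nat"
    and M :: "(nat \<Rightarrow> 'z) measure"
  assumes "prob_space P"
    and g_measurable: "(\<lambda>(x, z). g x z) \<in> borel_measurable (borel \<Otimes>\<^sub>M P)"
    and g_integrable: "\<And>x. integrable P (g x)"
    and gbar_def: "gbar = (\<lambda>x. \<integral>z. g x z \<partial>P)"
    and f_def: "f = (\<lambda>x. ereal (gbar x) + h x)"
    and f_closed: "closed_fun f"
    and h_not_minus_inf: "\<And>x. h x \<noteq> -\<infinity>"
    and h_proper: "effdom h \<noteq> {}"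
    and h_convex: "convex_fun h"
    and mu_pos: "\<mu> > 0"
    and strong_convexity: "AE z in P. strongly_convex_fun \<mu> (\<lambda>x. ereal (g x z) + h x)"
    and U_nbhd: "open U" "effdom h \<subseteq> U"
    and ell_measurable: "ell \<in> borel_measurable P"
    and lbar_pos: "lbar > 0"
    and ell_square_integrable: "integrable P (\<lambda>z. (ell z)\<^sup>2)"
    and ell_bound: "sqrt (\<integral>z. (ell z)\<^sup>2 \<partial>P) \<le> lbar"
    and g_lipschitz: "\<And>x y z. x \<in> U \<Longrightarrow> y \<in> U \<Longrightarrow> z \<in> space P \<Longrightarrow>
                        \<bar>g x z - g y z\<bar> \<le> ell z * norm (x - y)"
    and L_pos: "L > 0"
    and gbar_smooth: "smooth_fun L gbar"
    and g_gradient_exists: "\<And>x. x \<in> effdom h \<Longrightarrow> AE z in P. \<exists>D. GDERIV (\<lambda>y. g y z) x :> D"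
    and pick_mem: "\<And>zs I. finite I \<Longrightarrow> I \<noteq> {} \<Longrightarrow> pick zs I \<in> I"
    and pick_measurable: "\<And>s I. finite I \<Longrightarrow> I \<noteq> {} \<Longrightarrow>
                            (\<lambda>w. pick (map w [0..<s]) I)
                            \<in> measurable (\<Pi>\<^sub>M i\<in>(UNIV :: nat set). P) (count_space UNIV)"
    and M_def: "M = completion (\<Pi>\<^sub>M i\<in>(UNIV :: nat set). P)"
    and eps_pos: "\<epsilon> > 0"
    and p_range: "0 < p" "p < 1"
    and kappa_def: "\<kappa> = L / \<mu>"
    and T_def: "T = num_stages \<kappa>"
    and m_def: "m = num_trials T p"
    and delta_def: "\<delta> = stage_accuracy T \<epsilon>"
    and lam_def: "lam = reg_params \<mu>"
  shows
    "measure M {w \<in> space M.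
        \<forall>x \<in> fst (run_state (BoostERMC g h pick w \<mu> L lbar lam \<delta> T m) 0).
          f x - (INF y. f y) \<le> ereal \<epsilon>} \<ge> 1 - p
     \<and> (odd m \<longrightarrow> (\<forall>w. fst (run_state (BoostERMC g h pick w \<mu> L lbar lam \<delta> T m) 0) \<noteq> {}))
     \<and> (\<forall>w. snd (run_state (BoostERMC g h pick w \<mu> L lbar lam \<delta> T m) 0)
              = BoostERMC_samples \<mu> L lbar lam \<delta> T m)
     \<and> (\<forall>b>0. \<exists>C::real. \<forall>(\<mu>::real) (L::real) (lbar::real) (\<epsilon>::real) (p::real).
          let \<kappa> = L / \<mu>; T = num_stages \<kappa>; m = num_trials T p; \<delta> = stage_accuracy T \<epsilon> in
            \<mu> > 0 \<and> L > 0 \<and> lbar > 0 \<and> \<epsilon> > 0 \<and> 0 < p \<and> p < 1 \<and>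
            b \<le> ln \<kappa> \<and> b \<le> ln (ln \<kappa> / p) \<and> b \<le> lbar\<^sup>2 / (\<epsilon> * \<mu>) \<longrightarrow>
            real (BoostERMC_samples \<mu> L lbar (reg_params \<mu>) \<delta> T m)
              \<le> C * ((ln \<kappa>)\<^sup>2 * ln (ln \<kappa> / p) * (lbar\<^sup>2 / (\<epsilon> * \<mu>))))"
proof (intro conjI allI impI)
  interpret pr: prob_space P by fact
  have \<kappa>: "\<kappa> > 0" using L_pos mu_pos kappa_def by simp
  define Sc where "Sc = (\<lambda>z. strongly_convex_fun \<mu> (\<lambda>x. ereal (g x z) + h x))"
  obtain N where N: "{z \<in> space P. \<not> Sc z} \<subseteq> N" "N \<in> null_sets P"
    using AE_E[OF strong_convexity[folded Sc_def]] by (metis null_setsI)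
  have "space P - N \<noteq> {}"
  proof
    assume "space P - N = {}"
    then have "measure P (space P) \<le> measure P N" using N(2) by (intro pr.finite_measure_mono) auto
    then show False using N(2) pr.prob_space by (simp add: measure_eq_0_null_sets)
  qed
  then obtain z0 where z0: "z0 \<in> space P" "z0 \<notin> N" by auto
  \<comment> \<open>Samples in the null set \<open>N\<close> are replaced by one fixed sample
    \<open>z0\<close> outside it. Composing with \<open>c\<close> makes strong convexity hold for
    every sample and changes integrands only on a null set.\<close>
  define c where "c = (\<lambda>z. if z \<in> N then z0 else z)"
  have [measurable]: "N \<in> sets P" using N by auto
  have c [measurable]: "c \<in> measurable P P" unfolding c_def using z0 by measurable
  have cN: "c z \<in> space P" "c z \<notin> N" if "z \<in> space P" for z using that z0 by (auto simp: c_def)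
  have AEc: "AE z in P. c z = z" using AE_not_in[OF N(2)] by eventually_elim (simp add: c_def)
  define g' where "g' = (\<lambda>x z. g x (c z))"
  define ell' where "ell' = (\<lambda>z. \<bar>ell (c z)\<bar>)"
  have ell'_sq: "integrable P (\<lambda>z. (ell' z)^2)" "(\<integral>z. (ell' z)^2 \<partial>P) = (\<integral>z. (ell z)^2 \<partial>P)"
  proof -
    have ae: "AE z in P. (ell z)^2 = (ell' z)^2" using AEc by eventually_elim (simp add: ell'_def)
    have m: "ell' \<in> borel_measurable P" unfolding ell'_def using ell_measurable by measurable
    show "integrable P (\<lambda>z. (ell' z)^2)"
      using integrable_cong_AE[OF _ _ ae] ell_square_integrable m by (auto dest: borel_measurable_integrable)
    show "(\<integral>z. (ell' z)^2 \<partial>P) = (\<integral>z. (ell z)^2 \<partial>P)"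
      using integral_cong_AE[OF _ _ ae] ell_square_integrable m by (auto dest: borel_measurable_integrable)
  qed
  have g'_int: "integrable P (g' x)" "(\<integral>z. g' x z \<partial>P) = (\<integral>z. g x z \<partial>P)" for x
  proof -
    have ae: "AE z in P. g x z = g' x z" using AEc by eventually_elim (simp add: g'_def)
    have m: "g x \<in> borel_measurable P" using g_integrable by auto
    have m': "g' x \<in> borel_measurable P" unfolding g'_def by (rule measurable_compose[OF c m])
    show "integrable P (g' x)" using integrable_cong_AE[OF m m' ae] g_integrable by simp
    show "(\<integral>z. g' x z \<partial>P) = (\<integral>z. g x z \<partial>P)" using integral_cong_AE[OF m m' ae] by simp
  qed
  have gb: "(\<lambda>x. \<integral>z. g' x z \<partial>P) = gbar" by (simp add: g'_int gbar_def)
  \<comment> \<open>Closedness is assumed for \<open>f\<close>. As \<open>gbar\<close> is finite and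
    continuous, the epigraph of \<open>h\<close> is the preimage of that of \<open>f\<close> under a
    continuous shear.\<close>
  have hcl: "closed (epi h)"
  proof -
    note gc = continuous_on_smooth_fun[OF gbar_smooth]
    have "continuous_on UNIV (\<lambda>p::'a \<times> real. (fst p, snd p + gbar (fst p)))"
      by (intro continuous_intros continuous_on_compose2[OF gc]) auto
    moreover have "epi h = (\<lambda>p. (fst p, snd p + gbar (fst p))) -` epi f"
    proof -
      have "h x \<le> ereal t \<longleftrightarrow> ereal (gbar x) + h x \<le> ereal (t + gbar x)" for x t
        by (cases "h x") auto
      then show ?thesis by (auto simp: epi_def f_def)
    qed
    ultimately show ?thesis using f_closed closed_vimage[of "epi f"] by (simp add: closed_fun_def)
  qed
  have T: "L \<le> lam T"
    using kappa_le_two_power_num_stages[OF \<kappa>] mu_pos unfolding lam_def reg_params_def T_def kappa_def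
    by (simp add: pos_divide_le_eq mult.commute)
  have m_pos: "m > 0"
  proof -
    have "1 < (real T + 3) / p" using p_range by (simp add: pos_less_divide_eq)
    then have "0 < ln ((real T + 3) / p)" by (rule ln_gt_zero)
    then show ?thesis unfolding m_def num_trials_def by simp
  qed
  have \<delta>: "\<delta> > 0" "(2 * real T + 4) * \<delta> = \<epsilon>"
  proof -
    have "4 + 2 * real T > 0" by simp
    then show "\<delta> > 0" "(2 * real T + 4) * \<delta> = \<epsilon>" using eps_pos unfolding delta_def stage_accuracy_def by (simp_all add: add.commute)
  qed
  interpret boosting P g' h ell' U \<mu> L lbar lam \<delta> T m pick
  proof (unfold_locales)
    have "(\<lambda>p. (fst p, c (snd p))) \<in> measurable (borel \<Otimes>\<^sub>M P) (borel \<Otimes>\<^sub>M P)" by measurable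
    from measurable_compose[OF this g_measurable]
    show "(\<lambda>(x, z). g' x z) \<in> borel_measurable (borel \<Otimes>\<^sub>M P)" by (simp add: g'_def split_beta')
    show "integrable P (g' x)" for x by (rule g'_int)
    show "closed (epi h)" by (rule hcl)
    show "h x \<noteq> -\<infinity>" for x by (rule h_not_minus_inf)
    show "effdom h \<noteq> {}" by (rule h_proper)
    show "strongly_convex_fun \<mu> (\<lambda>x. ereal (g' x z) + h x)" if "z \<in> space P" for z
    proof -
      have "Sc (c z)" using cN[OF that] N(1) by blast
      then show ?thesis by (simp only: Sc_def g'_def)
    qed
    show "ell' \<in> borel_measurable P" unfolding ell'_def using ell_measurable by measurable
    show "0 \<le> ell' z" for z by (simp add: ell'_def)
    show "integrable P (\<lambda>z. (ell' z)^2)" by (rule ell'_sq)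
    show "(\<integral>z. (ell' z)^2 \<partial>P) \<le> lbar^2" unfolding ell'_sq by (rule sqrt_le_D[OF ell_bound])
    show "\<bar>g' x z - g' y z\<bar> \<le> ell' z * norm (x - y)" if "x \<in> U" "y \<in> U" "z \<in> space P" for x y z
    proof -
      have "\<bar>g' x z - g' y z\<bar> \<le> ell (c z) * norm (x - y)"
        unfolding g'_def by (rule g_lipschitz[OF that(1,2) cN(1)[OF that(3)]])
      also have "\<dots> \<le> ell' z * norm (x - y)" unfolding ell'_def by (intro mult_right_mono) auto
      finally show ?thesis .
    qed
    show "smooth_fun L (\<lambda>x. \<integral>z. g' x z \<partial>P)" unfolding gb by (rule gbar_smooth)
    show "AE z in P. \<exists>D. GDERIV (\<lambda>y. g' y z) x :> D" if "x \<in> effdom h" for x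
      using g_gradient_exists[OF that] AEc by eventually_elim (simp add: g'_def)
    show "0 \<le> lam j" for j using mu_pos by (simp add: lam_def reg_params_def)
    show "prev_reg lam (Suc j) \<le> 2 * (\<mu> + prev_reg lam j)" for j
      using mu_pos by (cases j) (simp_all add: lam_def reg_params_def prev_reg_def)
    show "\<mu> \<le> lam T" unfolding lam_def by (rule reg_params_ge[OF mu_pos])
  qed (fact mu_pos U_nbhd lbar_pos L_pos \<delta> m_pos pick_mem pick_measurable)+
  have gb': "composite.gbar P g' = gbar" using gb by (simp add: gbar_def[abs_def])
  define A where "A = {w \<in> space M. \<forall>x \<in> fst (run_state (BoostERMC g h pick w \<mu> L lbar lam \<delta> T m) 0).
          f x - (INF y. f y) \<le> ereal \<epsilon>}"
  have spM: "space M = space S" by (simp add: M_def)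
  have "AE w in S. w i \<notin> N" for i
    using AE_PiM_component[of UNIV "\<lambda>_. P" i "\<lambda>z. z \<notin> N"] AE_not_in[OF N(2)] prob_space_M by simp
  \<comment> \<open>A stream has countably many samples, so almost surely none lies in
    \<open>N\<close>; on such a stream \<open>c\<close> fixes every sample, and the runs with
    \<open>g\<close> and \<open>g'\<close> coincide.\<close>
  then have "AE w in S. \<forall>i. w i \<notin> N" by (simp add: AE_all_countable)
  from AE_E[OF this] obtain N' where N'1: "{w \<in> space S. \<not> (\<forall>i. w i \<notin> N)} \<subseteq> N'" "emeasure S N' = 0" "N' \<in> sets S"
    by blast
  have N': "{w \<in> space S. \<not> (\<forall>i. w i \<notin> N)} \<subseteq> N'" "N' \<in> null_sets S"
    by (fact N'1(1)) (rule null_setsI[OF N'1(2,3)])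
  have "measure M A \<ge> measure S good"
    unfolding M_def
  proof (rule completion_measure_ge[OF P.prob_space_axioms sets_good N'(2)])
    show "A \<subseteq> space S" by (auto simp: A_def spM)
    fix w assume w: "w \<in> space S" "w \<notin> N'"
    then have "w i \<notin> N" for i using N'(1) by blast
    then have eq: "g y (w i) = g' y (w i)" for i y by (simp add: g'_def c_def)
    have "w \<in> A \<longleftrightarrow> (\<forall>x\<in>result w. f x - (INF y. f y) \<le> ereal \<epsilon>)"
      unfolding A_def spM using w(1) run_BoostERMC_objective_cong[of g w g', OF eq] fst_run_eq_result[of w] by simp
    also have "\<dots> \<longleftrightarrow> w \<in> good"
      using in_result_iff[OF w(1), of \<epsilon>] \<delta>(2) unfolding f_def gb' by simp
    finally show "w \<in> A \<longleftrightarrow> w \<in> good" .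
  qed
  \<comment> \<open>The number of trials is chosen so that a single failure has probability at most
    \<open>p / (real T + 3)\<close>.\<close>
  moreover have "(real T + 3) * exp (- real m / 18) \<le> p"
  proof -
    have "18 * ln ((real T + 3) / p) \<le> real m" unfolding m_def num_trials_def by linarith
    then have "- real m / 18 \<le> - ln ((real T + 3) / p)" by simp
    then have "exp (- real m / 18) \<le> exp (- ln ((real T + 3) / p))" by simp
    also have "\<dots> = p / (real T + 3)" using p_range by (simp add: exp_minus exp_ln)
    finally show ?thesis by (simp add: pos_le_divide_eq mult.commute)
  qed
  ultimately have "measure M A \<ge> 1 - p" using prob_good by linarith
  then show "measure M {w \<in> space M. \<forall>x \<in> fst (run_state (BoostERMC g h pick w \<mu> L lbar lam \<delta> T m) 0).
          f x - (INF y. f y) \<le> ereal \<epsilon>} \<ge> 1 - p"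
    unfolding A_def .
qed (erule BoostERMC_nonempty_if_odd, rule snd_run_BoostERMC, erule BoostERMC_samples_bigo)

end
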